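(* Let $\mathcal F$ be a hyperbolic singular holomorphic foliation by curves on a complex manifold $M$ of dimension $m$ with singular set $E\subset M$ of dimension $k$, let $g$ be a hermitian metric on $M$, and let $\eta:M\setminus E\to(0,\infty)$ be the modulus of uniformization of $\mathcal F$. Suppose that the space of uniformizations $\mathcal U$ is NCP. Suppose that for each $q\in E$ there exist a neighbourhood $U_q$ of $q$ in $M$ and $m-k$ local $\mathcal F$-invariant hypersurfaces $\Sigma_{q,1},\Sigma_{q,2},\ldots,\Sigma_{q,m-k}$ in $U_q$ such that $q\in\bigcap_{i=1}^{m-k}\Sigma_{q,i}\subset U_q\cap E$. Then $\eta$ is continuous on $M\setminus E$.
   Context: A singular holomorphic foliation by curves (shfc) $\mathcal F$ on a complex manifold $M$ with singular set $E$ is a foliation locally generated by holomorphic vector fields whose zero set is $E$, where $E\subset M$ is a complex analytic set of codimension at least $2$; it is a nonsingular holomorphic foliation by Riemann surfaces on $M\setminus E$. Leaves are the leaves on $M\setminus E$. $\mathcal F$ is hyperbolic if every leaf is a hyperbolic Riemann surface (universally covered by the unit disc $\mathbb D$). Modulus of uniformization: let $\mathcal O(\mathbb D,\mathcal F)$ be the set of holomorphic maps $f:\mathbb D\to M\setminus E$ whose image lies in a single leaf. For $z\in M\setminus E$, $\eta(z)=\sup\{|f'(0)|_g : f\in\mathcal O(\mathbb D,\mathcal F),\ f(0)=z\}$, where $|\cdot|_g$ is the length with respect to $g$. $\mathcal U=\{\alpha\in\mathcal O(\mathbb D,\mathcal F): \alpha \text{ is a uniformization (universal covering map) of a leaf of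 }\mathcal F\}$. $\mathcal U$ is NCP (normal on compact parts) if for every $\mathcal H\subset\mathcal U$ with $\{\alpha(0):\alpha\in\mathcal H\}$ relatively compact in $M$, the family $\mathcal H$ is normal, i.e. every sequence in $\mathcal H$ has a subsequence converging uniformly on compact subsets of $\mathbb D$ to a holomorphic map $\mathbb D\to M$. A local $\mathcal F$-invariant hypersurface in $U_q$ is an analytic hypersurface $\Sigma=\{f=0\}$ of $U_q$, with $f$ holomorphic on $U_q$, such that for each $p\in\Sigma\setminus E$ the leaf through $p$ of the restricted foliation $\mathcal F|_{U_q}$ is contained in $\Sigma$. *)

theory Defs
  imports "HOL-Complex_Analysis.Complex_Analysis"
begin

section \<open>Several complex variables and smoothness\<close>

text \<open>Complex differentiability at every point of an open set: the real derivative is the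
  complex linear form with coefficients \<open>a\<close>, the complex gradient.\<close>

definition holomorphic_mv :: "(complex^'m \<Rightarrow> complex) \<Rightarrow> (complex^'m::finite) set \<Rightarrow> bool" where
  "holomorphic_mv f S \<longleftrightarrow>
     (\<forall>x\<in>S. \<exists>a. (f has_derivative (\<lambda>v. \<Sum>i\<in>UNIV. a $ i * v $ i)) (at x))"

text \<open>Real differentiability class \<open>C^n\<close> on an open set.\<close>

fun C_class :: "nat \<Rightarrow> ('b::euclidean_space \<Rightarrow> 'c::real_normed_vector) \<Rightarrow> 'b set \<Rightarrow> bool" where
  "C_class 0 f S \<longleftrightarrow> continuous_on S f"
| "C_class (Suc n) f S \<longleftrightarrow>
     (\<forall>x\<in>S. f differentiable (at x)) \<and> (\<forall>v. C_class n (\<lambda>x. frechet_derivative f (at x) v) S)"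

definition smooth_on :: "('b::euclidean_space \<Rightarrow> 'c::real_normed_vector) \<Rightarrow> 'b set \<Rightarrow> bool" where
  "smooth_on f S \<longleftrightarrow> (\<forall>n. C_class n f S)"


section \<open>Complex manifolds\<close>

text \<open>The manifold is a whole (Hausdorff, second countable) type \<open>'a\<close>, its dimension is
  \<open>CARD('m)\<close>. A chart is its domain together with a coordinate map, which is only
  meaningful on the domain.\<close>

type_synonym ('a, 'm) chart = "'a set \<times> ('a \<Rightarrow> complex^'m)"

definition transition ::
    "('a, 'm::finite) chart \<Rightarrow> ('a, 'm) chart \<Rightarrow> complex^'m \<Rightarrow> complex^'m" where
  "transition c d = (\<lambda>x. snd d (inv_into (fst c) (snd c) x))"

definition topological_chart :: "('a::topological_space, 'm::finite) chart \<Rightarrow> bool" where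
  "topological_chart c \<longleftrightarrow>
     open (fst c) \<and> open (snd c ` fst c) \<and> (\<exists>\<psi>. homeomorphism (fst c) (snd c ` fst c) (snd c) \<psi>)"

definition holomorphic_transition :: "('a, 'm::finite) chart \<Rightarrow> ('a, 'm) chart \<Rightarrow> bool" where
  "holomorphic_transition c d \<longleftrightarrow>
     (\<forall>i. holomorphic_mv (\<lambda>x. transition c d x $ i) (snd c ` (fst c \<inter> fst d)))"

text \<open>A complex structure is a maximal holomorphic atlas.\<close>

definition complex_structure :: "('a::topological_space, 'm::finite) chart set \<Rightarrow> bool" where
  "complex_structure A \<longleftrightarrow>
     (\<forall>c\<in>A. topological_chart c) \<and>
     (\<Union>c\<in>A. fst c) = UNIV \<and>
     (\<forall>c\<in>A. \<forall>d\<in>A. holomorphic_transition c d) \<and>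
     (\<forall>c. topological_chart c \<longrightarrow>
        (\<forall>d\<in>A. holomorphic_transition c d \<and> holomorphic_transition d c) \<longrightarrow> c \<in> A)"

definition holomorphic_fun ::
    "('a, 'm::finite) chart set \<Rightarrow> ('a \<Rightarrow> complex) \<Rightarrow> 'a set \<Rightarrow> bool" where
  "holomorphic_fun A f W \<longleftrightarrow>
     (\<forall>c\<in>A. holomorphic_mv (\<lambda>x. f (inv_into (fst c) (snd c) x)) (snd c ` (fst c \<inter> W)))"

text \<open>Holomorphic maps from the unit disc to the manifold (the values outside the disc
  are irrelevant).\<close>

definition holomorphic_disc ::
    "('a::topological_space, 'm::finite) chart set \<Rightarrow> (complex \<Rightarrow> 'a) \<Rightarrow> bool" where
  "holomorphic_disc A f \<longleftrightarrow>
     continuous_on (ball 0 1) f \<and>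
     (\<forall>c\<in>A. \<forall>i. (\<lambda>t. snd c (f t) $ i) holomorphic_on {t \<in> ball 0 1. f t \<in> fst c})"


section \<open>Analytic sets and their dimension\<close>

definition analytic_set ::
    "('a::topological_space, 'm::finite) chart set \<Rightarrow> 'a set \<Rightarrow> bool" where
  "analytic_set A E \<longleftrightarrow>
     (\<forall>p. \<exists>U H. open U \<and> p \<in> U \<and> finite H \<and> (\<forall>h\<in>H. holomorphic_fun A h U) \<and>
        E \<inter> U = {x \<in> U. \<forall>h\<in>H. h x = 0})"

text \<open>Near \<open>p\<close>, the set is a complex submanifold of dimension \<open>d\<close>.\<close>

definition regular_point ::
    "('a, 'm::finite) chart set \<Rightarrow> 'a set \<Rightarrow> 'a \<Rightarrow> nat \<Rightarrow> bool" where
  "regular_point A E p d \<longleftrightarrow>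
     p \<in> E \<and> (\<exists>c\<in>A. \<exists>I. p \<in> fst c \<and> card I = d \<and>
       E \<inter> fst c = {x \<in> fst c. \<forall>i. i \<notin> I \<longrightarrow> snd c x $ i = 0})"

text \<open>The dimension of an analytic set is the maximal dimension at its (dense) regular points.
  Every number is accepted as a dimension of the empty set.\<close>

definition has_analytic_dim :: "('a, 'm::finite) chart set \<Rightarrow> 'a set \<Rightarrow> nat \<Rightarrow> bool" where
  "has_analytic_dim A E k \<longleftrightarrow>
     (\<forall>p d. regular_point A E p d \<longrightarrow> d \<le> k) \<and>
     (E \<noteq> {} \<longrightarrow> (\<exists>p. regular_point A E p k))"

definition codim_at_least_2 :: "('a, 'm::finite) chart set \<Rightarrow> 'a set \<Rightarrow> bool" where
  "codim_at_least_2 A E \<longleftrightarrow> (\<forall>p d. regular_point A E p d \<longrightarrow> d + 2 \<le> CARD('m))"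


section \<open>Foliations by curves\<close>

text \<open>A foliated chart \<open>(U, \<phi>, l)\<close> maps \<open>U\<close> onto the open unit polydisc; \<open>l\<close> is
  the leaf coordinate, so the plaques are the discs on which all other coordinates are
  constant.\<close>

type_synonym ('a, 'm) fchart = "'a set \<times> ('a \<Rightarrow> complex^'m) \<times> 'm"

abbreviation dom_of :: "('a, 'm::finite) fchart \<Rightarrow> 'a set" where
  "dom_of c \<equiv> fst c"

abbreviation coord_of :: "('a, 'm::finite) fchart \<Rightarrow> 'a \<Rightarrow> complex^'m" where
  "coord_of c \<equiv> fst (snd c)"

abbreviation leaf_coord :: "('a, 'm::finite) fchart \<Rightarrow> 'm" where
  "leaf_coord c \<equiv> snd (snd c)"

abbreviation chart_of :: "('a, 'm::finite) fchart \<Rightarrow> ('a, 'm) chart" where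
  "chart_of c \<equiv> (dom_of c, coord_of c)"

definition foliated_chart ::
    "('a, 'm::finite) chart set \<Rightarrow> ('a, 'm) fchart \<Rightarrow> bool" where
  "foliated_chart A c \<longleftrightarrow>
     chart_of c \<in> A \<and> coord_of c ` dom_of c = {z. \<forall>i. cmod (z $ i) < 1}"

text \<open>The differential of the change of coordinates maps the leaf direction to the leaf
  direction, i.e. locally the coordinates other than the leaf coordinate of \<open>d\<close> do not
  depend on the leaf coordinate of \<open>c\<close>.\<close>

definition foliation_compatible ::
    "('a, 'm::finite) fchart \<Rightarrow> ('a, 'm) fchart \<Rightarrow> bool" where
  "foliation_compatible c d \<longleftrightarrow>
     (\<forall>x \<in> dom_of c \<inter> dom_of d. \<forall>i. i \<noteq> leaf_coord d \<longrightarrow>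
        frechet_derivative (transition (chart_of c) (chart_of d)) (at (coord_of c x))
          (axis (leaf_coord c) 1) $ i = 0)"

text \<open>Nonsingular holomorphic foliations by curves of an open set \<open>W\<close>.\<close>

definition foliated_atlas ::
    "('a, 'm::finite) chart set \<Rightarrow> 'a set \<Rightarrow> ('a, 'm) fchart set \<Rightarrow> bool" where
  "foliated_atlas A W F \<longleftrightarrow>
     (\<forall>c\<in>F. foliated_chart A c) \<and>
     (\<Union>c\<in>F. dom_of c) = W \<and>
     (\<forall>c\<in>F. \<forall>d\<in>F. foliation_compatible c d)"

text \<open>In the domain of the chart \<open>c\<close> the foliation is generated by the holomorphic vector
  field given in coordinates by \<open>X\<close>: it vanishes exactly on \<open>E\<close> and elsewhere it is tangent
  to the leaves.\<close>

definition generates ::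
    "('a, 'm::finite) fchart set \<Rightarrow> 'a set \<Rightarrow> ('a, 'm) chart \<Rightarrow> (complex^'m \<Rightarrow> complex^'m) \<Rightarrow> bool"
  where
  "generates F E c X \<longleftrightarrow>
     (\<forall>i. holomorphic_mv (\<lambda>z. X z $ i) (snd c ` fst c)) \<and>
     (\<forall>x \<in> fst c. X (snd c x) = 0 \<longleftrightarrow> x \<in> E) \<and>
     (\<forall>d\<in>F. \<forall>x \<in> fst c \<inter> dom_of d. \<forall>i. i \<noteq> leaf_coord d \<longrightarrow>
        frechet_derivative (transition c (chart_of d)) (at (snd c x)) (X (snd c x)) $ i = 0)"

text \<open>Singular holomorphic foliations by curves with singular set \<open>E\<close>.\<close>

definition shfc ::
    "('a::topological_space, 'm::finite) chart set \<Rightarrow> ('a, 'm) fchart set \<Rightarrow> 'a set \<Rightarrow> bool" where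
  "shfc A F E \<longleftrightarrow>
     analytic_set A E \<and> codim_at_least_2 A E \<and>
     foliated_atlas A (- E) F \<and>
     (\<forall>p. \<exists>c\<in>A. \<exists>X. p \<in> fst c \<and> generates F E c X)"

text \<open>The plaque of \<open>c\<close> through \<open>p\<close>, for \<open>p\<close> in the domain of \<open>c\<close>.\<close>

definition plaque :: "('a, 'm::finite) fchart \<Rightarrow> 'a \<Rightarrow> 'a set" where
  "plaque c p = {x \<in> dom_of c. \<forall>i. i \<noteq> leaf_coord c \<longrightarrow> coord_of c x $ i = coord_of c p $ i}"

text \<open>The leaf through \<open>p\<close> consists of the points that can be reached by finite chains
  of plaques.\<close>

definition leaf :: "('a, 'm::finite) fchart set \<Rightarrow> 'a \<Rightarrow> 'a set" where
  "leaf F p = {q. (\<lambda>x y. \<exists>c\<in>F. x \<in> dom_of c \<and> y \<in> plaque c x)\<^sup>*\<^sup>* p q}"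

definition leaf_topology :: "('a::topological_space, 'm::finite) fchart set \<Rightarrow> 'a topology" where
  "leaf_topology F = topology_generated_by
     {V \<inter> plaque c p | V c p. open V \<and> c \<in> F \<and> p \<in> dom_of c}"

text \<open>The restriction of the foliation to an open set \<open>U\<close>, given by all foliated charts inside
  \<open>U\<close> that are compatible with the foliation.\<close>

definition restrict_foliation ::
    "('a, 'm::finite) chart set \<Rightarrow> ('a, 'm) fchart set \<Rightarrow> 'a set \<Rightarrow> ('a, 'm) fchart set" where
  "restrict_foliation A F U =
     {c. foliated_chart A c \<and> dom_of c \<subseteq> U \<inter> (\<Union>d\<in>F. dom_of d) \<and>
         (\<forall>d\<in>F. foliation_compatible c d \<and> foliation_compatible d c)}"


section \<open>Uniformizations of leaves\<close>

text \<open>The analogue for abstract topologies of the library's \<open>covering_space\<close>; it is needed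
  because the leaf topology is in general finer than the subspace topology.\<close>

definition covering_projection :: "'a topology \<Rightarrow> ('a \<Rightarrow> 'b) \<Rightarrow> 'b topology \<Rightarrow> bool" where
  "covering_projection X p Y \<longleftrightarrow>
     continuous_map X Y p \<and> p ` topspace X = topspace Y \<and>
     (\<forall>y \<in> topspace Y. \<exists>V. y \<in> V \<and> openin Y V \<and>
        (\<exists>\<V>. \<Union>\<V> = {x \<in> topspace X. p x \<in> V} \<and>
             (\<forall>U\<in>\<V>. openin X U) \<and> pairwise disjnt \<V> \<and>
             (\<forall>U\<in>\<V>. homeomorphic_map (subtopology X U) (subtopology Y V) p)))"

text \<open>Leaves carry the complex structure for which they are immersed submanifolds, so a
  map into a leaf that is continuous for the leaf topology is holomorphic iff it is holomorphic
  as a map into the manifold. The covering is universal as the disc is simply connected.\<close>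

definition uniformization ::
    "('a::topological_space, 'm::finite) chart set \<Rightarrow> ('a, 'm) fchart set \<Rightarrow> (complex \<Rightarrow> 'a) \<Rightarrow>
      'a set \<Rightarrow> bool" where
  "uniformization A F \<alpha> L \<longleftrightarrow>
     holomorphic_disc A \<alpha> \<and>
     covering_projection (top_of_set (ball 0 1)) \<alpha> (subtopology (leaf_topology F) L)"

definition hyperbolic_foliation ::
    "('a::topological_space, 'm::finite) chart set \<Rightarrow> ('a, 'm) fchart set \<Rightarrow> 'a set \<Rightarrow> bool" where
  "hyperbolic_foliation A F E \<longleftrightarrow> (\<forall>p \<in> - E. \<exists>\<alpha>. uniformization A F \<alpha> (leaf F p))"

definition leaf_discs ::
    "('a::topological_space, 'm::finite) chart set \<Rightarrow> ('a, 'm) fchart set \<Rightarrow> 'a set \<Rightarrow>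
      (complex \<Rightarrow> 'a) set" where
  "leaf_discs A F E =
     {f. holomorphic_disc A f \<and> (\<exists>p \<in> - E. f ` ball 0 1 \<subseteq> leaf F p)}"

definition uniformizations ::
    "('a::topological_space, 'm::finite) chart set \<Rightarrow> ('a, 'm) fchart set \<Rightarrow> 'a set \<Rightarrow>
      (complex \<Rightarrow> 'a) set" where
  "uniformizations A F E =
     {\<alpha> \<in> leaf_discs A F E. \<exists>p \<in> - E. uniformization A F \<alpha> (leaf F p)}"


section \<open>Normality on compact parts\<close>

text \<open>Uniform convergence on compact subsets of the disc to a continuous limit does not depend
  on the distance function chosen among those inducing the topology of the manifold.\<close>

definition converges_locally_uniformly ::
    "(nat \<Rightarrow> complex \<Rightarrow> 'a::topological_space) \<Rightarrow> (complex \<Rightarrow> 'a) \<Rightarrow> bool" where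
  "converges_locally_uniformly s f \<longleftrightarrow>
     (\<exists>d. Metric_space UNIV d \<and> Metric_space.mtopology UNIV d = euclidean \<and>
        (\<forall>K. compact K \<and> K \<subseteq> ball 0 1 \<longrightarrow>
          (\<forall>\<epsilon>>0. \<forall>\<^sub>F n in sequentially. \<forall>t\<in>K. d (s n t) (f t) < \<epsilon>)))"

definition normal_family ::
    "('a::topological_space, 'm::finite) chart set \<Rightarrow> (complex \<Rightarrow> 'a) set \<Rightarrow> bool" where
  "normal_family A \<H> \<longleftrightarrow>
     (\<forall>s. range s \<subseteq> \<H> \<longrightarrow>
        (\<exists>r f. strict_mono (r :: nat \<Rightarrow> nat) \<and> holomorphic_disc A f \<and>
               converges_locally_uniformly (s \<circ> r) f))"

definition NCP ::
    "('a::topological_space, 'm::finite) chart set \<Rightarrow> (complex \<Rightarrow> 'a) set \<Rightarrow> bool" where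
  "NCP A \<U> \<longleftrightarrow>
     (\<forall>\<H> \<subseteq> \<U>. compact (closure ((\<lambda>\<alpha>. \<alpha> 0) ` \<H>)) \<longrightarrow> normal_family A \<H>)"


section \<open>Hermitian metrics and the modulus of uniformization\<close>

definition sesquilinear_form :: "complex^'m^'m::finite \<Rightarrow> complex^'m \<Rightarrow> complex^'m \<Rightarrow> complex" where
  "sesquilinear_form H v w = (\<Sum>i\<in>UNIV. \<Sum>j\<in>UNIV. H $ i $ j * v $ i * cnj (w $ j))"

text \<open>A hermitian metric is given by its coefficient matrices \<open>g c p\<close> in all charts
  \<open>c\<close>.\<close>

definition hermitian_metric ::
    "('a, 'm::finite) chart set \<Rightarrow> (('a, 'm) chart \<Rightarrow> 'a \<Rightarrow> complex^'m^'m) \<Rightarrow> bool" where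
  "hermitian_metric A g \<longleftrightarrow>
     (\<forall>c\<in>A. smooth_on (\<lambda>x. g c (inv_into (fst c) (snd c) x)) (snd c ` fst c) \<and>
        (\<forall>p \<in> fst c. (\<forall>i j. g c p $ j $ i = cnj (g c p $ i $ j)) \<and>
           (\<forall>v. v \<noteq> 0 \<longrightarrow> 0 < Re (sesquilinear_form (g c p) v v)))) \<and>
     (\<forall>c\<in>A. \<forall>d\<in>A. \<forall>p \<in> fst c \<inter> fst d. \<forall>v w.
        (let D = frechet_derivative (transition c d) (at (snd c p))
         in sesquilinear_form (g d p) (D v) (D w) = sesquilinear_form (g c p) v w))"

text \<open>The length of \<open>f'(0)\<close>; the choice of the chart around \<open>f 0\<close> is immaterial.\<close>

definition initial_speed ::
    "('a, 'm::finite) chart set \<Rightarrow> (('a, 'm) chart \<Rightarrow> 'a \<Rightarrow> complex^'m^'m) \<Rightarrow>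
      (complex \<Rightarrow> 'a) \<Rightarrow> real" where
  "initial_speed A g f =
     (let c = (SOME c. c \<in> A \<and> f 0 \<in> fst c);
          v = (\<chi> i. deriv (\<lambda>t. snd c (f t) $ i) 0)
      in sqrt (Re (sesquilinear_form (g c (f 0)) v v)))"

definition modulus_of_uniformization ::
    "('a::topological_space, 'm::finite) chart set \<Rightarrow> ('a, 'm) fchart set \<Rightarrow> 'a set \<Rightarrow>
      (('a, 'm) chart \<Rightarrow> 'a \<Rightarrow> complex^'m^'m) \<Rightarrow> 'a \<Rightarrow> ereal" where
  "modulus_of_uniformization A F E g z =
     (SUP f \<in> {f \<in> leaf_discs A F E. f 0 = z}. ereal (initial_speed A g f))"


section \<open>Local invariant hypersurfaces\<close>

text \<open>The defining function vanishes identically on no nonempty open set, so that its zero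
  set has codimension one.\<close>

definition analytic_hypersurface ::
    "('a::topological_space, 'm::finite) chart set \<Rightarrow> 'a set \<Rightarrow> 'a set \<Rightarrow> bool" where
  "analytic_hypersurface A U S \<longleftrightarrow>
     (\<exists>f. holomorphic_fun A f U \<and> S = {x \<in> U. f x = 0} \<and> interior S = {})"

definition invariant_hypersurface ::
    "('a::topological_space, 'm::finite) chart set \<Rightarrow> ('a, 'm) fchart set \<Rightarrow> 'a set \<Rightarrow>
      'a set \<Rightarrow> 'a set \<Rightarrow> bool" where
  "invariant_hypersurface A F E U S \<longleftrightarrow>
     analytic_hypersurface A U S \<and>
     (\<forall>p \<in> S - E. leaf (restrict_foliation A F U) p \<subseteq> S)"

end

(*
Uniformizations realise the supremum defining the modulus: a map f of the disc into a leaf lifts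
through the uniformization alpha with alpha(0) = f(0), and the Schwarz lemma bounds the derivative
of the lift. Let z_n converge to a regular point z and let alpha_n be uniformizations with
alpha_n(0) = z_n. By NCP a subsequence converges to some alpha with alpha(0) = z. Near a point
of E the composition of alpha_n with the equation of an invariant hypersurface vanishes identically
or nowhere, so by Hurwitz the same holds for alpha; hence the preimage of E under alpha is open and
closed, and it does not contain 0. So alpha maps into a leaf. Over each plaque alpha_n has
holomorphic sections with values in the disc, and by Montel they converge to sections of alpha.
These sections suffice to lift discs through alpha, so alpha also realises the supremum at z, and
the speeds of the alpha_n at 0 converge to that of alpha.
*)

theory Submission
  imports Defs
begin

section \<open>Lifting and convergence\<close>

text \<open>The limit \<alpha> is hard to treat as a covering of its leaf, because evenly covered
  neighbourhoods for the \<alpha>_n might shrink as n grows. A plaque, however, is a disc, so each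
  \<alpha>_n lifts it in one piece. These lifts share the unit disc as domain and as target, and a
  limit of them could leave the target only through the unit circle, which the maximum principle
  forbids since the lifts pass through a fixed interior point. Having such sections holds for
  uniformizations and is closed under limits, so one computation of \<eta> serves both z_n and z.
  Two further obstacles shape the proof. A competitor in the supremum is only known to have its
  image in a leaf as a set, while lifting needs continuity for the finer leaf topology; this is
  recovered from the countability of the plaques that a uniformized leaf has in a chart. And
  invariance of a hypersurface refers to foliated charts inside \<open>U\<close>, so plaques of the
  given atlas must first be cut down to small polydiscs.\<close>

lemma lift_unique_connected:
  fixes \<alpha> :: "'b::t2_space \<Rightarrow> 'c" and k l :: "'a::topological_space \<Rightarrow> 'b"
  assumes inj: "\<And>s. s \<in> S \<Longrightarrow> \<exists>W. open W \<and> s \<in> W \<and> inj_on \<alpha> (W \<inter> S)"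
    and N: "connected N"
    and k: "continuous_on N k" "k ` N \<subseteq> S" and l: "continuous_on N l" "l ` N \<subseteq> S"
    and eq: "\<And>x. x \<in> N \<Longrightarrow> \<alpha> (k x) = \<alpha> (l x)"
    and a: "a \<in> N" "k a = l a" and x: "x \<in> N"
  shows "k x = l x"
proof -
  \<comment> \<open>Clopen argument: local injectivity of \<alpha> makes the agreement set open, and
    the Hausdorff space containing the values of \<open>k\<close> and \<open>l\<close> makes it
    closed. No topology on the target of \<alpha> enters, so the argument serves the leaf topology
    and the manifold topology alike.\<close>
  let ?T = "{x \<in> N. k x = l x}"
  have 1: "openin (top_of_set N) ?T"
  proof (subst openin_subopen, intro ballI)
    fix y assume y: "y \<in> ?T"
    then obtain W where W: "open W" "k y \<in> W" "inj_on \<alpha> (W \<inter> S)"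
      using inj k(2) by blast
    let ?V = "(N \<inter> k -` W) \<inter> (N \<inter> l -` W)"
    have "openin (top_of_set N) ?V"
      using W k l by (intro openin_Int continuous_openin_preimage_gen)
    moreover have "y \<in> ?V" using y W by auto
    moreover have "?V \<subseteq> ?T"
      using W(3) k(2) l(2) eq by (force simp: inj_on_def)
    ultimately show "\<exists>T. openin (top_of_set N) T \<and> y \<in> T \<and> T \<subseteq> ?T" by blast
  qed
  have 2: "closedin (top_of_set N) ?T"
  proof -
    have "openin (top_of_set N) (N - ?T)"
    proof (subst openin_subopen, intro ballI)
      fix y assume y: "y \<in> N - ?T"
      then obtain V W where VW: "open V" "open W" "k y \<in> V" "l y \<in> W" "V \<inter> W = {}"
        using hausdorff[of "k y" "l y"] by blast
      let ?V = "(N \<inter> k -` V) \<inter> (N \<inter> l -` W)"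
      have "openin (top_of_set N) ?V"
        using VW k l by (intro openin_Int continuous_openin_preimage_gen)
      moreover have "y \<in> ?V" using y VW by auto
      moreover have "?V \<subseteq> N - ?T"
        using VW by auto
      ultimately show "\<exists>T. openin (top_of_set N) T \<and> y \<in> T \<and> T \<subseteq> N - ?T" by blast
    qed
    then show ?thesis by (simp add: closedin_def Diff_Diff_Int subset_iff)
  qed
  have "?T = N"
    using N 1 2 a unfolding connected_clopen by blast
  then show ?thesis using x by blast
qed

text \<open>The pullback \<open>{(t, s). \<alpha> s = f t}\<close> is a covering space of the simply connected set
  \<open>D\<close>, so the identity of \<open>D\<close> lifts to it.\<close>

lemma lift_through_local_sections:
  fixes \<alpha> :: "'b::real_normed_vector \<Rightarrow> 'c" and f :: "'a::real_normed_vector \<Rightarrow> 'c"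
  assumes D: "simply_connected D" "open D"
    and inj: "\<And>s. s \<in> S \<Longrightarrow> \<exists>W. open W \<and> s \<in> W \<and> inj_on \<alpha> (W \<inter> S)"
    and loc: "\<And>t0. t0 \<in> D \<Longrightarrow> \<exists>N. open N \<and> connected N \<and> t0 \<in> N \<and> N \<subseteq> D \<and>
        (\<forall>t\<in>N. \<forall>s\<in>S. \<alpha> s = f t \<longrightarrow>
          (\<exists>k. continuous_on N k \<and> k ` N \<subseteq> S \<and> (\<forall>x\<in>N. \<alpha> (k x) = f x) \<and> k t = s))"
    and ab: "a \<in> D" "b \<in> S" "\<alpha> b = f a"
  obtains g where "continuous_on D g" "g ` D \<subseteq> S" "\<And>x. x \<in> D \<Longrightarrow> \<alpha> (g x) = f x" "g a = b"
proof -
  define X where "X = {(t, s). t \<in> D \<and> s \<in> S \<and> \<alpha> s = f t}"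
  have conD: "connected D"
    using D(1) simply_connected_imp_connected by blast
  have surj: "fst ` X = D"
  proof -
    \<comment> \<open>Over \<open>N\<close> either all values of \<open>f\<close> have a preimage or
      none has, since a section through one preimage is defined on all of \<open>N\<close>. Hence
      \<open>?T\<close> is clopen in the connected set \<open>D\<close>, and it contains
      \<open>a\<close>.\<close>
    let ?T = "{t \<in> D. f t \<in> \<alpha> ` S}"
    have good: "\<exists>N. openin (top_of_set D) N \<and> t0 \<in> N \<and> (N \<subseteq> ?T \<or> N \<subseteq> D - ?T)" if t0: "t0 \<in> D" for t0
    proof -
      from loc[OF t0] obtain N where N: "open N" "connected N" "t0 \<in> N" "N \<subseteq> D"
        "\<forall>t\<in>N. \<forall>s\<in>S. \<alpha> s = f t \<longrightarrow>
          (\<exists>k. continuous_on N k \<and> k ` N \<subseteq> S \<and> (\<forall>x\<in>N. \<alpha> (k x) = f x) \<and> k t = s)" by blast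
      have "N \<subseteq> ?T" if "t \<in> N" "t \<in> ?T" for t
      proof -
        have "f t \<in> \<alpha> ` S" using that by simp
        then obtain s where "s \<in> S" "\<alpha> s = f t" by (metis imageE)
        then obtain k where "k ` N \<subseteq> S" "\<forall>x\<in>N. \<alpha> (k x) = f x" using N(5) \<open>t \<in> N\<close> by blast
        then show ?thesis using N(4) by (auto simp: image_iff) (metis image_subset_iff)
      qed
      then show ?thesis using N by (intro exI[of _ N]) (auto intro: open_subset)
    qed
    have "openin (top_of_set D) ?T"
      by (subst openin_subopen) (use good in blast)
    moreover have "openin (top_of_set D) (D - ?T)"
      by (subst openin_subopen) (use good in blast)
    then have "closedin (top_of_set D) ?T"
      by (simp add: closedin_def Diff_Diff_Int subset_iff)
    ultimately have "?T = D"
      using conD ab unfolding connected_clopen by (metis (mono_tags, lifting) empty_iff image_eqI mem_Collect_eq)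
    then have *: "t \<in> D \<Longrightarrow> \<exists>s\<in>S. \<alpha> s = f t" for t by (metis (mono_tags, lifting) imageE mem_Collect_eq)
    show ?thesis
    proof
      show "D \<subseteq> fst ` X"
      proof
        fix t assume "t \<in> D"
        then obtain s where "(t, s) \<in> X" using * by (auto simp: X_def)
        then show "t \<in> fst ` X" by force
      qed
    qed (auto simp: X_def)
  qed
  have cov: "covering_space X fst D"
    unfolding covering_space_def
  proof (intro conjI ballI)
    show "continuous_on X fst" by (intro continuous_intros)
    show "fst ` X = D" by (fact surj)
    fix t0 assume t0: "t0 \<in> D"
    from loc[OF t0] obtain N where N: "open N" "connected N" "t0 \<in> N" "N \<subseteq> D"
      "\<And>t s. t \<in> N \<Longrightarrow> s \<in> S \<Longrightarrow> \<alpha> s = f t \<Longrightarrow>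
        (\<exists>k. continuous_on N k \<and> k ` N \<subseteq> S \<and> (\<forall>x\<in>N. \<alpha> (k x) = f x) \<and> k t = s)" by blast
    \<comment> \<open>The sheets over \<open>N\<close> are the graphs of all sections on
      \<open>N\<close>. They exhaust the part of the pullback over \<open>N\<close> because
      \<open>loc\<close> provides a section through every preimage of every point of
      \<open>N\<close>, not only of \<open>t0\<close>.\<close>
    define K where "K = {k. continuous_on N k \<and> k ` N \<subseteq> S \<and> (\<forall>x\<in>N. \<alpha> (k x) = f x)}"
    define G where "G k = (\<lambda>t. (t, k t)) ` N" for k :: "'a \<Rightarrow> 'b"
    have un: "\<Union>(G ` K) = X \<inter> fst -` N"
    proof
      show "\<Union>(G ` K) \<subseteq> X \<inter> fst -` N"
        using N(4) by (auto simp: G_def K_def X_def)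
      show "X \<inter> fst -` N \<subseteq> \<Union>(G ` K)"
      proof
        fix p assume p: "p \<in> X \<inter> fst -` N"
        then obtain k where "k \<in> K" "k (fst p) = snd p"
          using N(5)[of "fst p" "snd p"] by (auto simp: X_def K_def)
        then show "p \<in> \<Union>(G ` K)"
          using p by (force simp: G_def image_iff)
      qed
    qed
    have opn: "openin (top_of_set X) (G k)" if k: "k \<in> K" for k
    proof (subst openin_subopen, intro ballI)
      fix p assume "p \<in> G k"
      then obtain t where t: "t \<in> N" "p = (t, k t)" by (auto simp: G_def)
      have kN: "continuous_on N k" "k ` N \<subseteq> S" "\<And>x. x \<in> N \<Longrightarrow> \<alpha> (k x) = f x"
        using k by (auto simp: K_def)
      obtain W where W: "open W" "k t \<in> W" "inj_on \<alpha> (W \<inter> S)"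
        using inj kN(2) t by blast
      have o: "open (N \<inter> k -` W)"
        using W(1) kN(1) N(1) by (metis continuous_openin_preimage_gen openin_open_eq)
      \<comment> \<open>For a point (x, s) of this set, \<open>s\<close> and \<open>k x\<close> lie
        in \<open>W\<close> and have the same image under \<alpha>, so they coincide: near
        \<open>p\<close> the pullback is just the graph of \<open>k\<close>.\<close>
      let ?V = "X \<inter> ((N \<inter> k -` W) \<times> W)"
      have "openin (top_of_set X) ?V"
        using o W(1) by (intro openin_open_Int open_Times)
      moreover have "p \<in> ?V"
        using t W kN N(4) by (auto simp: X_def)
      moreover have "?V \<subseteq> G k"
      proof
        fix q assume q: "q \<in> ?V"
        then have "snd q = k (fst q)"
          using W(3) kN by (auto simp: X_def inj_on_def)
        then show "q \<in> G k" using q by (auto simp: G_def)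
      qed
      ultimately show "\<exists>T. openin (top_of_set X) T \<and> p \<in> T \<and> T \<subseteq> G k" by blast
    qed
    have disj: "pairwise disjnt (G ` K)"
    proof (rule pairwiseI, rule ccontr)
      fix u v assume uv: "u \<in> G ` K" "v \<in> G ` K" "u \<noteq> v" "\<not> disjnt u v"
      then obtain k l where kl: "k \<in> K" "l \<in> K" "u = G k" "v = G l" by blast
      then obtain t where t: "t \<in> N" "k t = l t" using uv(4) by (auto simp: disjnt_def G_def)
      have "k x = l x" if "x \<in> N" for x
        by (rule lift_unique_connected[where S=S and N=N and \<alpha>=\<alpha> and a=t])
           (use kl t that inj N(2) in \<open>auto simp: K_def\<close>)
      then have "u = v" using kl by (simp add: G_def)
      then show False using uv by blast
    qed
    have hom: "\<exists>q. homeomorphism (G k) N fst q" if k: "k \<in> K" for k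
      by (rule exI[of _ "\<lambda>t. (t, k t)"])
         (use k in \<open>auto simp: homeomorphism_def G_def K_def image_image intro!: continuous_intros\<close>)
    show "\<exists>T. t0 \<in> T \<and> openin (top_of_set D) T \<and>
           (\<exists>v. \<Union>v = X \<inter> fst -` T \<and> (\<forall>u\<in>v. openin (top_of_set X) u) \<and>
                pairwise disjnt v \<and> (\<forall>u\<in>v. \<exists>q. homeomorphism u T fst q))"
      using N(1,3,4) un opn disj hom
      by (intro exI[of _ N] conjI exI[of _ "G ` K"]) (auto intro: open_subset)
  qed
  have abX: "(a, b) \<in> X" using ab by (simp add: X_def)
  obtain h where h: "continuous_on D h" "h \<in> D \<rightarrow> X" "h a = (a, b)" "\<And>y. y \<in> D \<Longrightarrow> fst (h y) = id y"
    using covering_space_lift_strong[OF cov abX ab(1) D(1) open_imp_locally_path_connected[OF D(2)], of id]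
    by (auto intro: continuous_on_id)
  show thesis
  proof (rule that[of "\<lambda>x. snd (h x)"])
    show "continuous_on D (\<lambda>x. snd (h x))" using h(1) by (intro continuous_intros)
    show "(\<lambda>x. snd (h x)) ` D \<subseteq> S"
      using h(2) by (force simp: X_def Pi_iff)
    show "\<alpha> (snd (h x)) = f x" if "x \<in> D" for x
      using h(2,4) that by (force simp: X_def Pi_iff case_prod_unfold)
  qed (simp add: h(3))
qed

text \<open>Joint convergence as \<open>n \<rightarrow> \<infinity>\<close> and \<open>x \<rightarrow> t\<close>: for continuous limits this is locally uniform
  convergence, without reference to a distance on the target.\<close>

definition converges_continuously ::
    "(nat \<Rightarrow> complex \<Rightarrow> 'a::topological_space) \<Rightarrow> (complex \<Rightarrow> 'a) \<Rightarrow> complex set \<Rightarrow> bool" where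
  "converges_continuously s f S \<longleftrightarrow>
     (\<forall>t\<in>S. ((\<lambda>(n, x). s n x) \<longlongrightarrow> f t) (sequentially \<times>\<^sub>F nhds t))"

lemma converges_continuouslyD:
  assumes "converges_continuously s f S" "t \<in> S" "open V" "f t \<in> V"
  obtains r n where "r > 0" "\<And>k x. k \<ge> n \<Longrightarrow> dist x t < r \<Longrightarrow> s k x \<in> V"
proof -
  have "\<forall>\<^sub>F p in sequentially \<times>\<^sub>F nhds t. (case p of (n, x) \<Rightarrow> s n x) \<in> V"
    using assms by (auto simp: converges_continuously_def tendsto_def)
  then obtain P Q where PQ: "eventually P sequentially" "eventually Q (nhds t)"
      "\<And>n x. P n \<Longrightarrow> Q x \<Longrightarrow> s n x \<in> V"
    unfolding eventually_prod_filter by auto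
  obtain n where "\<And>k. k \<ge> n \<Longrightarrow> P k" using PQ(1) by (auto simp: eventually_sequentially)
  moreover obtain r where "r > 0" "\<And>x. dist x t < r \<Longrightarrow> Q x"
    using PQ(2) by (auto simp: eventually_nhds_metric)
  ultimately show thesis using PQ(3) that by metis
qed

text \<open>The moving arguments \<open>x n\<close> are the point: in the limit of plaque sections
  both the map and the parameter at which it is evaluated vary with \<open>n\<close>.\<close>

lemma converges_continuously_compose:
  assumes "converges_continuously s f S" "t \<in> S" "x \<longlonglongrightarrow> t"
  shows "(\<lambda>n. s n (x n)) \<longlonglongrightarrow> f t"
proof -
  have "filterlim (\<lambda>n. (n, x n)) (sequentially \<times>\<^sub>F nhds t) sequentially"
    using assms(3) by (intro filterlim_Pair filterlim_ident)
  from filterlim_compose[OF _ this, of "\<lambda>(n, x). s n x"] show ?thesis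
    using assms(1,2) by (auto simp: converges_continuously_def)
qed

lemma converges_continuously_subseq:
  assumes "converges_continuously s f S" "strict_mono r"
  shows "converges_continuously (\<lambda>n. s (r n)) f S"
  unfolding converges_continuously_def
proof
  fix t assume t: "t \<in> S"
  have "filterlim (\<lambda>p. (r (fst p), snd p)) (sequentially \<times>\<^sub>F nhds t) (sequentially \<times>\<^sub>F nhds t)"
    by (intro filterlim_Pair filterlim_compose[OF filterlim_subseq[OF assms(2)] filterlim_fst] filterlim_snd)
  from filterlim_compose[OF _ this, of "\<lambda>(n, x). s n x"] t assms(1)
  show "((\<lambda>(n, x). s (r n) x) \<longlongrightarrow> f t) (sequentially \<times>\<^sub>F nhds t)"
    by (auto simp: converges_continuously_def case_prod_unfold)
qed

lemma converges_continuously_image: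
  fixes f :: "complex \<Rightarrow> 'a::t2_space" and h :: "'a \<Rightarrow> 'b::topological_space"
  assumes "converges_continuously s f S" "open U" "continuous_on U h" "f ` S \<subseteq> U"
  shows "converges_continuously (\<lambda>n x. h (s n x)) (\<lambda>x. h (f x)) S"
  unfolding converges_continuously_def
proof
  fix t assume t: "t \<in> S"
  have "isCont h (f t)" using assms t by (meson continuous_on_eq_continuous_at image_subset_iff)
  then show "((\<lambda>(n, x). h (s n x)) \<longlongrightarrow> h (f t)) (sequentially \<times>\<^sub>F nhds t)"
    using assms(1) t isCont_tendsto_compose[of "f t" h "\<lambda>(n, x). s n x"]
    by (auto simp: converges_continuously_def case_prod_unfold)
qed

text \<open>Near each point the estimate holds on a ball and from an index on, both depending on the
  point; a finite subcover makes the index uniform. This returns to the form of convergence in which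
  the theorems of Weierstrass and Hurwitz are applied.\<close>

lemma converges_continuously_imp_uniform_limit:
  fixes s :: "nat \<Rightarrow> complex \<Rightarrow> 'a::metric_space"
  assumes "converges_continuously s f K" "compact K" "continuous_on K f"
  shows "uniform_limit K s f sequentially"
proof (rule uniform_limitI)
  fix e :: real assume e: "e > 0"
  have "\<exists>r>0. \<exists>n. \<forall>x\<in>K \<inter> ball t r. \<forall>k\<ge>n. dist (s k x) (f x) < e" if t: "t \<in> K" for t
  proof -
    obtain r n where r: "r > 0" "\<And>k x. k \<ge> n \<Longrightarrow> dist x t < r \<Longrightarrow> s k x \<in> ball (f t) (e/2)"
      using converges_continuouslyD[OF assms(1) t, of "ball (f t) (e/2)"] e by auto
    obtain r' where r': "r' > 0" "\<And>x. x \<in> K \<Longrightarrow> dist x t < r' \<Longrightarrow> dist (f x) (f t) < e/2"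
      using assms(3) t e unfolding continuous_on_iff by (metis half_gt_zero)
    have "dist (s k x) (f x) < e" if "x \<in> K \<inter> ball t (min r r')" "k \<ge> n" for x k
    proof -
      have "dist (f t) (s k x) < e/2" "dist (f x) (f t) < e/2"
        using r(2)[of k x] r'(2)[of x] that by (auto simp: dist_commute)
      then show ?thesis by (metis dist_commute dist_triangle_half_l)
    qed
    then show ?thesis using r(1) r'(1)
      by (intro exI[of _ "min r r'"] conjI exI[of _ n]) auto
  qed
  then obtain r n where rn: "\<And>t. t \<in> K \<Longrightarrow> r t > (0::real)"
     "\<And>t x k. t \<in> K \<Longrightarrow> x \<in> K \<inter> ball t (r t) \<Longrightarrow> k \<ge> n t \<Longrightarrow> dist (s k x) (f x) < e"
    by metis
  obtain C where C: "C \<subseteq> K" "finite C" "K \<subseteq> (\<Union>c\<in>C. ball c (r c))"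
  proof (rule compactE_image[OF assms(2), of K "\<lambda>t. ball t (r t)"])
    show "K \<subseteq> (\<Union>c\<in>K. ball c (r c))" using rn(1) by force
  qed auto
  have "\<forall>\<^sub>F k in sequentially. \<forall>c\<in>C. k \<ge> n c"
    using C(2) by (intro eventually_ball_finite) (auto intro: eventually_ge_at_top)
  then show "\<forall>\<^sub>F k in sequentially. \<forall>x\<in>K. dist (s k x) (f x) < e"
  proof eventually_elim
    case (elim k)
    show ?case
    proof
      fix x assume "x \<in> K"
      then obtain c where "c \<in> C" "x \<in> ball c (r c)" using C by blast
      then show "dist (s k x) (f x) < e" using rn(2)[of c x k] C(1) elim \<open>x \<in> K\<close> by blast
    qed
  qed
qed

lemma uniform_limit_imp_converges_continuously:
  fixes s :: "nat \<Rightarrow> complex \<Rightarrow> 'a::metric_space"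
  assumes "open S" "continuous_on S f"
    and "\<And>K. compact K \<Longrightarrow> K \<subseteq> S \<Longrightarrow> uniform_limit K s f sequentially"
  shows "converges_continuously s f S"
  unfolding converges_continuously_def
proof
  fix t assume t: "t \<in> S"
  obtain r where r: "r > 0" "cball t r \<subseteq> S" using assms(1) t open_contains_cball by blast
  show "((\<lambda>(n, x). s n x) \<longlongrightarrow> f t) (sequentially \<times>\<^sub>F nhds t)"
  proof (rule tendstoI)
    fix e :: real assume e: "e > 0"
    have "\<forall>\<^sub>F n in sequentially. \<forall>x\<in>cball t r. dist (s n x) (f x) < e/2"
      using uniform_limitD[OF assms(3)[OF compact_cball r(2)], of "e/2"] e by simp
    moreover have "\<forall>\<^sub>F x in nhds t. x \<in> cball t r \<and> dist (f x) (f t) < e/2"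
    proof (rule eventually_conj)
      show "\<forall>\<^sub>F x in nhds t. x \<in> cball t r"
        by (rule eventually_mono[OF eventually_nhds_in_open[OF open_ball, of t t r]])
           (use r(1) in \<open>auto simp: dist_commute\<close>)
      have "(f \<longlongrightarrow> f t) (nhds t)"
        using assms(1,2) t by (simp add: continuous_on_eq_continuous_at isCont_def tendsto_at_iff_tendsto_nhds)
      then show "\<forall>\<^sub>F x in nhds t. dist (f x) (f t) < e/2"
        by (rule tendstoD) (use e in simp)
    qed
    ultimately have "\<forall>\<^sub>F p in sequentially \<times>\<^sub>F nhds t. (\<forall>x\<in>cball t r. dist (s (fst p) x) (f x) < e/2) \<and>
        (snd p \<in> cball t r \<and> dist (f (snd p)) (f t) < e/2)"
      by (auto simp: eventually_prod_filter)
    then show "\<forall>\<^sub>F p in sequentially \<times>\<^sub>F nhds t. dist (case p of (n, x) \<Rightarrow> s n x) (f t) < e"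
    proof eventually_elim
      case (elim p)
      then have "dist (s (fst p) (snd p)) (f (snd p)) < e/2" "dist (f t) (f (snd p)) < e/2"
        by (auto simp: dist_commute)
      then show ?case by (auto simp: case_prod_unfold intro: dist_triangle_half_l)
    qed
  qed
qed

text \<open>The metric is only known to exist and has no relation to the coordinates. Its single use
  is this passage to a purely topological notion, which continuous maps such as chart coordinates
  preserve.\<close>

lemma converges_locally_uniformly_imp_continuously:
  assumes "converges_locally_uniformly s f" "continuous_on (ball 0 1) f"
  shows "converges_continuously s f (ball 0 1)"
  unfolding converges_continuously_def
proof
  fix t :: complex assume t: "t \<in> ball 0 1"
  obtain d where d: "Metric_space UNIV d" "Metric_space.mtopology UNIV d = euclidean"
      "\<And>K e. compact K \<Longrightarrow> K \<subseteq> ball 0 1 \<Longrightarrow> e > 0 \<Longrightarrow> \<forall>\<^sub>F n in sequentially. \<forall>t\<in>K. d (s n t) (f t) < e"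
    using assms(1) unfolding converges_locally_uniformly_def by blast
  interpret Metric_space UNIV d by (fact d(1))
  obtain r where r: "r > 0" "cball t r \<subseteq> ball 0 1" using t open_contains_cball open_ball by blast
  show "((\<lambda>(n, x). s n x) \<longlongrightarrow> f t) (sequentially \<times>\<^sub>F nhds t)"
  proof (rule topological_tendstoI)
    fix V assume V: "open V" "f t \<in> V"
    then have "openin mtopology V" by (simp add: d(2))
    then obtain e where e: "e > 0" "mball (f t) e \<subseteq> V"
      using V(2) openin_mtopology by blast
    have "openin mtopology (mball (f t) (e/2))" by simp
    then have o: "open (mball (f t) (e/2))" by (simp add: d(2))
    have "f t \<in> mball (f t) (e/2)" using e by simp
    moreover have "(f \<longlongrightarrow> f t) (nhds t)"
      using assms(2) t by (simp add: continuous_on_eq_continuous_at isCont_def tendsto_at_iff_tendsto_nhds)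
    ultimately have ft: "\<forall>\<^sub>F x in nhds t. f x \<in> mball (f t) (e/2)"
      using o by (rule_tac topological_tendstoD)
    have "\<forall>\<^sub>F n in sequentially. \<forall>x\<in>cball t r. d (s n x) (f x) < e/2"
      by (rule d(3)[OF compact_cball r(2)]) (use e in simp)
    moreover have "\<forall>\<^sub>F x in nhds t. x \<in> ball t r \<and> f x \<in> mball (f t) (e/2)"
      using r(1) ft by (intro eventually_conj eventually_nhds_in_open) auto
    ultimately have "\<forall>\<^sub>F p in sequentially \<times>\<^sub>F nhds t. (\<forall>x\<in>cball t r. d (s (fst p) x) (f x) < e/2) \<and>
        (snd p \<in> ball t r \<and> f (snd p) \<in> mball (f t) (e/2))"
      by (auto simp: eventually_prod_filter)
    then show "\<forall>\<^sub>F p in sequentially \<times>\<^sub>F nhds t. (case p of (n, x) \<Rightarrow> s n x) \<in> V"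
    proof eventually_elim
      case (elim p)
      then have "d (s (fst p) (snd p)) (f (snd p)) < e/2" "d (f t) (f (snd p)) < e/2"
        by auto
      then have "d (f t) (s (fst p) (snd p)) < e"
        using triangle[of "f t" "f (snd p)" "s (fst p) (snd p)"] commute[of "f (snd p)" "s (fst p) (snd p)"] by simp
      then show ?case using e(2) by (auto simp: case_prod_unfold)
    qed
  qed
qed

section \<open>Complex derivatives in coordinate spaces\<close>

no_notation fps_nth (infixl "$" 75)

lemma has_derivative_vec_componentwise:
  fixes f :: "'a::real_normed_vector \<Rightarrow> 'b::euclidean_space^'n"
  assumes "\<And>i. ((\<lambda>x. f x $ i) has_derivative (\<lambda>v. D v $ i)) (at x within S)"
  shows "(f has_derivative D) (at x within S)"
proof (subst has_derivative_componentwise_within, intro ballI)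
  fix b :: "'b^'n" assume "b \<in> Basis"
  then obtain i u where b: "b = axis i u" by (auto simp: Basis_vec_def)
  show "((\<lambda>x. f x \<bullet> b) has_derivative (\<lambda>v. D v \<bullet> b)) (at x within S)"
    using assms[of i] by (simp add: b inner_axis has_derivative_inner_left)
qed

lemma has_derivative_vec_field:
  fixes \<gamma> :: "complex \<Rightarrow> complex^'m"
  assumes "\<And>i. ((\<lambda>t. \<gamma> t $ i) has_field_derivative v $ i) (at t)"
  shows "(\<gamma> has_derivative (\<lambda>h. h *s v)) (at t)"
proof (rule has_derivative_vec_componentwise)
  show "((\<lambda>x. \<gamma> x $ i) has_derivative (\<lambda>h. (h *s v) $ i)) (at t)" for i
    using assms[of i] by (simp add: has_field_derivative_def mult_commute_abs)
qed

lemma holomorphic_mv_has_field_derivative: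
  fixes \<gamma> :: "complex \<Rightarrow> complex^'m"
  assumes f: "(f has_derivative (\<lambda>v. \<Sum>i\<in>UNIV. (a::complex^'m) $ i * v $ i)) (at (\<gamma> t))"
    and \<gamma>: "\<And>i. ((\<lambda>t. \<gamma> t $ i) has_field_derivative v $ i) (at t)"
  shows "((\<lambda>t. f (\<gamma> t)) has_field_derivative (\<Sum>i\<in>UNIV. a $ i * v $ i)) (at t)"
proof -
  have "((\<lambda>t. f (\<gamma> t)) has_derivative (\<lambda>h. \<Sum>i\<in>UNIV. a $ i * (h *s v) $ i)) (at t)"
    by (rule has_derivative_compose[OF has_derivative_vec_field[OF \<gamma>] f])
  moreover have "(\<lambda>h. \<Sum>i\<in>UNIV. a $ i * (h *s v) $ i) = (*) (\<Sum>i\<in>UNIV. a $ i * v $ i)"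
    by (rule ext) (simp add: sum_distrib_left mult.commute mult.left_commute)
  ultimately show ?thesis
    by (simp add: has_field_derivative_def)
qed

lemma holomorphic_mv_compose:
  assumes "holomorphic_mv f S" "open T" "\<And>i. (\<lambda>t. \<gamma> t $ i) holomorphic_on T" "\<gamma> ` T \<subseteq> S"
  shows "(\<lambda>t. f (\<gamma> t)) holomorphic_on T"
  unfolding holomorphic_on_open[OF assms(2)]
proof
  fix t assume t: "t \<in> T"
  then have "\<gamma> t \<in> S" using assms(4) by blast
  obtain a where a: "(f has_derivative (\<lambda>v. \<Sum>i\<in>UNIV. a $ i * v $ i)) (at (\<gamma> t))"
    using assms(1)[unfolded holomorphic_mv_def, rule_format, OF \<open>\<gamma> t \<in> S\<close>] by (elim exE)
  have "((\<lambda>t. \<gamma> t $ i) has_field_derivative (\<chi> i. deriv (\<lambda>t. \<gamma> t $ i) t) $ i) (at t)" for i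
    using holomorphic_derivI[OF assms(3) assms(2) t] by simp
  from holomorphic_mv_has_field_derivative[OF a this]
  show "\<exists>f'. ((\<lambda>t. f (\<gamma> t)) has_field_derivative f') (at t)" by (rule exI)
qed

lemma holomorphic_mv_continuous_on: "holomorphic_mv f S \<Longrightarrow> continuous_on S f"
  unfolding holomorphic_mv_def
  by (rule continuous_at_imp_continuous_on) (auto dest!: bspec intro: has_derivative_continuous)

section \<open>Charts\<close>

text \<open>A topological chart only asserts that some continuous inverse exists, whereas
  transitions and holomorphic functions are written with \<open>inv_into\<close>; by injectivity the
  two agree on the image.\<close>

lemma topological_chartD:
  assumes "topological_chart c"
  shows "open (fst c)" "open (snd c ` fst c)" "continuous_on (fst c) (snd c)" "inj_on (snd c) (fst c)"
    and "continuous_on (snd c ` fst c) (inv_into (fst c) (snd c))"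
proof -
  obtain \<psi> where h: "homeomorphism (fst c) (snd c ` fst c) (snd c) \<psi>"
    and o: "open (fst c)" "open (snd c ` fst c)"
    using assms by (auto simp: topological_chart_def)
  show "open (fst c)" "open (snd c ` fst c)" by (fact o)+
  show "continuous_on (fst c) (snd c)" using h by (simp add: homeomorphism_def)
  show inj: "inj_on (snd c) (fst c)"
    by (rule inj_on_inverseI[of _ \<psi>]) (use h in \<open>simp add: homeomorphism_def\<close>)
  show "continuous_on (snd c ` fst c) (inv_into (fst c) (snd c))"
  proof (rule continuous_on_eq)
    show "continuous_on (snd c ` fst c) \<psi>" using h by (simp add: homeomorphism_def)
    show "\<psi> x = inv_into (fst c) (snd c) x" if "x \<in> snd c ` fst c" for x
      using that h inj by (auto simp: homeomorphism_def)
  qed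
qed

lemma open_chart_image:
  assumes "topological_chart c" "open W"
  shows "open (snd c ` (fst c \<inter> W))"
proof -
  let ?i = "inv_into (fst c) (snd c)"
  have "snd c ` (fst c \<inter> W) = snd c ` fst c \<inter> ?i -` W"
    using topological_chartD(4)[OF assms(1)] by auto
  moreover have "open (snd c ` fst c \<inter> ?i -` W)"
    using topological_chartD[OF assms(1)] assms(2) continuous_on_open_vimage by (simp add: continuous_open_preimage)
  ultimately show ?thesis by simp
qed

lemma transition_apply:
  assumes "inj_on (snd c) (fst c)" "x \<in> fst c"
  shows "transition c d (snd c x) = snd d x"
  using assms by (simp add: transition_def)

lemma sesquilinear_form_scale:
  "sesquilinear_form H (a *s v) (a *s v) = (cmod a)\<^sup>2 * sesquilinear_form H v v"
proof -
  have *: "H $ i $ j * (a * v $ i) * cnj (a * v $ j) = (complex_of_real (cmod a))\<^sup>2 * (H $ i $ j * v $ i * cnj (v $ j))" for i j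
    using complex_norm_square[of a] by simp
  show ?thesis
    by (simp add: sesquilinear_form_def sum_distrib_left * del: complex_cnj_mult)
qed

locale complex_manifold =
  fixes A :: "('a::{t2_space, second_countable_topology}, 'm::finite) chart set"
  assumes complex_str: "complex_structure A"
begin

lemma topological: "c \<in> A \<Longrightarrow> topological_chart c"
  using complex_str by (auto simp: complex_structure_def)

lemmas chart_open = topological_chartD(1)[OF topological]
  and chart_continuous = topological_chartD(3)[OF topological]
  and chart_inj = topological_chartD(4)[OF topological]
  and chart_inv_continuous = topological_chartD(5)[OF topological]

lemma chart_at: obtains c where "c \<in> A" "p \<in> fst c"
proof -
  have "p \<in> (\<Union>c\<in>A. fst c)" using complex_str by (simp add: complex_structure_def)
  then show thesis using that by blast
qed

text \<open>The complex gradients of the components are the rows of \<open>M\<close>. Having the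
  derivative as a complex matrix lets scalars of tangent vectors be pulled out in the chain rule
  along discs.\<close>

lemma transition_has_derivative:
  assumes "c \<in> A" "d \<in> A" "p \<in> fst c" "p \<in> fst d"
  obtains M where "(transition c d has_derivative (\<lambda>v. M *v v)) (at (snd c p))"
proof -
  have "\<forall>i. \<exists>a. ((\<lambda>x. transition c d x $ i) has_derivative (\<lambda>v. \<Sum>j\<in>UNIV. a $ j * v $ j)) (at (snd c p))"
  proof
    fix i
    have "holomorphic_transition c d"
      using complex_str assms(1,2) by (simp add: complex_structure_def)
    then have "holomorphic_mv (\<lambda>x. transition c d x $ i) (snd c ` (fst c \<inter> fst d))"
      by (simp add: holomorphic_transition_def)
    then show "\<exists>a. ((\<lambda>x. transition c d x $ i) has_derivative (\<lambda>v. \<Sum>j\<in>UNIV. a $ j * v $ j)) (at (snd c p))"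
      unfolding holomorphic_mv_def by (rule bspec) (use assms in blast)
  qed
  then obtain a where a: "\<And>i. ((\<lambda>x. transition c d x $ i) has_derivative (\<lambda>v. \<Sum>j\<in>UNIV. a i $ j * v $ j)) (at (snd c p))"
    by metis
  show thesis
    by (rule that[of "\<chi> i. a i"], rule has_derivative_vec_componentwise)
       (use a in \<open>simp add: matrix_vector_mult_def\<close>)
qed

lemma disc_preimage_open:
  assumes "holomorphic_disc A f" "open W"
  shows "open {t \<in> ball 0 1. f t \<in> W}"
proof -
  have "open (ball 0 1 \<inter> f -` W)"
    using assms by (intro continuous_open_preimage) (auto simp: holomorphic_disc_def)
  then show ?thesis by (simp add: vimage_def Int_def)
qed

lemma disc_coord_has_derivative:
  assumes "holomorphic_disc A f" "c \<in> A" "t \<in> ball 0 1" "f t \<in> fst c"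
  shows "((\<lambda>t. snd c (f t) $ i) has_field_derivative deriv (\<lambda>t. snd c (f t) $ i) t) (at t)"
proof (rule holomorphic_derivI)
  show "(\<lambda>t. snd c (f t) $ i) holomorphic_on {t \<in> ball 0 1. f t \<in> fst c}"
    using assms(1,2) by (simp add: holomorphic_disc_def)
  show "open {t \<in> ball 0 1. f t \<in> fst c}"
    by (rule disc_preimage_open[OF assms(1) chart_open[OF assms(2)]])
qed (use assms in simp)

lemma disc_eventually:
  assumes "holomorphic_disc A f" "open W" "t \<in> ball 0 1" "f t \<in> W"
  shows "\<forall>\<^sub>F x in nhds t. x \<in> ball 0 1 \<and> f x \<in> W"
  using eventually_nhds_in_open[OF disc_preimage_open[OF assms(1,2)], of t] assms by simp

lemma holomorphic_fun_disc:
  assumes f: "holomorphic_disc A f" and h: "holomorphic_fun A h U" and U: "open U"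
    and T: "open T" "T \<subseteq> ball 0 1" "f ` T \<subseteq> U"
  shows "(\<lambda>t. h (f t)) holomorphic_on T"
  unfolding holomorphic_on_open[OF T(1)]
proof
  fix t assume t: "t \<in> T"
  obtain c where c: "c \<in> A" "f t \<in> fst c" using chart_at by blast
  let ?T = "T \<inter> {t \<in> ball 0 1. f t \<in> fst c}"
  have o: "open ?T" using T disc_preimage_open[OF f chart_open[OF c(1)]] by blast
  have "(\<lambda>t. (\<lambda>x. h (inv_into (fst c) (snd c) x)) (snd c (f t))) holomorphic_on ?T"
  proof (rule holomorphic_mv_compose[OF _ o])
    show "holomorphic_mv (\<lambda>x. h (inv_into (fst c) (snd c) x)) (snd c ` (fst c \<inter> U))"
      using h c by (simp add: holomorphic_fun_def)
    show "(\<lambda>t. snd c (f t) $ i) holomorphic_on ?T" for i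
      using f c by (auto simp: holomorphic_disc_def intro: holomorphic_on_subset)
    show "(\<lambda>t. snd c (f t)) ` ?T \<subseteq> snd c ` (fst c \<inter> U)"
      using T(3) by auto
  qed
  then have "(\<lambda>t. h (f t)) holomorphic_on ?T"
    by (rule holomorphic_transform) (use chart_inj[OF c(1)] in auto)
  then show "\<exists>f'. ((\<lambda>t. h (f t)) has_field_derivative f') (at t)"
    unfolding holomorphic_on_open[OF o] by (rule bspec) (use t c T(2) in blast)
qed

lemma holomorphic_fun_continuous:
  assumes h: "holomorphic_fun A h U" and U: "open U"
  shows "continuous_on U h"
proof -
  have "isCont h x" if x: "x \<in> U" for x
  proof -
    obtain c where c: "c \<in> A" "x \<in> fst c" using chart_at by blast
    let ?W = "fst c \<inter> U"
    have "continuous_on (snd c ` ?W) (\<lambda>x. h (inv_into (fst c) (snd c) x))"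
      using h c by (auto simp: holomorphic_fun_def intro: holomorphic_mv_continuous_on)
    moreover have "continuous_on ?W (snd c)"
      using chart_continuous[OF c(1)] continuous_on_subset by blast
    ultimately have "continuous_on ?W (\<lambda>x. h (inv_into (fst c) (snd c) (snd c x)))"
      by (rule continuous_on_compose2) auto
    then have "continuous_on ?W h"
      by (rule continuous_on_eq) (use chart_inj[OF c(1)] in auto)
    moreover have "open ?W" using chart_open[OF c(1)] U by blast
    ultimately show ?thesis using c x by (simp add: continuous_on_eq_continuous_at)
  qed
  then show ?thesis by (simp add: continuous_at_imp_continuous_on)
qed

section \<open>Initial speed\<close>

text \<open>Independence of the chart that \<open>initial_speed\<close> selects by
  \<open>SOME\<close>: the velocities in two charts correspond under the Jacobian \<open>M\<close>
  of the transition, and the transformation law of the metric is invariance under exactly this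
  map.\<close>

lemma initial_speed_chart:
  assumes f: "holomorphic_disc A f" and g: "hermitian_metric A g" and c: "c \<in> A" "f 0 \<in> fst c"
  shows "initial_speed A g f = (let v = \<chi> i. deriv (\<lambda>t. snd c (f t) $ i) 0
           in sqrt (Re (sesquilinear_form (g c (f 0)) v v)))"
proof -
  define d where "d = (SOME d. d \<in> A \<and> f 0 \<in> fst d)"
  have d: "d \<in> A" "f 0 \<in> fst d"
    using someI[of "\<lambda>d. d \<in> A \<and> f 0 \<in> fst d" c] c by (auto simp: d_def)
  define v where "v = (\<chi> i. deriv (\<lambda>t. snd c (f t) $ i) 0)"
  define w where "w = (\<chi> i. deriv (\<lambda>t. snd d (f t) $ i) 0)"
  obtain M where M: "(transition c d has_derivative (\<lambda>v. M *v v)) (at (snd c (f 0)))"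
    using transition_has_derivative[OF c(1) d(1) c(2) d(2)] by blast
  have "((\<lambda>t. snd c (f t)) has_derivative (\<lambda>h. h *s v)) (at 0)"
    by (rule has_derivative_vec_field) (use disc_coord_has_derivative[OF f c(1) _ c(2)] in \<open>simp add: v_def\<close>)
  from has_derivative_compose[OF this M]
  have 1: "((\<lambda>t. transition c d (snd c (f t))) has_derivative (\<lambda>h. M *v (h *s v))) (at 0)" by simp
  have 2: "((\<lambda>t. snd d (f t)) has_derivative (\<lambda>h. M *v (h *s v))) (at 0)"
  proof (rule has_derivative_transform_eventually[OF 1])
    show "\<forall>\<^sub>F x in at 0. transition c d (snd c (f x)) = snd d (f x)"
      unfolding eventually_at_filter
      by (rule eventually_mono[OF disc_eventually[OF f chart_open[OF c(1)], of 0]])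
         (auto simp: transition_apply chart_inj c)
  qed (auto simp: transition_apply chart_inj c)
  have 3: "((\<lambda>t. snd d (f t)) has_derivative (\<lambda>h. h *s w)) (at 0)"
    by (rule has_derivative_vec_field) (use disc_coord_has_derivative[OF f d(1) _ d(2)] in \<open>simp add: w_def\<close>)
  \<comment> \<open>The derivative of \<open>snd d (f t)\<close> at 0 has been computed through the
    chart \<open>c\<close> and directly; evaluating both at the real number 1 compares the two
    velocities.\<close>
  have w: "w = M *v v"
    using fun_cong[OF has_derivative_unique[OF 2 3], of 1] by simp
  have "frechet_derivative (transition c d) (at (snd c (f 0))) = (\<lambda>v. M *v v)"
    using frechet_derivative_at[OF M] by simp
  then have "sesquilinear_form (g d (f 0)) w w = sesquilinear_form (g c (f 0)) v v"
    using g c d unfolding w hermitian_metric_def Let_def by (metis IntI)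
  then show ?thesis
    by (simp add: initial_speed_def d_def[symmetric] Let_def v_def[symmetric] w_def[symmetric])
qed

lemma initial_speed_nonneg:
  assumes "holomorphic_disc A f" "hermitian_metric A g"
  shows "0 \<le> initial_speed A g f"
proof -
  obtain c where c: "c \<in> A" "f 0 \<in> fst c" using chart_at by blast
  have "0 \<le> Re (sesquilinear_form (g c (f 0)) v v)" for v
  proof (cases "v = 0")
    case True
    then show ?thesis by (simp add: sesquilinear_form_def)
  next
    case False
    then show ?thesis using assms(2) c by (auto simp: hermitian_metric_def intro: less_imp_le)
  qed
  then show ?thesis by (simp add: initial_speed_chart[OF assms c] Let_def)
qed

text \<open>As \<open>h\<close> fixes 0, both discs have the same base point and the same metric
  coefficients there; the velocities differ by the scalar \<open>deriv h 0\<close>, which leaves the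
  form as a squared modulus.\<close>

lemma initial_speed_compose:
  assumes f: "holomorphic_disc A f" and \<alpha>: "holomorphic_disc A \<alpha>" and g: "hermitian_metric A g"
    and h: "h holomorphic_on ball 0 1" "h 0 = 0"
    and eq: "\<And>t. t \<in> ball 0 1 \<Longrightarrow> f t = \<alpha> (h t)"
  shows "initial_speed A g f = cmod (deriv h 0) * initial_speed A g \<alpha>"
proof -
  have f0: "f 0 = \<alpha> 0" using eq[of 0] h by simp
  obtain c where c: "c \<in> A" "f 0 \<in> fst c" using chart_at by blast
  then have c': "\<alpha> 0 \<in> fst c" by (simp add: f0)
  define v where "v = (\<chi> i. deriv (\<lambda>t. snd c (\<alpha> t) $ i) 0)"
  have h': "(h has_field_derivative deriv h 0) (at 0)"
    using holomorphic_derivI[OF h(1)] by simp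
  have "deriv (\<lambda>t. snd c (f t) $ i) 0 = deriv h 0 * v $ i" for i
  proof (rule DERIV_imp_deriv)
    have "((\<lambda>t. snd c (\<alpha> t) $ i) has_field_derivative v $ i) (at (h 0))"
      using disc_coord_has_derivative[OF \<alpha> c(1) _ c', of i] h by (simp add: v_def)
    from DERIV_chain2[OF this h']
    have "((\<lambda>t. snd c (\<alpha> (h t)) $ i) has_field_derivative v $ i * deriv h 0) (at 0)" .
    then show "((\<lambda>t. snd c (f t) $ i) has_field_derivative deriv h 0 * v $ i) (at 0)"
      by (rule DERIV_cong_ev[THEN iffD1, rotated -1])
         (auto simp: eq eventually_nhds mult.commute intro!: exI[of _ "ball 0 1"])
  qed
  then have "(\<chi> i. deriv (\<lambda>t. snd c (f t) $ i) 0) = deriv h 0 *s v"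
    by (simp add: vec_eq_iff)
  then show ?thesis
    by (simp add: initial_speed_chart[OF f g c] initial_speed_chart[OF \<alpha> g c(1) c'] Let_def
       v_def[symmetric] sesquilinear_form_scale f0 real_sqrt_mult)
qed

lemma initial_speed_le_of_factor:
  assumes f: "holomorphic_disc A f" and \<alpha>: "holomorphic_disc A \<alpha>" and g: "hermitian_metric A g"
    and h: "h holomorphic_on ball 0 1" "h ` ball 0 1 \<subseteq> ball 0 1" "h 0 = 0"
    and eq: "\<And>t. t \<in> ball 0 1 \<Longrightarrow> f t = \<alpha> (h t)"
  shows "initial_speed A g f \<le> initial_speed A g \<alpha>"
proof -
  have "cmod (deriv h 0) \<le> 1"
    by (rule Schwarz_Lemma(2)[OF h(1,3), of 0]) (use h(2) in \<open>auto simp: image_subset_iff\<close>)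
  then show ?thesis
    using initial_speed_compose[OF f \<alpha> g h(1,3) eq] initial_speed_nonneg[OF \<alpha> g]
    by (simp add: mult_left_le_one_le)
qed

text \<open>Weierstrass in one chart around \<open>f 0\<close>: from some index on, a fixed small
  disc is mapped into the chart, the coordinates converge uniformly there, and so do their
  derivatives at 0. The metric coefficients at the moving base points converge by
  continuity.\<close>

lemma initial_speed_tendsto:
  assumes s: "\<And>n. holomorphic_disc A (s n)" and f: "holomorphic_disc A f" and g: "hermitian_metric A g"
    and conv: "converges_continuously s f (ball 0 1)"
  shows "(\<lambda>n. initial_speed A g (s n)) \<longlonglongrightarrow> initial_speed A g f"
proof -
  obtain c where c: "c \<in> A" "f 0 \<in> fst c" using chart_at by blast
  obtain r N where r: "r > 0" "\<And>k x. k \<ge> N \<Longrightarrow> dist x 0 < r \<Longrightarrow> s k x \<in> fst c"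
    using converges_continuouslyD[OF conv _ chart_open[OF c(1)] c(2)] by auto
  obtain r' where r': "r' > 0" "\<And>x. dist x 0 < r' \<Longrightarrow> f x \<in> fst c"
    using disc_eventually[OF f chart_open[OF c(1)] _ c(2)] by (auto simp: eventually_nhds_metric)
  \<comment> \<open>The bound 1/2 keeps the closed disc inside the unit disc; halving
    \<open>min r r'\<close> turns the non-strict bound on the closed disc into the strict bounds
    below \<open>r\<close> and \<open>r'\<close>.\<close>
  define \<rho> where "\<rho> = min (1/2) (min r r' / 2)"
  have \<rho>: "\<rho> > 0" "cball 0 \<rho> \<subseteq> ball 0 1" "\<And>x. x \<in> cball 0 \<rho> \<Longrightarrow> dist x 0 < r \<and> dist x 0 < r'"
  proof -
    show "\<rho> > 0" using r(1) r'(1) by (simp add: \<rho>_def)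
    show "cball 0 \<rho> \<subseteq> ball 0 1" by (auto simp: \<rho>_def)
    show "dist x 0 < r \<and> dist x 0 < r'" if "x \<in> cball 0 \<rho>" for x
    proof -
      have "dist x 0 \<le> min r r' / 2" using that by (simp add: \<rho>_def dist_commute)
      then show ?thesis using r(1) r'(1) by linarith
    qed
  qed
  let ?v = "\<lambda>f. \<chi> i. deriv (\<lambda>t. snd c (f t) $ i) 0"
  have coord: "continuous_on (fst c) (\<lambda>x. snd c x $ i)" for i
    using chart_continuous[OF c(1)] by (intro continuous_intros)
  have "(\<lambda>n. deriv (\<lambda>t. snd c (s n t) $ i) 0) \<longlonglongrightarrow> deriv (\<lambda>t. snd c (f t) $ i) 0" for i
  proof -
    have "converges_continuously (\<lambda>n x. snd c (s n x) $ i) (\<lambda>x. snd c (f x) $ i) (cball 0 \<rho>)"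
    proof (rule converges_continuously_image[OF _ chart_open[OF c(1)] coord])
      show "converges_continuously s f (cball 0 \<rho>)"
        using conv \<rho>(2) by (auto simp: converges_continuously_def)
      show "f ` cball 0 \<rho> \<subseteq> fst c" using \<rho>(3) r'(2) by blast
    qed
    moreover have "continuous_on (cball 0 \<rho>) (\<lambda>x. snd c (f x) $ i)"
    proof (rule continuous_on_compose2[OF coord])
      show "continuous_on (cball 0 \<rho>) f"
        using f \<rho>(2) by (auto simp: holomorphic_disc_def intro: continuous_on_subset)
      show "f ` cball 0 \<rho> \<subseteq> fst c" using \<rho>(3) r'(2) by blast
    qed
    ultimately have "uniform_limit (cball 0 \<rho>) (\<lambda>n x. snd c (s n x) $ i) (\<lambda>x. snd c (f x) $ i) sequentially"
      by (intro converges_continuously_imp_uniform_limit) auto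
    then have ul: "uniform_limit (ball 0 \<rho>) (\<lambda>n x. snd c (s n x) $ i) (\<lambda>x. snd c (f x) $ i) sequentially"
      by (rule uniform_limit_on_subset) auto
    have "\<forall>\<^sub>F n in sequentially. (\<lambda>x. snd c (s n x) $ i) holomorphic_on ball 0 \<rho>"
      using eventually_ge_at_top[of N]
    proof eventually_elim
      case (elim n)
      have "ball 0 \<rho> \<subseteq> {t \<in> ball 0 1. s n t \<in> fst c}"
      proof
        fix t :: complex assume "t \<in> ball 0 \<rho>"
        then have "t \<in> cball 0 \<rho>" by simp
        then show "t \<in> {t \<in> ball 0 1. s n t \<in> fst c}"
          using subsetD[OF \<rho>(2), of t] \<rho>(3)[of t] r(2)[OF elim, of t] by blast
      qed
      then show ?case
        using s[of n] c(1) by (auto simp: holomorphic_disc_def intro: holomorphic_on_subset)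
    qed
    from higher_deriv_complex_uniform_limit[OF ul this _ open_ball, of 0 1] \<rho>(1)
    show ?thesis by simp
  qed
  then have v: "(\<lambda>n. ?v (s n)) \<longlonglongrightarrow> ?v f"
    by (intro tendsto_vec_lambda)
  have s0: "(\<lambda>n. s n 0) \<longlonglongrightarrow> f 0"
    by (rule converges_continuously_compose[OF conv]) auto
  have ev: "\<forall>\<^sub>F n in sequentially. s n 0 \<in> fst c"
    using eventually_ge_at_top[of N] by eventually_elim (use r in auto)
  have s0c: "(\<lambda>n. snd c (s n 0)) \<longlonglongrightarrow> snd c (f 0)"
    by (rule continuous_on_tendsto_compose[OF chart_continuous[OF c(1)] s0 c(2) ev])
  have "\<forall>n. C_class n (\<lambda>x. g c (inv_into (fst c) (snd c) x)) (snd c ` fst c)"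
    using g c(1) unfolding hermitian_metric_def smooth_on_def by blast
  then have "C_class 0 (\<lambda>x. g c (inv_into (fst c) (snd c) x)) (snd c ` fst c)" by (rule spec)
  then have "continuous_on (snd c ` fst c) (\<lambda>x. g c (inv_into (fst c) (snd c) x))" by simp
  then have "(\<lambda>n. g c (inv_into (fst c) (snd c) (snd c (s n 0)))) \<longlonglongrightarrow> g c (inv_into (fst c) (snd c) (snd c (f 0)))"
    by (rule continuous_on_tendsto_compose[OF _ s0c])
       (use c(2) ev in \<open>auto elim!: eventually_mono\<close>)
  then have "(\<lambda>n. g c (inv_into (fst c) (snd c) (snd c (s n 0)))) \<longlonglongrightarrow> g c (f 0)"
    using c chart_inj[OF c(1)] by simp
  then have G: "(\<lambda>n. g c (s n 0)) \<longlonglongrightarrow> g c (f 0)"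
    by (rule Lim_transform_eventually)
       (use ev c chart_inj[OF c(1)] in \<open>auto elim!: eventually_mono\<close>)
  have "(\<lambda>n. sqrt (Re (sesquilinear_form (g c (s n 0)) (?v (s n)) (?v (s n)))))
      \<longlonglongrightarrow> sqrt (Re (sesquilinear_form (g c (f 0)) (?v f) (?v f)))"
    unfolding sesquilinear_form_def by (intro tendsto_intros G v)
  then show ?thesis
    unfolding initial_speed_chart[OF f g c] Let_def
    by (rule Lim_transform_eventually)
       (use ev in \<open>auto elim!: eventually_mono simp: initial_speed_chart[OF s g c(1)] Let_def\<close>)
qed

end

text \<open>Locally \<psi> is a holomorphic inverse of the injective map \<phi> composed with the
  holomorphic function \<phi> (\<psi> t), so continuity of \<psi> is enough to start from.\<close>

lemma holomorphic_lift:
  assumes S: "open S" and \<phi>: "\<phi> holomorphic_on S"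
    and inj: "\<And>s. s \<in> S \<Longrightarrow> \<exists>W. open W \<and> s \<in> W \<and> inj_on \<phi> (W \<inter> S)"
    and T: "open T" and \<psi>: "continuous_on T \<psi>" "\<psi> ` T \<subseteq> S"
    and hol: "(\<lambda>t. \<phi> (\<psi> t)) holomorphic_on T"
  shows "\<psi> holomorphic_on T"
  unfolding holomorphic_on_open[OF T]
proof
  fix t assume t: "t \<in> T"
  then have "\<psi> t \<in> S" using \<psi>(2) by blast
  then obtain W where W: "open W" "\<psi> t \<in> W" "inj_on \<phi> (W \<inter> S)" using inj by blast
  have oWS: "open (W \<inter> S)" using W(1) S by blast
  have "\<phi> holomorphic_on (W \<inter> S)" using \<phi> holomorphic_on_subset by blast
  from holomorphic_has_inverse[OF this oWS W(3)]
  obtain h where h: "h holomorphic_on \<phi> ` (W \<inter> S)" "\<And>z. z \<in> W \<inter> S \<Longrightarrow> h (\<phi> z) = z" by metis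
  let ?T = "T \<inter> \<psi> -` W"
  have oT: "open ?T" using continuous_open_preimage[OF \<psi>(1) T W(1)] .
  have "(h \<circ> (\<lambda>t. \<phi> (\<psi> t))) holomorphic_on ?T"
    by (rule holomorphic_on_compose_gen[OF _ h(1)])
       (use hol \<psi>(2) in \<open>auto intro: holomorphic_on_subset\<close>)
  then have "\<psi> holomorphic_on ?T"
    by (rule holomorphic_transform) (use h(2) \<psi>(2) in auto)
  then show "\<exists>f'. (\<psi> has_field_derivative f') (at t)"
    unfolding holomorphic_on_open[OF oT] by (rule bspec) (use t W in blast)
qed

section \<open>Foliated charts\<close>

text \<open>The parametrization of the plaque through \<open>p\<close> by its leaf coordinate.
  Foliated charts map onto the unit polydisc, so every plaque is parametrized by the same unit disc,
  independently of \<open>p\<close>.\<close>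

definition plaque_point :: "('a, 'm::finite) fchart \<Rightarrow> 'a \<Rightarrow> complex \<Rightarrow> 'a" where
  "plaque_point c p u =
     inv_into (dom_of c) (coord_of c) (\<chi> i. if i = leaf_coord c then u else coord_of c p $ i)"

text \<open>For continuous \<open>f\<close> this expresses continuity into the leaf topology:
  plaques are its local pieces. Stated chart by chart, it reduces to constancy of the transverse
  coordinates, which passes to limits.\<close>

definition leafwise :: "('a, 'm::finite) fchart set \<Rightarrow> (complex \<Rightarrow> 'a) \<Rightarrow> bool" where
  "leafwise F f \<longleftrightarrow> f ` ball 0 1 \<subseteq> (\<Union>c\<in>F. dom_of c) \<and>
     (\<forall>c\<in>F. \<forall>t\<in>ball 0 1. f t \<in> dom_of c \<longrightarrow> (\<forall>\<^sub>F x in nhds t. f x \<in> plaque c (f t)))"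

text \<open>Replaces the covering property of a uniformization: unlike the latter it mentions only
  whole plaques, so that Montel's theorem carries it over to limits of uniformizations.\<close>

definition has_plaque_sections :: "('a, 'm::finite) fchart set \<Rightarrow> (complex \<Rightarrow> 'a) \<Rightarrow> bool" where
  "has_plaque_sections F \<alpha> \<longleftrightarrow>
     (\<forall>s\<in>ball 0 1. \<forall>c\<in>F. \<alpha> s \<in> dom_of c \<longrightarrow>
        (\<exists>\<psi>. \<psi> holomorphic_on ball 0 1 \<and> \<psi> ` ball 0 1 \<subseteq> ball 0 1 \<and>
             \<psi> (coord_of c (\<alpha> s) $ leaf_coord c) = s \<and>
             (\<forall>u\<in>ball 0 1. \<alpha> (\<psi> u) = plaque_point c (\<alpha> s) u)))"

locale foliated_manifold = complex_manifold A
  for A :: "('a::{t2_space, second_countable_topology}, 'm::finite) chart set" +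
  fixes F :: "('a, 'm) fchart set" and E :: "'a set"
  assumes foliated: "foliated_atlas A (- E) F"
begin

lemma chart_of_in: "c \<in> F \<Longrightarrow> chart_of c \<in> A"
  using foliated by (simp add: foliated_atlas_def foliated_chart_def)

lemma dom_union: "(\<Union>c\<in>F. dom_of c) = - E"
  using foliated by (simp add: foliated_atlas_def)

lemma polydisc: "c \<in> F \<Longrightarrow> coord_of c ` dom_of c = {z. \<forall>i. cmod (z $ i) < 1}"
  using foliated by (simp add: foliated_atlas_def foliated_chart_def)

lemma foliated_chart_at:
  assumes "p \<in> - E" obtains c where "c \<in> F" "p \<in> dom_of c"
  using assms dom_union by blast

lemma dom_open: "c \<in> F \<Longrightarrow> open (dom_of c)"
  using chart_open[OF chart_of_in, of c] by simp

lemma coord_continuous: "c \<in> F \<Longrightarrow> continuous_on (dom_of c) (coord_of c)"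
  using chart_continuous[OF chart_of_in, of c] by simp

lemma coord_inj: "c \<in> F \<Longrightarrow> inj_on (coord_of c) (dom_of c)"
  using chart_inj[OF chart_of_in, of c] by simp

lemma coord_inv_continuous:
  "c \<in> F \<Longrightarrow> continuous_on {z. \<forall>i. cmod (z $ i) < 1} (inv_into (dom_of c) (coord_of c))"
  using chart_inv_continuous[OF chart_of_in, of c] polydisc[of c] by simp

lemma singular_closed: "closed E"
  using dom_union dom_open by (metis closed_open open_UN)

lemma coord_ball:
  assumes "c \<in> F" "x \<in> dom_of c" shows "coord_of c x $ i \<in> ball 0 1"
proof -
  have "coord_of c x \<in> {z. \<forall>i. cmod (z $ i) < 1}"
    using polydisc[OF assms(1)] assms(2) by blast
  then show ?thesis by simp
qed

lemma plaque_self: "p \<in> dom_of c \<Longrightarrow> p \<in> plaque c p"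
  by (simp add: plaque_def)

lemma plaque_eq: "x \<in> plaque c p \<Longrightarrow> plaque c x = plaque c p"
  by (auto simp: plaque_def)

lemma plaque_dom: "x \<in> plaque c p \<Longrightarrow> x \<in> dom_of c"
  by (simp add: plaque_def)

lemma plaque_point:
  assumes "c \<in> F" "p \<in> dom_of c" "u \<in> ball 0 1"
  shows "plaque_point c p u \<in> plaque c p"
    and "coord_of c (plaque_point c p u) = (\<chi> i. if i = leaf_coord c then u else coord_of c p $ i)"
    and "plaque_point c p u \<in> dom_of c"
proof -
  let ?w = "\<chi> i. if i = leaf_coord c then u else coord_of c p $ i"
  have "?w \<in> {z. \<forall>i. cmod (z $ i) < 1}"
    using coord_ball[OF assms(1,2)] assms(3) by simp
  then have w: "?w \<in> coord_of c ` dom_of c" using polydisc[OF assms(1)] by simp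
  show *: "coord_of c (plaque_point c p u) = ?w" "plaque_point c p u \<in> dom_of c"
    using f_inv_into_f[OF w] inv_into_into[OF w] by (simp_all add: plaque_point_def)
  then show "plaque_point c p u \<in> plaque c p"
    by (simp add: plaque_def)
qed

lemma plaque_point_leaf_coord:
  assumes "c \<in> F" "x \<in> plaque c p"
  shows "plaque_point c p (coord_of c x $ leaf_coord c) = x"
proof -
  have "(\<chi> i. if i = leaf_coord c then coord_of c x $ leaf_coord c else coord_of c p $ i) = coord_of c x"
    using assms(2) by (simp add: vec_eq_iff plaque_def)
  then show ?thesis
    using assms coord_inj[OF assms(1)] by (simp add: plaque_point_def plaque_def)
qed

lemma plaque_coord_inj:
  assumes "c \<in> F" "x \<in> plaque c p" "y \<in> plaque c p"
    and "coord_of c x $ leaf_coord c = coord_of c y $ leaf_coord c"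
  shows "x = y"
  using plaque_point_leaf_coord[OF assms(1,2)] plaque_point_leaf_coord[OF assms(1,3)]
  unfolding assms(4) by (rule trans[OF sym])

lemma plaque_point_continuous:
  assumes "c \<in> F" "p \<in> dom_of c"
  shows "continuous_on (ball 0 1) (plaque_point c p)"
proof -
  have "continuous_on (ball 0 1)
    (\<lambda>u. inv_into (dom_of c) (coord_of c) (\<chi> i. if i = leaf_coord c then u else coord_of c p $ i))"
  proof (rule continuous_on_compose2[OF coord_inv_continuous[OF assms(1)]])
    have "continuous_on (ball 0 1) (\<lambda>u. if i = leaf_coord c then u else coord_of c p $ i)" for i
      by (cases "i = leaf_coord c") auto
    then show "continuous_on (ball 0 1) (\<lambda>u. \<chi> i. if i = leaf_coord c then u else coord_of c p $ i)"
      by (intro continuous_on_vec_lambda)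
  qed (use coord_ball[OF assms] in auto)
  then show ?thesis by (simp add: plaque_point_def[abs_def])
qed

text \<open>Along a plaque of \<open>c\<close> the transverse coordinates of \<open>d\<close> have
  derivative zero by compatibility, and on a disc this makes them constant. So plaques of different
  charts agree locally wherever they meet.\<close>

lemma plaque_point_eventually:
  assumes c: "c \<in> F" "p \<in> dom_of c" and d: "d \<in> F" and u: "u \<in> ball 0 1" "plaque_point c p u \<in> dom_of d"
  shows "\<forall>\<^sub>F x in nhds u. plaque_point c p x \<in> plaque d (plaque_point c p u)"
proof -
  let ?P = "plaque_point c p"
  have "open (ball 0 1 \<inter> ?P -` dom_of d)"
    by (rule continuous_open_preimage[OF plaque_point_continuous[OF c] open_ball dom_open[OF d]])
  then obtain r where r: "r > 0" "ball u r \<subseteq> ball 0 1 \<inter> ?P -` dom_of d"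
    using u open_contains_ball by (metis IntI vimageI)
  have const: "coord_of d (?P x) $ i = coord_of d (?P u) $ i" if i: "i \<noteq> leaf_coord d" and x: "x \<in> ball u r" for i x
  proof -
    have "((\<lambda>x. coord_of d (?P x) $ i) has_field_derivative 0) (at y within ball u r)" if y: "y \<in> ball u r" for y
    proof -
      have y1: "y \<in> ball 0 1" "?P y \<in> dom_of d" using r y by auto
      have y2: "?P y \<in> dom_of c" using plaque_point(3)[OF c y1(1)] .
      obtain M where M: "(transition (chart_of c) (chart_of d) has_derivative (\<lambda>v. M *v v)) (at (coord_of c (?P y)))"
        using transition_has_derivative[OF chart_of_in[OF c(1)] chart_of_in[OF d], of "?P y"] y1 y2 by auto
      have "foliation_compatible c d"
        using foliated c(1) d by (simp add: foliated_atlas_def)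
      \<comment> \<open>Compatibility read off from the Jacobian: in the column of the leaf
        direction of \<open>c\<close> only the row \<open>leaf_coord d\<close> can be
        nonzero.\<close>
      then have Mi: "(M *v axis (leaf_coord c) 1) $ i = 0"
        using frechet_derivative_at[OF M] y1 y2 i by (auto simp: foliation_compatible_def)
      let ?w = "\<lambda>x. \<chi> i. if i = leaf_coord c then x else coord_of c p $ i"
      have w: "(?w has_derivative (\<lambda>h. h *s axis (leaf_coord c) 1)) (at y)"
      proof (rule has_derivative_vec_field)
        show "((\<lambda>x. ?w x $ i) has_field_derivative axis (leaf_coord c) 1 $ i) (at y)" for i
          by (cases "i = leaf_coord c") (auto simp: axis_def)
      qed
      have "?w y = coord_of c (?P y)" using plaque_point(2)[OF c y1(1)] by simp
      with M have "(transition (chart_of c) (chart_of d) has_derivative (\<lambda>v. M *v v)) (at (?w y))" by simp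
      from has_derivative_compose[OF w this]
      have "((\<lambda>x. transition (chart_of c) (chart_of d) (?w x)) has_derivative (\<lambda>h. M *v (h *s axis (leaf_coord c) 1))) (at y)" .
      then have "((\<lambda>x. transition (chart_of c) (chart_of d) (?w x) $ i) has_derivative (\<lambda>h. (M *v (h *s axis (leaf_coord c) 1)) $ i)) (at y)"
        by (rule bounded_linear.has_derivative[OF bounded_linear_vec_nth])
      moreover have "(\<lambda>h. (M *v (h *s axis (leaf_coord c) 1)) $ i) = (*) 0"
        using Mi by (auto simp: vector_scalar_commute)
      ultimately have "((\<lambda>x. transition (chart_of c) (chart_of d) (?w x) $ i) has_field_derivative 0) (at y)"
        unfolding has_field_derivative_def by metis
      then have "((\<lambda>x. transition (chart_of c) (chart_of d) (?w x) $ i) has_field_derivative 0) (at y within ball u r)"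
        by (rule has_field_derivative_at_within)
      then show ?thesis
      proof (rule has_field_derivative_transform_within[OF _ zero_less_one y])
        fix z assume z: "z \<in> ball u r"
        then have z1: "z \<in> ball 0 1" using r by auto
        have "transition (chart_of c) (chart_of d) (coord_of c (?P z)) = coord_of d (?P z)"
          using transition_apply[of "chart_of c" "?P z" "chart_of d"] coord_inj[OF c(1)] plaque_point(3)[OF c z1]
          by simp
        then show "transition (chart_of c) (chart_of d) (?w z) $ i = coord_of d (?P z) $ i"
          using plaque_point(2)[OF c z1] by simp
      qed
    qed
    then have "\<exists>k. \<forall>x\<in>ball u r. coord_of d (?P x) $ i = k"
      by (intro has_field_derivative_zero_constant convex_ball)
    then show ?thesis using x r(1) by (metis centre_in_ball)
  qed
  have "\<forall>\<^sub>F x in nhds u. x \<in> ball u r"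
    using r(1) by (intro eventually_nhds_in_open) auto
  then show ?thesis
  proof eventually_elim
    case (elim x)
    then show ?case using const r(2) by (auto simp: plaque_def)
  qed
qed

section \<open>Leafwise maps\<close>

lemma leafwise_dom: "leafwise F f \<Longrightarrow> t \<in> ball 0 1 \<Longrightarrow> f t \<in> - E"
  unfolding leafwise_def dom_union by blast

lemma leafwiseD:
  assumes "leafwise F f" "c \<in> F" "t \<in> ball 0 1" "f t \<in> dom_of c"
  obtains r where "r > 0" "ball t r \<subseteq> ball 0 1" "\<And>x. x \<in> ball t r \<Longrightarrow> f x \<in> plaque c (f t)"
proof -
  have "\<forall>\<^sub>F x in nhds t. f x \<in> plaque c (f t)"
    using assms by (auto simp: leafwise_def)
  then obtain r where r: "r > 0" "\<And>x. dist x t < r \<Longrightarrow> f x \<in> plaque c (f t)"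
    unfolding eventually_nhds_metric by blast
  obtain r' where r': "r' > 0" "ball t r' \<subseteq> ball 0 1"
    using assms(3) open_contains_ball open_ball by blast
  show thesis
  proof (rule that[of "min r r'"])
    show "ball t (min r r') \<subseteq> ball 0 1" using r'(2) by (auto simp: subset_iff)
  qed (use r r' in \<open>auto simp: dist_commute\<close>)
qed

lemma leafwise_plaque_point:
  assumes "c \<in> F" "p \<in> dom_of c"
  shows "leafwise F (plaque_point c p)"
  unfolding leafwise_def
  using plaque_point(3)[OF assms] plaque_point_eventually[OF assms] assms(1) by blast

lemma leaf_step: "c \<in> F \<Longrightarrow> q \<in> leaf F p \<Longrightarrow> q \<in> dom_of c \<Longrightarrow> x \<in> plaque c q \<Longrightarrow> x \<in> leaf F p"
  unfolding leaf_def mem_Collect_eq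
  by (rule rtranclp.rtrancl_into_rtrancl) auto

lemma leaf_self: "p \<in> leaf F p"
  by (simp add: leaf_def)

lemma leaf_regular:
  assumes "p \<in> - E" "q \<in> leaf F p" shows "q \<in> - E"
  using assms(2) unfolding leaf_def mem_Collect_eq
  by (induction rule: rtranclp_induct) (use assms(1) dom_union in \<open>auto simp: plaque_def\<close>)

text \<open>A plaque step can be taken in either direction, so membership of \<open>f t\<close> in
  the leaf is locally constant in \<open>t\<close>, and the disc is connected.\<close>

lemma leafwise_in_leaf:
  assumes f: "leafwise F f" and a: "a \<in> ball 0 1" "f a \<in> leaf F p" and t: "t \<in> ball 0 1"
  shows "f t \<in> leaf F p"
proof -
  have "(f a \<in> leaf F p) = (f t \<in> leaf F p)"
  proof (rule connected_local_const[OF connected_ball a(1) t], intro ballI)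
    fix x assume x: "x \<in> ball (0::complex) 1"
    obtain c where c: "c \<in> F" "f x \<in> dom_of c"
      using leafwise_dom[OF f x] foliated_chart_at by blast
    have "\<forall>\<^sub>F y in nhds x. f y \<in> plaque c (f x)"
      using f c x by (auto simp: leafwise_def)
    then have "\<forall>\<^sub>F y in nhds x. (f x \<in> leaf F p) = (f y \<in> leaf F p)"
    proof eventually_elim
      case (elim y)
      then show ?case
        using leaf_step[OF c(1) _ c(2) elim] leaf_step[OF c(1) _ plaque_dom[OF elim]]
          plaque_eq[OF elim] plaque_self[OF c(2)] by blast
    qed
    then show "\<forall>\<^sub>F y in at x within ball 0 1. (f x \<in> leaf F p) = (f y \<in> leaf F p)"
      unfolding eventually_at_filter by (rule eventually_mono) simp
  qed
  then show ?thesis using a by simp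
qed

lemma openin_leaf_topology_plaque:
  assumes "c \<in> F" "p \<in> dom_of c" shows "openin (leaf_topology F) (plaque c p)"
  unfolding leaf_topology_def
proof (rule topology_generated_by_Basis, rule CollectI, intro exI conjI)
  show "plaque c p = UNIV \<inter> plaque c p" by simp
qed (use assms in auto)

lemma topspace_leaf_topology: "topspace (leaf_topology F) = - E"
proof -
  have "\<Union>{V \<inter> plaque c p | V c p. open V \<and> c \<in> F \<and> p \<in> dom_of c} = (\<Union>c\<in>F. dom_of c)"
  proof
    show "(\<Union>c\<in>F. dom_of c) \<subseteq> \<Union>{V \<inter> plaque c p | V c p. open V \<and> c \<in> F \<and> p \<in> dom_of c}"
    proof
      fix x assume "x \<in> (\<Union>c\<in>F. dom_of c)"
      then obtain c where "c \<in> F" "x \<in> dom_of c" by blast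
      then show "x \<in> \<Union>{V \<inter> plaque c p | V c p. open V \<and> c \<in> F \<and> p \<in> dom_of c}"
        by (intro UnionI[of "UNIV \<inter> plaque c x"] CollectI exI conjI)
           (rule refl open_UNIV | simp add: plaque_self)+
    qed
  qed (auto simp: plaque_def)
  then show ?thesis by (simp add: leaf_topology_def dom_union)
qed

text \<open>It suffices to test the generating sets \<open>V \<inter> plaque c p\<close>: ordinary
  continuity handles \<open>V\<close>, and local constancy of the plaque handles the other
  factor.\<close>

lemma leafwise_continuous_map:
  assumes f: "leafwise F f" "continuous_on (ball 0 1) f"
  shows "continuous_map (top_of_set (ball 0 1)) (leaf_topology F) f"
  unfolding leaf_topology_def
proof (rule continuous_on_generated_topo)
  fix U assume "U \<in> {V \<inter> plaque c p | V c p. open V \<and> c \<in> F \<and> p \<in> dom_of c}"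
  then obtain V c p where U: "U = V \<inter> plaque c p" "open V" "c \<in> F" "p \<in> dom_of c" by blast
  have "open (f -` U \<inter> ball 0 1)"
    unfolding open_contains_ball
  proof
    fix t assume t: "t \<in> f -` U \<inter> ball 0 1"
    then have ft: "f t \<in> V" "f t \<in> plaque c p" "t \<in> ball 0 1" using U by auto
    obtain r where r: "r > 0" "ball t r \<subseteq> ball 0 1" "\<And>x. x \<in> ball t r \<Longrightarrow> f x \<in> plaque c (f t)"
      using leafwiseD[OF f(1) U(3) ft(3) plaque_dom[OF ft(2)]] by blast
    have "open (ball 0 1 \<inter> f -` V)" by (rule continuous_open_preimage[OF f(2) open_ball U(2)])
    then obtain r' where r': "r' > 0" "ball t r' \<subseteq> ball 0 1 \<inter> f -` V"
      using ft open_contains_ball by (metis IntI vimageI)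
    have "ball t (min r r') \<subseteq> f -` U \<inter> ball 0 1"
    proof
      fix x assume "x \<in> ball t (min r r')"
      then have x: "x \<in> ball t r" "x \<in> ball t r'" by auto
      show "x \<in> f -` U \<inter> ball 0 1"
        using r(3)[OF x(1)] plaque_eq[OF ft(2)] subsetD[OF r'(2) x(2)] by (simp add: U(1))
    qed
    then show "\<exists>e>0. ball t e \<subseteq> f -` U \<inter> ball 0 1" using r(1) r'(1) by (intro exI[of _ "min r r'"]) auto
  qed
  then show "openin (top_of_set (ball 0 1)) (f -` U \<inter> topspace (top_of_set (ball 0 1)))"
    by (simp add: open_subset)
next
  show "f ` topspace (top_of_set (ball 0 1)) \<subseteq> \<Union>{V \<inter> plaque c p | V c p. open V \<and> c \<in> F \<and> p \<in> dom_of c}"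
    using topspace_leaf_topology leafwise_dom[OF f(1)] by (auto simp: leaf_topology_def)
qed

section \<open>Uniformizations\<close>

lemma uniformization_image:
  assumes "uniformization A F \<alpha> (leaf F p)" "p \<in> - E"
  shows "\<alpha> ` ball 0 1 = leaf F p"
  using assms leaf_regular[OF assms(2)]
  by (auto simp: uniformization_def covering_projection_def topspace_leaf_topology)

lemma uniformization_leafwise:
  assumes \<alpha>: "uniformization A F \<alpha> (leaf F p)" and p: "p \<in> - E"
  shows "leafwise F \<alpha>"
  unfolding leafwise_def dom_union
proof (intro conjI ballI impI)
  show "\<alpha> ` ball 0 1 \<subseteq> - E"
    using uniformization_image[OF assms] leaf_regular[OF p] by blast
  fix c t assume c: "c \<in> F" and t: "t \<in> ball (0::complex) 1" "\<alpha> t \<in> dom_of c"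
  have "continuous_map (top_of_set (ball 0 1)) (subtopology (leaf_topology F) (leaf F p)) \<alpha>"
    using \<alpha> by (simp add: uniformization_def covering_projection_def)
  then have "continuous_map (top_of_set (ball 0 1)) (leaf_topology F) \<alpha>"
    by (rule continuous_map_into_fulltopology)
  then have "openin (top_of_set (ball 0 1)) {x \<in> topspace (top_of_set (ball 0 1)). \<alpha> x \<in> plaque c (\<alpha> t)}"
    by (rule openin_continuous_map_preimage) (rule openin_leaf_topology_plaque[OF c t(2)])
  then have "open {x \<in> ball 0 1. \<alpha> x \<in> plaque c (\<alpha> t)}"
    using openin_open_eq[of "ball (0::complex) 1"] by simp
  then have "\<forall>\<^sub>F x in nhds t. x \<in> {x \<in> ball 0 1. \<alpha> x \<in> plaque c (\<alpha> t)}"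
    by (rule eventually_nhds_in_open) (use t plaque_self[OF t(2)] in simp)
  then show "\<forall>\<^sub>F x in nhds t. \<alpha> x \<in> plaque c (\<alpha> t)"
    by (rule eventually_mono) simp
qed

lemma uniformization_locally_injective:
  assumes \<alpha>: "uniformization A F \<alpha> (leaf F p)" and s: "s \<in> ball 0 1"
  shows "\<exists>W. open W \<and> s \<in> W \<and> inj_on \<alpha> (W \<inter> ball 0 1)"
proof -
  let ?X = "top_of_set (ball (0::complex) 1)" and ?Y = "subtopology (leaf_topology F) (leaf F p)"
  have cov: "covering_projection ?X \<alpha> ?Y" using \<alpha> by (simp add: uniformization_def)
  then have "\<alpha> s \<in> topspace ?Y" using s by (auto simp: covering_projection_def)
  then obtain V \<V> where V: "\<alpha> s \<in> V" "\<Union>\<V> = {x \<in> topspace ?X. \<alpha> x \<in> V}"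
      "\<forall>U\<in>\<V>. openin ?X U" "\<forall>U\<in>\<V>. homeomorphic_map (subtopology ?X U) (subtopology ?Y V) \<alpha>"
    using cov unfolding covering_projection_def by blast
  have "s \<in> \<Union>\<V>" using V(1,2) s by simp
  then obtain U where U: "U \<in> \<V>" "s \<in> U" by blast
  have UX: "U \<subseteq> ball 0 1" "open U"
    using V(3) U(1) by (auto simp: openin_open_eq dest: openin_subset)
  have "inj_on \<alpha> U"
    using V(4) U(1) UX by (auto simp: homeomorphic_map_def inf.absorb2)
  then show ?thesis using UX U by (intro exI[of _ U]) (auto intro: inj_on_subset)
qed

text \<open>Reduction to \<open>lift_through_local_sections\<close>: a ball around \<open>t0\<close>
  is mapped by \<open>f\<close> into one evenly covered set, and the section through
  \<open>s\<close> is the inverse of \<alpha> on the sheet of \<open>s\<close>, composed with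
  \<open>f\<close>. Continuity of \<open>f\<close> into the leaf topology is what makes such a ball
  exist.\<close>

lemma uniformization_lift:
  assumes \<alpha>: "uniformization A F \<alpha> (leaf F p)" and p: "p \<in> - E"
    and f: "leafwise F f" "continuous_on (ball 0 1) f" "f ` ball 0 1 \<subseteq> leaf F p"
    and ab: "a \<in> ball 0 1" "b \<in> ball 0 1" "\<alpha> b = f a"
  obtains h where "continuous_on (ball 0 1) h" "h ` ball 0 1 \<subseteq> ball 0 1"
    "\<And>t. t \<in> ball 0 1 \<Longrightarrow> \<alpha> (h t) = f t" "h a = b"
proof -
  let ?X = "top_of_set (ball (0::complex) 1)" and ?Y = "subtopology (leaf_topology F) (leaf F p)"
  have cov: "covering_projection ?X \<alpha> ?Y" using \<alpha> by (simp add: uniformization_def)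
  have fY: "continuous_map ?X ?Y f"
    using leafwise_continuous_map[OF f(1,2)] f(3) by (auto simp: continuous_map_in_subtopology)
  have loc: "\<exists>N. open N \<and> connected N \<and> t0 \<in> N \<and> N \<subseteq> ball 0 1 \<and>
        (\<forall>t\<in>N. \<forall>s\<in>ball 0 1. \<alpha> s = f t \<longrightarrow>
          (\<exists>k. continuous_on N k \<and> k ` N \<subseteq> ball 0 1 \<and> (\<forall>x\<in>N. \<alpha> (k x) = f x) \<and> k t = s))"
    if t0: "t0 \<in> ball 0 1" for t0
  proof -
    have "f t0 \<in> topspace ?Y" using fY t0 by (auto simp: continuous_map_def)
    then obtain V \<V> where V: "f t0 \<in> V" "openin ?Y V" "\<Union>\<V> = {x \<in> topspace ?X. \<alpha> x \<in> V}"
        "\<forall>U\<in>\<V>. openin ?X U" "\<forall>U\<in>\<V>. homeomorphic_map (subtopology ?X U) (subtopology ?Y V) \<alpha>"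
      using cov unfolding covering_projection_def by blast
    have "openin ?X {x \<in> topspace ?X. f x \<in> V}"
      by (rule openin_continuous_map_preimage[OF fY V(2)])
    then have "open {x \<in> ball 0 1. f x \<in> V}" using openin_open_eq[of "ball (0::complex) 1"] by simp
    then obtain r where r: "r > 0" "ball t0 r \<subseteq> {x \<in> ball 0 1. f x \<in> V}"
      using t0 V(1) open_contains_ball by (metis (mono_tags, lifting) mem_Collect_eq)
    have fN: "continuous_map (top_of_set (ball t0 r)) (subtopology ?Y V) f"
    proof -
      have "continuous_map (subtopology ?X (ball t0 r)) ?Y f"
        by (rule continuous_map_from_subtopology[OF fY])
      then have "continuous_map (top_of_set (ball t0 r)) ?Y f"
        using r(2) by (simp add: subtopology_subtopology inf.absorb2 subset_iff)
      then show ?thesis using r(2) by (auto simp: continuous_map_in_subtopology)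
    qed
    have "\<exists>k. continuous_on (ball t0 r) k \<and> k ` ball t0 r \<subseteq> ball 0 1 \<and> (\<forall>x\<in>ball t0 r. \<alpha> (k x) = f x) \<and> k t = s"
      if t: "t \<in> ball t0 r" and s: "s \<in> ball 0 1" "\<alpha> s = f t" for t s
    proof -
      have "f t \<in> V" using r(2) t by blast
      then have "s \<in> \<Union>\<V>" using V(3) s by simp
      then obtain U where U: "U \<in> \<V>" "s \<in> U" by blast
      have UX: "U \<subseteq> ball 0 1" using V(4) U(1) openin_subset by fastforce
      have "homeomorphic_map (subtopology ?X U) (subtopology ?Y V) \<alpha>" using V(5) U(1) by blast
      then obtain q where "homeomorphic_maps (subtopology ?X U) (subtopology ?Y V) \<alpha> q"
        using homeomorphic_map_maps by blast
      then have q: "continuous_map (subtopology ?Y V) (subtopology ?X U) q"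
        "\<And>x. x \<in> topspace (subtopology ?X U) \<Longrightarrow> q (\<alpha> x) = x"
        "\<And>y. y \<in> topspace (subtopology ?Y V) \<Longrightarrow> \<alpha> (q y) = y"
        by (auto simp: homeomorphic_maps_def)
      have "continuous_map (top_of_set (ball t0 r)) (subtopology ?X U) (q \<circ> f)"
        by (rule continuous_map_compose[OF fN q(1)])
      then have "continuous_map (top_of_set (ball t0 r)) (top_of_set U) (q \<circ> f)"
        using UX by (simp add: subtopology_subtopology inf.absorb2)
      then have c: "continuous_on (ball t0 r) (q \<circ> f)" "(q \<circ> f) ` ball t0 r \<subseteq> U"
        by (auto simp: continuous_map_in_subtopology)
      have "f x \<in> topspace (subtopology ?Y V)" if "x \<in> ball t0 r" for x
        using fN that by (auto simp: continuous_map_def Pi_iff)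
      then have e: "\<forall>x\<in>ball t0 r. \<alpha> ((q \<circ> f) x) = f x" using q(3) by simp
      have "(q \<circ> f) t = s" using q(2)[of s] s U(2) UX by simp
      with c e UX show ?thesis by (intro exI[of _ "q \<circ> f"]) blast
    qed
    then show ?thesis using r by (intro exI[of _ "ball t0 r"]) auto
  qed
  show thesis
  proof (rule lift_through_local_sections[where f=f and \<alpha>=\<alpha> and S="ball 0 1" and D="ball (0::complex) 1" and a=a and b=b])
    show "simply_connected (ball (0::complex) 1)" by (simp add: convex_imp_simply_connected)
  qed (use uniformization_locally_injective[OF \<alpha>] loc ab that in auto)
qed

text \<open>Near \<open>s\<close> the map stays in one plaque, where the leaf coordinate alone
  determines the point. Thus local injectivity of \<alpha> becomes local injectivity of a scalar
  holomorphic function.\<close>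

lemma leaf_coord_locally_injective:
  assumes \<alpha>: "leafwise F \<alpha>" and c: "c \<in> F" and s: "s \<in> ball 0 1" "\<alpha> s \<in> dom_of c"
    and W: "open W" "s \<in> W" "inj_on \<alpha> (W \<inter> ball 0 1)"
  shows "\<exists>W. open W \<and> s \<in> W \<and> inj_on (\<lambda>t. coord_of c (\<alpha> t) $ leaf_coord c) (W \<inter> S)"
proof -
  obtain r where r: "r > 0" "ball s r \<subseteq> ball 0 1" "\<And>x. x \<in> ball s r \<Longrightarrow> \<alpha> x \<in> plaque c (\<alpha> s)"
    using leafwiseD[OF \<alpha> c s] by blast
  have "inj_on (\<lambda>t. coord_of c (\<alpha> t) $ leaf_coord c) (W \<inter> ball s r \<inter> S)"
  proof (rule inj_onI)
    fix x y assume xy: "x \<in> W \<inter> ball s r \<inter> S" "y \<in> W \<inter> ball s r \<inter> S"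
      "coord_of c (\<alpha> x) $ leaf_coord c = coord_of c (\<alpha> y) $ leaf_coord c"
    then have "\<alpha> x = \<alpha> y"
      using plaque_coord_inj[OF c r(3)[of x] r(3)[of y]] by blast
    moreover have "x \<in> W \<inter> ball 0 1" "y \<in> W \<inter> ball 0 1" using xy(1,2) r(2) by blast+
    ultimately show "x = y" using W(3) by (simp add: inj_on_def)
  qed
  then show ?thesis using W r(1) by (intro exI[of _ "W \<inter> ball s r"]) auto
qed

lemma holomorphic_disc_leaf_coord:
  assumes "holomorphic_disc A f" "c \<in> F"
  shows "(\<lambda>t. coord_of c (f t) $ i) holomorphic_on {t \<in> ball 0 1. f t \<in> dom_of c}"
proof -
  have "\<forall>c\<in>A. \<forall>i. (\<lambda>t. snd c (f t) $ i) holomorphic_on {t \<in> ball 0 1. f t \<in> fst c}"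
    using assms(1) by (simp add: holomorphic_disc_def)
  from bspec[OF this chart_of_in[OF assms(2)]] show ?thesis by simp
qed

text \<open>Topological lifting only yields continuous lifts; the leaf coordinate turns the
  regularity question into the one-variable situation of \<open>holomorphic_lift\<close>.\<close>

lemma leafwise_lift_holomorphic:
  assumes \<alpha>: "holomorphic_disc A \<alpha>" "leafwise F \<alpha>"
    and inj: "\<And>s. s \<in> ball 0 1 \<Longrightarrow> \<exists>W. open W \<and> s \<in> W \<and> inj_on \<alpha> (W \<inter> ball 0 1)"
    and c: "c \<in> F" and T: "open T" and h: "continuous_on T h" "h ` T \<subseteq> ball 0 1"
    and hT: "\<And>t. t \<in> T \<Longrightarrow> \<alpha> (h t) \<in> dom_of c"
    and hol: "(\<lambda>t. coord_of c (\<alpha> (h t)) $ leaf_coord c) holomorphic_on T"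
  shows "h holomorphic_on T"
proof (rule holomorphic_lift[where S="{t \<in> ball 0 1. \<alpha> t \<in> dom_of c}"
        and \<phi>="\<lambda>t. coord_of c (\<alpha> t) $ leaf_coord c"])
  show "open {t \<in> ball 0 1. \<alpha> t \<in> dom_of c}"
    by (rule disc_preimage_open[OF \<alpha>(1) dom_open[OF c]])
  show "\<exists>W. open W \<and> s \<in> W \<and> inj_on (\<lambda>t. coord_of c (\<alpha> t) $ leaf_coord c) (W \<inter> {t \<in> ball 0 1. \<alpha> t \<in> dom_of c})"
    if "s \<in> {t \<in> ball 0 1. \<alpha> t \<in> dom_of c}" for s
    using inj[of s] leaf_coord_locally_injective[OF \<alpha>(2) c, of s] that by blast
qed (use assms holomorphic_disc_leaf_coord[OF \<alpha>(1) c] in auto)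

text \<open>The parametrized plaque is itself a leafwise disc, so the covering property lifts all of
  it at once, with the parameter of \<alpha> s sent to \<open>s\<close>. The lift is holomorphic
  because the leaf coordinate of \<alpha> along it is the identity.\<close>

lemma uniformization_has_plaque_sections:
  assumes \<alpha>: "uniformization A F \<alpha> (leaf F p)" and p: "p \<in> - E"
  shows "has_plaque_sections F \<alpha>"
  unfolding has_plaque_sections_def
proof (intro ballI impI)
  fix s c assume s: "s \<in> ball (0::complex) 1" and c: "c \<in> F" "\<alpha> s \<in> dom_of c"
  let ?P = "plaque_point c (\<alpha> s)" and ?a = "coord_of c (\<alpha> s) $ leaf_coord c"
  have \<alpha>s: "\<alpha> s \<in> leaf F p" using uniformization_image[OF assms] s by blast
  have a: "?a \<in> ball 0 1" by (rule coord_ball[OF c])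
  have "?P ` ball 0 1 \<subseteq> leaf F p"
    using leaf_step[OF c(1) \<alpha>s c(2)] plaque_point(1)[OF c] by blast
  moreover have "\<alpha> s = ?P ?a"
    by (rule plaque_point_leaf_coord[OF c(1) plaque_self[OF c(2)], symmetric])
  ultimately obtain \<psi> where \<psi>: "continuous_on (ball 0 1) \<psi>" "\<psi> ` ball 0 1 \<subseteq> ball 0 1"
    "\<And>t. t \<in> ball 0 1 \<Longrightarrow> \<alpha> (\<psi> t) = ?P t" "\<psi> ?a = s"
    using uniformization_lift[OF assms leafwise_plaque_point[OF c] plaque_point_continuous[OF c] _ a s] by blast
  have "\<psi> holomorphic_on ball 0 1"
  proof (rule leafwise_lift_holomorphic[OF _ uniformization_leafwise[OF assms] uniformization_locally_injective[OF \<alpha>] c(1) open_ball \<psi>(1,2)])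
    show "holomorphic_disc A \<alpha>" using \<alpha> by (simp add: uniformization_def)
    show "\<alpha> (\<psi> t) \<in> dom_of c" if "t \<in> ball 0 1" for t
      using \<psi>(3)[OF that] plaque_point(3)[OF c that] by simp
    show "(\<lambda>t. coord_of c (\<alpha> (\<psi> t)) $ leaf_coord c) holomorphic_on ball 0 1"
      by (rule holomorphic_transform[OF holomorphic_on_ident]) (use \<psi>(3) plaque_point(2)[OF c] in simp)
  qed
  then show "\<exists>\<psi>. \<psi> holomorphic_on ball 0 1 \<and> \<psi> ` ball 0 1 \<subseteq> ball 0 1 \<and> \<psi> ?a = s \<and>
      (\<forall>u\<in>ball 0 1. \<alpha> (\<psi> u) = ?P u)"
    using \<psi>(2-4) by (intro exI[of _ \<psi>]) simp
qed

text \<open>A section is a right inverse of the leaf coordinate of \<alpha>, and it passes through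
  \<open>s\<close>. By the chain rule the derivative of that coordinate at \<open>s\<close> is a
  factor of 1, hence nonzero.\<close>

lemma plaque_sections_locally_injective:
  assumes \<alpha>: "holomorphic_disc A \<alpha>" "leafwise F \<alpha>" "has_plaque_sections F \<alpha>" and s: "s \<in> ball 0 1"
  shows "\<exists>W. open W \<and> s \<in> W \<and> inj_on \<alpha> (W \<inter> ball 0 1)"
proof -
  obtain c where c: "c \<in> F" "\<alpha> s \<in> dom_of c"
    using leafwise_dom[OF \<alpha>(2) s] foliated_chart_at by blast
  let ?a = "coord_of c (\<alpha> s) $ leaf_coord c"
  let ?\<phi> = "\<lambda>t. coord_of c (\<alpha> t) $ leaf_coord c"
  let ?S = "{t \<in> ball 0 1. \<alpha> t \<in> dom_of c}"
  have a: "?a \<in> ball 0 1" by (rule coord_ball[OF c])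
  obtain \<psi> where \<psi>: "\<psi> holomorphic_on ball 0 1" "\<psi> ` ball 0 1 \<subseteq> ball 0 1" "\<psi> ?a = s"
      "\<forall>u\<in>ball 0 1. \<alpha> (\<psi> u) = plaque_point c (\<alpha> s) u"
    using \<alpha>(3)[unfolded has_plaque_sections_def, rule_format, OF s c] by (elim exE conjE)
  have S: "open ?S" "s \<in> ?S" using disc_preimage_open[OF \<alpha>(1) dom_open[OF c(1)]] s c by auto
  have hol: "?\<phi> holomorphic_on ?S" by (rule holomorphic_disc_leaf_coord[OF \<alpha>(1) c(1)])
  have d1: "(\<psi> has_field_derivative deriv \<psi> ?a) (at ?a)"
    by (rule holomorphic_derivI[OF \<psi>(1) open_ball a])
  have d2: "(?\<phi> has_field_derivative deriv ?\<phi> s) (at (\<psi> ?a))"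
    using holomorphic_derivI[OF hol S] \<psi>(3) by simp
  have "((\<lambda>u. ?\<phi> (\<psi> u)) has_field_derivative deriv ?\<phi> s * deriv \<psi> ?a) (at ?a)"
    by (rule DERIV_chain2[OF d2 d1])
  moreover have "((\<lambda>u. ?\<phi> (\<psi> u)) has_field_derivative 1) (at ?a)"
  proof (rule has_field_derivative_transform_within_open[OF DERIV_ident open_ball a])
    show "u = ?\<phi> (\<psi> u)" if "u \<in> ball 0 1" for u
      using \<psi>(4) that plaque_point(2)[OF c that] by simp
  qed
  ultimately have "deriv ?\<phi> s * deriv \<psi> ?a = 1" by (rule DERIV_unique)
  then have "deriv ?\<phi> s \<noteq> 0" by auto
  then obtain r where r: "r > 0" "ball s r \<subseteq> ?S" "inj_on ?\<phi> (ball s r)"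
    using has_complex_derivative_locally_injective[OF hol S(2,1)] by blast
  have "inj_on \<alpha> (ball s r \<inter> ball 0 1)"
    using r(3) by (auto simp: inj_on_def)
  then show ?thesis using r(1) by (intro exI[of _ "ball s r"]) auto
qed

text \<open>Sections over plaques do the work of even covering: the local lift of \<open>f\<close>
  through \<open>s\<close> is the section at \<open>s\<close> evaluated at the leaf coordinate of
  \<open>f\<close>.\<close>

lemma plaque_sections_lift:
  assumes \<alpha>: "holomorphic_disc A \<alpha>" "leafwise F \<alpha>" "has_plaque_sections F \<alpha>"
    and f: "holomorphic_disc A f" "leafwise F f"
    and ab: "a \<in> ball 0 1" "b \<in> ball 0 1" "\<alpha> b = f a"
  obtains h where "h holomorphic_on ball 0 1" "h ` ball 0 1 \<subseteq> ball 0 1"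
    "\<And>t. t \<in> ball 0 1 \<Longrightarrow> \<alpha> (h t) = f t" "h a = b"
proof -
  have fc: "continuous_on (ball 0 1) f" using f(1) by (simp add: holomorphic_disc_def)
  note inj = plaque_sections_locally_injective[OF \<alpha>]
  have loc: "\<exists>N. open N \<and> connected N \<and> t0 \<in> N \<and> N \<subseteq> ball 0 1 \<and>
        (\<forall>t\<in>N. \<forall>s\<in>ball 0 1. \<alpha> s = f t \<longrightarrow>
          (\<exists>k. continuous_on N k \<and> k ` N \<subseteq> ball 0 1 \<and> (\<forall>x\<in>N. \<alpha> (k x) = f x) \<and> k t = s))"
    if t0: "t0 \<in> ball 0 1" for t0
  proof -
    obtain c where c: "c \<in> F" "f t0 \<in> dom_of c"
      using leafwise_dom[OF f(2) t0] foliated_chart_at by blast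
    \<comment> \<open>The radius depends on \<open>f\<close> and \<open>t0\<close> only and is fixed
      before the preimage \<open>s\<close>. One ball can serve all preimages because each section is
      defined over its whole plaque.\<close>
    obtain r where r: "r > 0" "ball t0 r \<subseteq> ball 0 1" "\<And>x. x \<in> ball t0 r \<Longrightarrow> f x \<in> plaque c (f t0)"
      using leafwiseD[OF f(2) c(1) t0 c(2)] by blast
    have "\<exists>k. continuous_on (ball t0 r) k \<and> k ` ball t0 r \<subseteq> ball 0 1 \<and> (\<forall>x\<in>ball t0 r. \<alpha> (k x) = f x) \<and> k t = s"
      if t: "t \<in> ball t0 r" and s: "s \<in> ball 0 1" "\<alpha> s = f t" for t s
    proof -
      let ?u = "\<lambda>x. coord_of c (f x) $ leaf_coord c"
      have fd: "f x \<in> dom_of c" if "x \<in> ball t0 r" for x using plaque_dom[OF r(3)[OF that]] .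
      have \<alpha>s: "\<alpha> s \<in> dom_of c" using fd[OF t] s by simp
      obtain \<psi> where \<psi>: "\<psi> holomorphic_on ball 0 1" "\<psi> ` ball 0 1 \<subseteq> ball 0 1"
          "\<psi> (coord_of c (\<alpha> s) $ leaf_coord c) = s"
          "\<forall>u\<in>ball 0 1. \<alpha> (\<psi> u) = plaque_point c (\<alpha> s) u"
        using \<alpha>(3)[unfolded has_plaque_sections_def, rule_format, OF s(1) c(1) \<alpha>s] by (elim exE conjE)
      have u: "?u x \<in> ball 0 1" if "x \<in> ball t0 r" for x by (rule coord_ball[OF c(1) fd[OF that]])
      have "continuous_on (ball t0 r) (\<lambda>x. coord_of c (f x))"
        by (rule continuous_on_compose2[OF coord_continuous[OF c(1)] continuous_on_subset[OF fc r(2)]])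
           (use fd in auto)
      then have "continuous_on (ball t0 r) ?u" by (intro continuous_intros)
      then have 1: "continuous_on (ball t0 r) (\<lambda>x. \<psi> (?u x))"
        by (rule continuous_on_compose2[OF holomorphic_on_imp_continuous_on[OF \<psi>(1)]]) (use u in auto)
      have 2: "\<alpha> (\<psi> (?u x)) = f x" if x: "x \<in> ball t0 r" for x
      proof -
        have "f x \<in> plaque c (\<alpha> s)" using r(3)[OF x] plaque_eq[OF r(3)[OF t]] s(2) by simp
        then show ?thesis using \<psi>(4) u[OF x] plaque_point_leaf_coord[OF c(1)] by simp
      qed
      show ?thesis
        using 1 2 u \<psi>(2,3) s(2) by (intro exI[of _ "\<lambda>x. \<psi> (?u x)"]) auto
    qed
    then show ?thesis using r by (intro exI[of _ "ball t0 r"]) auto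
  qed
  obtain h where h: "continuous_on (ball 0 1) h" "h ` ball 0 1 \<subseteq> ball 0 1"
    "\<And>t. t \<in> ball 0 1 \<Longrightarrow> \<alpha> (h t) = f t" "h a = b"
  proof (rule lift_through_local_sections[where f=f and \<alpha>=\<alpha> and S="ball 0 1" and D="ball (0::complex) 1" and a=a and b=b])
    show "simply_connected (ball (0::complex) 1)" by (simp add: convex_imp_simply_connected)
  qed (use inj loc ab in auto)
  have "\<exists>h'. (h has_field_derivative h') (at t)" if t: "t \<in> ball 0 1" for t
  proof -
    obtain c where c: "c \<in> F" "f t \<in> dom_of c"
      using leafwise_dom[OF f(2) t] foliated_chart_at by blast
    let ?T = "{x \<in> ball 0 1. f x \<in> dom_of c}"
    have T: "open ?T" by (rule disc_preimage_open[OF f(1) dom_open[OF c(1)]])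
    have "h holomorphic_on ?T"
    proof (rule leafwise_lift_holomorphic[OF \<alpha>(1,2) inj c(1) T])
      show "continuous_on ?T h" using h(1) by (rule continuous_on_subset) auto
      show "h ` ?T \<subseteq> ball 0 1" using h(2) by blast
      show "\<alpha> (h x) \<in> dom_of c" if "x \<in> ?T" for x using h(3) that by simp
      show "(\<lambda>t. coord_of c (\<alpha> (h t)) $ leaf_coord c) holomorphic_on ?T"
        by (rule holomorphic_transform[OF holomorphic_disc_leaf_coord[OF f(1) c(1)]]) (use h(3) in simp)
    qed
    then show ?thesis
      unfolding holomorphic_on_open[OF T] by (rule bspec) (use t c in blast)
  qed
  then have "h holomorphic_on ball 0 1" by (simp add: holomorphic_on_open)
  then show thesis using h(2-4) that by blast
qed

section \<open>The modulus of uniformization\<close>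

text \<open>A leaf that is the image of a disc meets every foliated chart in countably many plaques,
  so the transverse coordinates of a map into the leaf are locally constant.\<close>

lemma uniformized_leaf_transversal_countable:
  assumes \<alpha>: "uniformization A F \<alpha> (leaf F p)" and p: "p \<in> - E" and c: "c \<in> F" and i: "i \<noteq> leaf_coord c"
  shows "countable ((\<lambda>x. coord_of c x $ i) ` (leaf F p \<inter> dom_of c))"
proof -
  \<comment> \<open>\<open>O' q\<close> is the set of parameters sent into the plaque of
    \<open>q\<close>. It is nonempty for \<open>q\<close> in the leaf, because the uniformization is
    onto, so counting these open subsets of the disc counts plaques.\<close>
  define O' where "O' q = {t \<in> ball 0 1. \<alpha> t \<in> plaque c q}" for q
  have "open U" if U: "U \<in> O' ` (leaf F p \<inter> dom_of c)" for U
  proof -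
    obtain q where q: "U = O' q" using U by (rule imageE)
    have "\<exists>e>0. ball t e \<subseteq> O' q" if t: "t \<in> O' q" for t
    proof -
      have t': "t \<in> ball 0 1" "\<alpha> t \<in> plaque c q" using t by (auto simp: O'_def)
      obtain r where "r > 0" "ball t r \<subseteq> ball 0 1" "\<And>x. x \<in> ball t r \<Longrightarrow> \<alpha> x \<in> plaque c (\<alpha> t)"
        using leafwiseD[OF uniformization_leafwise[OF \<alpha> p] c t'(1) plaque_dom[OF t'(2)]] by blast
      then show ?thesis using plaque_eq[OF t'(2)] by (intro exI[of _ r]) (auto simp: O'_def)
    qed
    then show ?thesis by (simp add: open_contains_ball q)
  qed
  \<comment> \<open>Lindelof leaves countably many plaques that already contain the image of every
    parameter under consideration; choosing one point \<open>q\<close> on each gives the countable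
    set \<open>Q\<close>.\<close>
  then obtain \<F>' where F': "\<F>' \<subseteq> O' ` (leaf F p \<inter> dom_of c)" "countable \<F>'" "\<Union>\<F>' = \<Union>(O' ` (leaf F p \<inter> dom_of c))"
    by (rule Lindelof) blast
  obtain Q where Q: "Q \<subseteq> leaf F p \<inter> dom_of c" "countable Q" "\<F>' = O' ` Q"
    using countable_subset_image[of \<F>' O'] F'(1,2) by auto
  have "(\<lambda>x. coord_of c x $ i) ` (leaf F p \<inter> dom_of c) \<subseteq> (\<lambda>x. coord_of c x $ i) ` Q"
  proof
    fix z assume "z \<in> (\<lambda>x. coord_of c x $ i) ` (leaf F p \<inter> dom_of c)"
    then obtain x where x: "x \<in> leaf F p" "x \<in> dom_of c" "z = coord_of c x $ i" by blast
    have "x \<in> \<alpha> ` ball 0 1" using uniformization_image[OF \<alpha> p] x(1) by simp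
    then obtain t where t: "t \<in> ball 0 1" "\<alpha> t = x" by (metis imageE)
    have "t \<in> O' x" using t plaque_self[OF x(2)] by (simp add: O'_def)
    then have "t \<in> \<Union>(O' ` (leaf F p \<inter> dom_of c))" using x(1,2) by blast
    then have "t \<in> \<Union>(O' ` Q)" using F'(3) Q(3) by simp
    then obtain q where "q \<in> Q" "t \<in> O' q" by blast
    then have "z = coord_of c q $ i" using x t i by (auto simp: O'_def plaque_def)
    then show "z \<in> (\<lambda>x. coord_of c x $ i) ` Q" using \<open>q \<in> Q\<close> by blast
  qed
  then show ?thesis using Q(2) by (meson countable_image countable_subset)
qed

text \<open>Membership in \<open>leaf_discs\<close> restricts the image only as a set, and a leaf
  can return to a chart infinitely often. A jump between plaques is excluded because a connected set
  of transverse coordinates with two points is uncountable; hyperbolicity supplies the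
  uniformization behind the count.\<close>

lemma leaf_discs_leafwise:
  assumes hyp: "hyperbolic_foliation A F E" and f: "f \<in> leaf_discs A F E"
  shows "leafwise F f"
  unfolding leafwise_def dom_union
proof (intro conjI ballI impI)
  obtain p where p: "p \<in> - E" "f ` ball 0 1 \<subseteq> leaf F p" and hol: "holomorphic_disc A f"
    using f by (auto simp: leaf_discs_def)
  then show "f ` ball 0 1 \<subseteq> - E" using leaf_regular by blast
  obtain \<alpha> where \<alpha>: "uniformization A F \<alpha> (leaf F p)"
    using hyp[unfolded hyperbolic_foliation_def, rule_format, OF p(1)] by (elim exE)
  fix c t assume c: "c \<in> F" and t: "t \<in> ball (0::complex) 1" "f t \<in> dom_of c"
  have "open {x \<in> ball 0 1. f x \<in> dom_of c}" by (rule disc_preimage_open[OF hol dom_open[OF c]])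
  then obtain r where r: "r > 0" "ball t r \<subseteq> {x \<in> ball 0 1. f x \<in> dom_of c}"
    using t open_contains_ball by (metis (mono_tags, lifting) mem_Collect_eq)
  have cont: "continuous_on (ball t r) (\<lambda>x. coord_of c (f x) $ i)" for i
    using holomorphic_on_subset[OF holomorphic_disc_leaf_coord[OF hol c] r(2)]
    by (rule holomorphic_on_imp_continuous_on)
  have "f x \<in> plaque c (f t)" if x: "x \<in> ball t r" for x
  proof -
    have "coord_of c (f x) $ i = coord_of c (f t) $ i" if i: "i \<noteq> leaf_coord c" for i
    proof (rule ccontr)
      assume ne: "coord_of c (f x) $ i \<noteq> coord_of c (f t) $ i"
      let ?S = "(\<lambda>x. coord_of c (f x) $ i) ` ball t r"
      have "connected ?S" by (rule connected_continuous_image[OF cont connected_ball])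
      then have "uncountable ?S"
        by (rule connected_uncountable) (use x r(1) ne in auto)
      moreover have "?S \<subseteq> (\<lambda>x. coord_of c x $ i) ` (leaf F p \<inter> dom_of c)"
        using r(2) p(2) by blast
      ultimately show False
        using uniformized_leaf_transversal_countable[OF \<alpha> p(1) c i] countable_subset by blast
    qed
    then show ?thesis using x r(2) by (auto simp: plaque_def)
  qed
  then show "\<forall>\<^sub>F x in nhds t. f x \<in> plaque c (f t)"
    using r(1) eventually_nhds_in_open[OF open_ball, of t t r] by (auto elim: eventually_mono)
qed

text \<open>The supremum is attained at \<alpha>. Formulated through plaque sections, it applies to
  the uniformizations of nearby leaves and to their limit without deciding whether the limit is a
  covering.\<close>

lemma modulus_of_uniformization_eq:
  assumes hyp: "hyperbolic_foliation A F E" and g: "hermitian_metric A g"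
    and \<alpha>: "holomorphic_disc A \<alpha>" "leafwise F \<alpha>" "has_plaque_sections F \<alpha>"
  shows "modulus_of_uniformization A F E g (\<alpha> 0) = ereal (initial_speed A g \<alpha>)"
  unfolding modulus_of_uniformization_def
proof (rule SUP_eqI)
  have 0: "\<alpha> 0 \<in> - E" using leafwise_dom[OF \<alpha>(2)] by simp
  have "\<alpha> ` ball 0 1 \<subseteq> leaf F (\<alpha> 0)"
    using leafwise_in_leaf[OF \<alpha>(2) _ leaf_self] by (meson centre_in_ball image_subsetI zero_less_one)
  then have "\<alpha> \<in> leaf_discs A F E" using \<alpha>(1) 0 by (auto simp: leaf_discs_def)
  then show "ereal (initial_speed A g \<alpha>) \<le> y"
    if "\<And>f. f \<in> {f \<in> leaf_discs A F E. f 0 = \<alpha> 0} \<Longrightarrow> ereal (initial_speed A g f) \<le> y" for y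
    using that by blast
  fix f assume "f \<in> {f \<in> leaf_discs A F E. f 0 = \<alpha> 0}"
  then have f: "f \<in> leaf_discs A F E" "f 0 = \<alpha> 0" by auto
  then have hol: "holomorphic_disc A f" by (simp add: leaf_discs_def)
  obtain h where h: "h holomorphic_on ball 0 1" "h ` ball 0 1 \<subseteq> ball 0 1"
      "\<And>t. t \<in> ball 0 1 \<Longrightarrow> \<alpha> (h t) = f t" "h 0 = 0"
    using plaque_sections_lift[OF \<alpha> hol leaf_discs_leafwise[OF hyp f(1)], of 0 0] f(2) by auto
  show "ereal (initial_speed A g f) \<le> ereal (initial_speed A g \<alpha>)"
    using initial_speed_le_of_factor[OF hol \<alpha>(1) g h(1,2,4)] h(3) by simp
qed

end

section \<open>Change of base point of a uniformization\<close>

lemma covering_projection_precompose: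
  assumes p: "covering_projection X p Y" and \<phi>: "homeomorphic_map Z X \<phi>"
  shows "covering_projection Z (p \<circ> \<phi>) Y"
  unfolding covering_projection_def
proof (intro conjI ballI)
  have pc: "continuous_map X Y p" "p ` topspace X = topspace Y"
    using p by (auto simp: covering_projection_def)
  have \<phi>c: "continuous_map Z X \<phi>" "\<phi> ` topspace Z = topspace X"
    using \<phi> by (simp_all add: homeomorphic_imp_continuous_map homeomorphic_imp_surjective_map)
  show "continuous_map Z Y (p \<circ> \<phi>)" by (rule continuous_map_compose[OF \<phi>c(1) pc(1)])
  show "(p \<circ> \<phi>) ` topspace Z = topspace Y" using pc \<phi>c by (metis image_comp)
  fix y assume "y \<in> topspace Y"
  then obtain V \<V> where V: "y \<in> V" "openin Y V" "\<Union>\<V> = {x \<in> topspace X. p x \<in> V}"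
      "\<forall>U\<in>\<V>. openin X U" "pairwise disjnt \<V>" 
      "\<forall>U\<in>\<V>. homeomorphic_map (subtopology X U) (subtopology Y V) p"
    using p unfolding covering_projection_def by blast
  define G where "G U = {z \<in> topspace Z. \<phi> z \<in> U}" for U
  have 1: "\<Union>(G ` \<V>) = {x \<in> topspace Z. (p \<circ> \<phi>) x \<in> V}"
  proof (intro equalityI subsetI)
    fix z assume "z \<in> \<Union>(G ` \<V>)"
    then obtain U where "U \<in> \<V>" "z \<in> topspace Z" "\<phi> z \<in> U" by (auto simp: G_def)
    moreover then have "\<phi> z \<in> \<Union>\<V>" by blast
    ultimately show "z \<in> {x \<in> topspace Z. (p \<circ> \<phi>) x \<in> V}" using V(3) by simp
  next
    fix z assume z: "z \<in> {x \<in> topspace Z. (p \<circ> \<phi>) x \<in> V}"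
    then have "\<phi> z \<in> \<Union>\<V>" using V(3) \<phi>c(2) by auto
    then show "z \<in> \<Union>(G ` \<V>)" using z by (auto simp: G_def)
  qed
  have 2: "\<forall>U\<in>G ` \<V>. openin Z U"
    using V(4) openin_continuous_map_preimage[OF \<phi>c(1)] by (auto simp: G_def)
  have 3: "pairwise disjnt (G ` \<V>)"
  proof (rule pairwiseI)
    fix A B assume "A \<in> G ` \<V>" "B \<in> G ` \<V>" "A \<noteq> B"
    then obtain U U' where U: "U \<in> \<V>" "U' \<in> \<V>" "A = G U" "B = G U'" "U \<noteq> U'" by blast
    then have "disjnt U U'" using V(5) by (simp add: pairwise_def)
    then show "disjnt A B" using U(3,4) by (auto simp: disjnt_def G_def)
  qed
  have 4: "\<forall>U\<in>G ` \<V>. homeomorphic_map (subtopology Z U) (subtopology Y V) (p \<circ> \<phi>)"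
  proof
    fix W assume "W \<in> G ` \<V>"
    then obtain U where U: "U \<in> \<V>" "W = G U" by blast
    have UX: "U \<subseteq> topspace X" using V(4) U(1) openin_subset by blast
    have "\<phi> ` (topspace Z \<inter> W) = topspace X \<inter> U"
    proof (intro equalityI subsetI)
      fix x assume "x \<in> topspace X \<inter> U"
      then have x: "x \<in> U" "x \<in> \<phi> ` topspace Z" using \<phi>c(2) by auto
      then obtain z where "z \<in> topspace Z" "x = \<phi> z" by blast
      then show "x \<in> \<phi> ` (topspace Z \<inter> W)" using x by (simp add: U(2) G_def)
    qed (use UX in \<open>auto simp: U(2) G_def\<close>)
    then have "homeomorphic_map (subtopology Z W) (subtopology X U) \<phi>"
      by (rule homeomorphic_map_subtopologies[OF \<phi>])
    then show "homeomorphic_map (subtopology Z W) (subtopology Y V) (p \<circ> \<phi>)"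
      by (rule homeomorphic_map_compose) (use V(6) U(1) in blast)
  qed
  show "\<exists>V. y \<in> V \<and> openin Y V \<and> (\<exists>\<V>. \<Union>\<V> = {x \<in> topspace Z. (p \<circ> \<phi>) x \<in> V} \<and>
      (\<forall>U\<in>\<V>. openin Z U) \<and> pairwise disjnt \<V> \<and>
      (\<forall>U\<in>\<V>. homeomorphic_map (subtopology Z U) (subtopology Y V) (p \<circ> \<phi>)))"
    by (intro exI[of _ V] conjI exI[of _ "G ` \<V>"]) (fact V(1) V(2) 1 2 3 4)+
qed

lemma (in complex_manifold) holomorphic_disc_compose:
  assumes f: "holomorphic_disc A f" and h: "h holomorphic_on ball 0 1" "h ` ball 0 1 \<subseteq> ball 0 1"
  shows "holomorphic_disc A (f \<circ> h)"
  unfolding holomorphic_disc_def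
proof (intro conjI ballI allI)
  have hc: "continuous_on (ball 0 1) h" using h(1) by (rule holomorphic_on_imp_continuous_on)
  show "continuous_on (ball 0 1) (f \<circ> h)"
  proof (rule continuous_on_compose[OF hc])
    show "continuous_on (h ` ball 0 1) f"
      using f by (intro continuous_on_subset[OF _ h(2)]) (simp add: holomorphic_disc_def)
  qed
  fix c i assume c: "c \<in> A"
  have "(\<lambda>t. snd c (f t) $ i) holomorphic_on {t \<in> ball 0 1. f t \<in> fst c}"
    using f c by (simp add: holomorphic_disc_def)
  then have "((\<lambda>t. snd c (f t) $ i) \<circ> h) holomorphic_on {t \<in> ball 0 1. (f \<circ> h) t \<in> fst c}"
  proof (rule holomorphic_on_compose_gen[rotated])
    show "h holomorphic_on {t \<in> ball 0 1. (f \<circ> h) t \<in> fst c}"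
      using h(1) by (rule holomorphic_on_subset) auto
    show "h ` {t \<in> ball 0 1. (f \<circ> h) t \<in> fst c} \<subseteq> {t \<in> ball 0 1. f t \<in> fst c}"
    proof (rule image_subsetI)
      fix t assume "t \<in> {t \<in> ball 0 1. (f \<circ> h) t \<in> fst c}"
      then show "h t \<in> {t \<in> ball 0 1. f t \<in> fst c}" using subsetD[OF h(2), of "h t"] by simp
    qed
  qed
  then show "(\<lambda>t. snd c ((f \<circ> h) t) $ i) holomorphic_on {t \<in> ball 0 1. (f \<circ> h) t \<in> fst c}"
    by (simp add: o_def)
qed

context foliated_manifold
begin

text \<open>Hyperbolicity gives a uniformization with uncontrolled value at 0; a disc automorphism
  moves a preimage of \<open>z\<close> to the origin.\<close>

lemma uniformization_at:
  assumes hyp: "hyperbolic_foliation A F E" and z: "z \<in> - E"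
  obtains \<alpha> where "uniformization A F \<alpha> (leaf F z)" "\<alpha> 0 = z"
proof -
  obtain \<beta> where \<beta>: "uniformization A F \<beta> (leaf F z)"
    using hyp[unfolded hyperbolic_foliation_def, rule_format, OF z] by (elim exE)
  have "z \<in> \<beta> ` ball 0 1" using uniformization_image[OF \<beta> z] leaf_self by simp
  then obtain a where a: "a \<in> ball 0 1" "\<beta> a = z" by (metis imageE)
  \<comment> \<open>\<open>f\<close> is the automorphism with \<open>f a = 0\<close> and
    \<open>h\<close> its inverse, so \<open>h 0 = a\<close> and precomposition with \<open>h\<close>
    recentres \<beta>.\<close>
  obtain f h where fh: "f a = 0" "f holomorphic_on ball 0 1" "f ` ball 0 1 \<subseteq> ball 0 1"
      "h holomorphic_on ball 0 1" "h ` ball 0 1 \<subseteq> ball 0 1"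
      "\<And>z. z \<in> ball 0 1 \<Longrightarrow> f (h z) = z" "\<And>z. z \<in> ball 0 1 \<Longrightarrow> h (f z) = z"
    using ball_biholomorphism_exists[OF a(1)] by metis
  have "homeomorphic_maps (top_of_set (ball 0 1)) (top_of_set (ball 0 1)) h f"
    using fh holomorphic_on_imp_continuous_on
    by (auto simp: homeomorphic_maps_def continuous_map_in_subtopology)
  then have "homeomorphic_map (top_of_set (ball 0 1)) (top_of_set (ball 0 1)) h"
    using homeomorphic_map_maps by blast
  then have "uniformization A F (\<beta> \<circ> h) (leaf F z)"
    using \<beta> covering_projection_precompose holomorphic_disc_compose[OF _ fh(4,5)]
    by (auto simp: uniformization_def)
  moreover have "(\<beta> \<circ> h) 0 = z" using fh(7)[OF a(1)] fh(1) a(2) by simp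
  ultimately show thesis by (rule that)
qed

section \<open>Limits of leafwise maps\<close>

text \<open>The locally constant quantity is the plaque itself, viewed as a function of the
  parameter with sets as values.\<close>

lemma leafwise_in_plaque:
  assumes f: "leafwise F f" and c: "c \<in> F"
    and N: "connected N" "N \<subseteq> ball 0 1" "f ` N \<subseteq> dom_of c" and xy: "x \<in> N" "y \<in> N"
  shows "f y \<in> plaque c (f x)"
proof -
  have "plaque c (f x) = plaque c (f y)"
  proof (rule connected_local_const[OF N(1) xy], intro ballI)
    fix t assume t: "t \<in> N"
    then have "t \<in> ball 0 1" "f t \<in> dom_of c" using N(2,3) by blast+
    then have "\<forall>\<^sub>F x in nhds t. f x \<in> plaque c (f t)"
      using f c by (simp add: leafwise_def)
    then have "\<forall>\<^sub>F x in nhds t. plaque c (f t) = plaque c (f x)"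
      by (rule eventually_mono) (rule plaque_eq[symmetric])
    then show "\<forall>\<^sub>F x in at t within N. plaque c (f t) = plaque c (f x)"
      unfolding eventually_at_filter by (rule eventually_mono) simp
  qed
  moreover have "f y \<in> plaque c (f y)" using N(3) xy by (intro plaque_self) blast
  ultimately show ?thesis by simp
qed

text \<open>On a disc \<open>B\<close> independent of \<open>n\<close> the transverse coordinates of
  \<open>s n\<close> are constant for all large \<open>n\<close>, and the equality of two
  coordinates survives pointwise limits. Avoiding the singular set guarantees a foliated chart at
  each limit point.\<close>

lemma leafwise_limit:
  assumes s: "\<And>n. leafwise F (s n)" and f: "holomorphic_disc A f" "f ` ball 0 1 \<subseteq> - E"
    and conv: "converges_continuously s f (ball 0 1)"
  shows "leafwise F f"
  unfolding leafwise_def dom_union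
proof (intro conjI ballI impI)
  show "f ` ball 0 1 \<subseteq> - E" by (fact f)
  fix c t assume c: "c \<in> F" and t: "t \<in> ball (0::complex) 1" "f t \<in> dom_of c"
  obtain r N where r: "r > 0" "\<And>k x. k \<ge> N \<Longrightarrow> dist x t < r \<Longrightarrow> s k x \<in> dom_of c"
    using converges_continuouslyD[OF conv t(1) dom_open[OF c] t(2)] by metis
  have "open {x \<in> ball 0 1. f x \<in> dom_of c}" by (rule disc_preimage_open[OF f(1) dom_open[OF c]])
  then obtain r' where r': "r' > 0" "ball t r' \<subseteq> {x \<in> ball 0 1. f x \<in> dom_of c}"
    using t open_contains_ball by (metis (mono_tags, lifting) mem_Collect_eq)
  define B where "B = ball t (min r r')"
  have tB: "t \<in> B" using r(1) r'(1) by (simp add: B_def)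
  have B1: "B \<subseteq> ball 0 1" using r'(2) by (auto simp: B_def subset_iff)
  have lim: "(\<lambda>n. coord_of c (s n x) $ i) \<longlonglongrightarrow> coord_of c (f x) $ i" if x: "x \<in> B" for x i
  proof -
    have "x \<in> ball t r'" using x by (simp add: B_def)
    then have "f x \<in> dom_of c" using r'(2) by blast
    moreover have "(\<lambda>n. s n x) \<longlonglongrightarrow> f x"
      by (rule converges_continuously_compose[OF conv]) (use x B1 in auto)
    moreover have "\<forall>\<^sub>F n in sequentially. s n x \<in> dom_of c"
      using eventually_ge_at_top[of N] by eventually_elim (use r(2) x in \<open>simp add: B_def dist_commute\<close>)
    ultimately have "(\<lambda>n. coord_of c (s n x)) \<longlonglongrightarrow> coord_of c (f x)"
      by (intro continuous_on_tendsto_compose[OF coord_continuous[OF c]])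
    then show ?thesis by (rule tendsto_vec_nth)
  qed
  have "f x \<in> plaque c (f t)" if x: "x \<in> B" for x
  proof -
    have "coord_of c (f x) $ i = coord_of c (f t) $ i" if i: "i \<noteq> leaf_coord c" for i
    proof (rule LIMSEQ_unique[OF lim[OF x]])
      have "\<forall>\<^sub>F n in sequentially. coord_of c (s n t) $ i = coord_of c (s n x) $ i"
        using eventually_ge_at_top[of N]
      proof eventually_elim
        case (elim n)
        have "s n ` B \<subseteq> dom_of c" using r(2)[OF elim] by (auto simp: B_def dist_commute)
        then have "s n x \<in> plaque c (s n t)"
          using leafwise_in_plaque[OF s c _ B1 _ tB x] by (simp add: B_def)
        then show ?case using i by (simp add: plaque_def)
      qed
      then show "(\<lambda>n. coord_of c (s n x) $ i) \<longlonglongrightarrow> coord_of c (f t) $ i"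
        by (rule Lim_transform_eventually[OF lim[OF tB]])
    qed
    moreover have "x \<in> ball t r'" using x by (simp add: B_def)
    ultimately show ?thesis using r'(2) by (auto simp: plaque_def)
  qed
  then show "\<forall>\<^sub>F x in nhds t. f x \<in> plaque c (f t)"
    using eventually_nhds_in_open[of B t] tB by (auto simp: B_def elim: eventually_mono)
qed

lemma plaque_point_tendsto:
  assumes c: "c \<in> F" and q: "\<And>n. q n \<in> dom_of c" "p \<in> dom_of c" "q \<longlonglongrightarrow> p" and v: "v \<in> ball 0 1"
  shows "(\<lambda>n. plaque_point c (q n) v) \<longlonglongrightarrow> plaque_point c p v"
  unfolding plaque_point_def
proof (rule continuous_on_tendsto_compose[OF coord_inv_continuous[OF c]])
  have "(\<lambda>n. coord_of c (q n)) \<longlonglongrightarrow> coord_of c p"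
    by (rule continuous_on_tendsto_compose[OF coord_continuous[OF c] q(3,2)]) (simp add: q(1))
  then have "(\<lambda>n. if i = leaf_coord c then v else coord_of c (q n) $ i) \<longlonglongrightarrow>
      (if i = leaf_coord c then v else coord_of c p $ i)" for i
    by (cases "i = leaf_coord c") (auto intro: tendsto_vec_nth)
  then show "(\<lambda>n. \<chi> i. if i = leaf_coord c then v else coord_of c (q n) $ i) \<longlonglongrightarrow>
      (\<chi> i. if i = leaf_coord c then v else coord_of c p $ i)"
    by (rule tendsto_vec_lambda)
qed (use coord_ball[OF c q(1)] coord_ball[OF c q(2)] v in auto)

text \<open>All sections are taken through the same parameter \<sigma>, while the plaque, that of
  \<open>s n\<close> at \<sigma>, moves with \<open>n\<close>. Montel gives a limit section
  \<open>g\<close>; the issue is that \<open>g\<close> might take values on the unit circle, where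
  \<open>f\<close> is not controlled.\<close>

lemma has_plaque_sections_limit:
  assumes s: "\<And>n. has_plaque_sections F (s n)" and conv: "converges_continuously s f (ball 0 1)"
  shows "has_plaque_sections F f"
  unfolding has_plaque_sections_def
proof (intro ballI impI)
  fix \<sigma> c assume \<sigma>: "\<sigma> \<in> ball (0::complex) 1" and c: "c \<in> F" and p: "f \<sigma> \<in> dom_of c"
  obtain r N where r: "r > 0" "\<And>k x. k \<ge> N \<Longrightarrow> dist x \<sigma> < r \<Longrightarrow> s k x \<in> dom_of c"
    using converges_continuouslyD[OF conv \<sigma> dom_open[OF c] p] by metis
  \<comment> \<open>The shift by \<open>N\<close> puts every \<open>s' n \<sigma>\<close> into the
    domain of \<open>c\<close>, so that a section exists for each index.\<close>
  define s' where "s' n = s (n + N)" for n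
  have conv': "converges_continuously s' f (ball 0 1)"
    unfolding s'_def by (rule converges_continuously_subseq[OF conv]) (simp add: strict_mono_def)
  define q where "q n = s' n \<sigma>" for n
  have q: "q n \<in> dom_of c" for n using r(2)[of "n + N" \<sigma>] r(1) by (simp add: q_def s'_def)
  have "\<exists>\<psi>. \<psi> holomorphic_on ball 0 1 \<and> \<psi> ` ball 0 1 \<subseteq> ball 0 1 \<and>
      \<psi> (coord_of c (q n) $ leaf_coord c) = \<sigma> \<and> (\<forall>v\<in>ball 0 1. s' n (\<psi> v) = plaque_point c (q n) v)" for n
    using s[of "n + N", unfolded has_plaque_sections_def, rule_format, OF \<sigma> c] q[of n]
    by (simp add: q_def s'_def)
  then obtain \<psi> where \<psi>: "\<And>n. \<psi> n holomorphic_on ball 0 1" "\<And>n. \<psi> n ` ball 0 1 \<subseteq> ball 0 1"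
      "\<And>n. \<psi> n (coord_of c (q n) $ leaf_coord c) = \<sigma>"
      "\<And>n v. v \<in> ball 0 1 \<Longrightarrow> s' n (\<psi> n v) = plaque_point c (q n) v"
    by metis
  have q_lim: "q \<longlonglongrightarrow> f \<sigma>"
    unfolding q_def by (rule converges_continuously_compose[OF conv' \<sigma>]) simp
  obtain g \<rho> where g: "g holomorphic_on ball 0 1" and \<rho>: "strict_mono (\<rho> :: nat \<Rightarrow> nat)"
    and pw: "\<And>x. x \<in> ball 0 1 \<Longrightarrow> (\<lambda>n. \<psi> (\<rho> n) x) \<longlonglongrightarrow> g x"
    and ul: "\<And>K. compact K \<Longrightarrow> K \<subseteq> ball 0 1 \<Longrightarrow> uniform_limit K (\<psi> \<circ> \<rho>) g sequentially"
  proof (rule Montel[of "ball 0 1" "{h. h holomorphic_on ball 0 1 \<and> h ` ball 0 1 \<subseteq> ball 0 1}" \<psi>])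
    show "\<exists>B. \<forall>h\<in>{h. h holomorphic_on ball 0 1 \<and> h ` ball 0 1 \<subseteq> ball 0 1}. \<forall>z\<in>K. cmod (h z) \<le> B"
      if "compact K" "K \<subseteq> ball 0 1" for K
    proof (intro exI[of _ 1] ballI)
      fix h z assume "h \<in> {h. h holomorphic_on ball 0 1 \<and> h ` ball 0 1 \<subseteq> ball 0 1}" "z \<in> K"
      then have "h z \<in> ball 0 1" using that(2) by blast
      then show "cmod (h z) \<le> 1" by simp
    qed
    show "range \<psi> \<subseteq> {h. h holomorphic_on ball 0 1 \<and> h ` ball 0 1 \<subseteq> ball 0 1}"
      using \<psi>(1,2) by blast
  qed auto
  let ?u = "coord_of c (f \<sigma>) $ leaf_coord c"
  have u: "?u \<in> ball 0 1" by (rule coord_ball[OF c p])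
  have g\<psi>: "converges_continuously (\<psi> \<circ> \<rho>) g (ball 0 1)"
    by (rule uniform_limit_imp_converges_continuously[OF open_ball holomorphic_on_imp_continuous_on[OF g] ul])
  have "(\<lambda>n. coord_of c (q n)) \<longlonglongrightarrow> coord_of c (f \<sigma>)"
    by (rule continuous_on_tendsto_compose[OF coord_continuous[OF c] q_lim p]) (simp add: q)
  then have "(\<lambda>n. coord_of c (q n) $ leaf_coord c) \<longlonglongrightarrow> ?u" by (rule tendsto_vec_nth)
  then have "(\<lambda>n. coord_of c (q (\<rho> n)) $ leaf_coord c) \<longlonglongrightarrow> ?u"
    using LIMSEQ_subseq_LIMSEQ[OF _ \<rho>] by (auto simp: o_def)
  \<comment> \<open>The section number \<open>n\<close> takes the value \<sigma> at a point
    depending on \<open>n\<close>; convergence at moving points transfers this to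
    \<open>g ?u = \<sigma>\<close>.\<close>
  from converges_continuously_compose[OF g\<psi> u this]
  have "(\<lambda>n. \<sigma>) \<longlonglongrightarrow> g ?u" by (simp add: \<psi>(3))
  then have gu: "g ?u = \<sigma>" by (simp add: LIMSEQ_const_iff)
  have g1: "cmod (g x) \<le> 1" if x: "x \<in> ball 0 1" for x
  proof (rule Lim_bounded[OF tendsto_norm[OF pw[OF x]], of 0], intro allI impI)
    fix n
    have "\<psi> (\<rho> n) x \<in> ball 0 1" using \<psi>(2) x by blast
    then show "cmod (\<psi> (\<rho> n) x) \<le> 1" by simp
  qed
  have gball: "g x \<in> ball 0 1" if x: "x \<in> ball 0 1" for x
  proof (rule ccontr)
    assume "g x \<notin> ball 0 1"
    then have gx: "cmod (g x) = 1" using g1[OF x] by simp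
    \<comment> \<open>A value of modulus 1 would be an interior maximum, so \<open>g\<close> would
      be constant of modulus 1, against \<open>g ?u = \<sigma>\<close> with \<sigma> inside the
      disc.\<close>
    have "g constant_on ball 0 1"
      by (rule maximum_modulus_principle[OF g open_ball connected_ball open_ball order_refl x])
         (use g1 gx in simp)
    then have "g ?u = g x" using u x unfolding constant_on_def by metis
    then show False using gu gx \<sigma> by simp
  qed
  have "f (g v) = plaque_point c (f \<sigma>) v" if v: "v \<in> ball 0 1" for v
  proof (rule LIMSEQ_unique)
    show "(\<lambda>n. plaque_point c (q (\<rho> n)) v) \<longlonglongrightarrow> plaque_point c (f \<sigma>) v"
      using plaque_point_tendsto[OF c _ p _ v, of "\<lambda>n. q (\<rho> n)"] q LIMSEQ_subseq_LIMSEQ[OF q_lim \<rho>]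
      by (simp add: o_def)
    have "(\<lambda>n. s' (\<rho> n) (\<psi> (\<rho> n) v)) \<longlonglongrightarrow> f (g v)"
      by (rule converges_continuously_compose[OF converges_continuously_subseq[OF conv' \<rho>] gball[OF v] pw[OF v]])
    then show "(\<lambda>n. plaque_point c (q (\<rho> n)) v) \<longlonglongrightarrow> f (g v)"
      by (simp add: \<psi>(4)[OF v])
  qed
  then show "\<exists>\<psi>. \<psi> holomorphic_on ball 0 1 \<and> \<psi> ` ball 0 1 \<subseteq> ball 0 1 \<and> \<psi> ?u = \<sigma> \<and>
      (\<forall>u\<in>ball 0 1. f (\<psi> u) = plaque_point c (f \<sigma>) u)"
    using g gu gball by (intro exI[of _ g]) auto
qed

end

section \<open>Small foliated charts\<close>

text \<open>The factor \<open>k\<close> accommodates the dilation in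
  \<open>subpolydisc_chart\<close>; it is absorbed into the gradients.\<close>

lemma holomorphic_transitionI:
  assumes "\<And>p. p \<in> fst c \<Longrightarrow> p \<in> fst d \<Longrightarrow>
      \<exists>M. (transition c d has_derivative (\<lambda>v. k *s (M *v v))) (at (snd c p))"
  shows "holomorphic_transition c d"
  unfolding holomorphic_transition_def holomorphic_mv_def
proof (intro allI ballI)
  fix i x assume "x \<in> snd c ` (fst c \<inter> fst d)"
  then obtain p where p: "p \<in> fst c" "p \<in> fst d" "x = snd c p" by blast
  then obtain M where M: "(transition c d has_derivative (\<lambda>v. k *s (M *v v))) (at x)"
    using assms by blast
  have "((\<lambda>x. transition c d x $ i) has_derivative (\<lambda>v. (k *s (M *v v)) $ i)) (at x)"
    by (rule bounded_linear.has_derivative[OF bounded_linear_vec_nth M])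
  then have "((\<lambda>x. transition c d x $ i) has_derivative (\<lambda>v. \<Sum>j\<in>UNIV. (k *s M $ i) $ j * v $ j)) (at x)"
    by (simp add: matrix_vector_mult_def sum_distrib_left mult.assoc)
  then show "\<exists>a. ((\<lambda>x. transition c d x $ i) has_derivative (\<lambda>v. \<Sum>j\<in>UNIV. a $ j * v $ j)) (at x)"
    by (rule exI)
qed

lemma scale_has_derivative:
  assumes "(f has_derivative D) (at x within S)"
  shows "((\<lambda>x. (k::complex) *s f x) has_derivative (\<lambda>v. k *s D v)) (at x within S)"
proof (rule has_derivative_vec_componentwise)
  fix i
  have "((\<lambda>x. f x $ i) has_derivative (\<lambda>v. D v $ i)) (at x within S)"
    by (rule bounded_linear.has_derivative[OF bounded_linear_vec_nth assms])
  then show "((\<lambda>x. (k *s f x) $ i) has_derivative (\<lambda>v. (k *s D v) $ i)) (at x within S)"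
    by (simp add: has_derivative_mult_right)
qed

lemma scale_continuous_on:
  "continuous_on S f \<Longrightarrow> continuous_on S (\<lambda>x. (k::complex) *s f x)"
  unfolding vector_scalar_mult_def by (intro continuous_intros)

lemma open_polydisc: "open {z :: complex^'m. \<forall>i. cmod (z $ i - a $ i) < e}"
proof -
  have "{z :: complex^'m. \<forall>i. cmod (z $ i - a $ i) < e} = (\<Inter>i\<in>UNIV. {z. cmod (z $ i - a $ i) < e})"
    by auto
  also have "open \<dots>"
    by (intro open_INT finite ballI open_Collect_less continuous_intros)
  finally show ?thesis .
qed

lemma polydisc_subset_ball:
  fixes a :: "complex^'m"
  shows "{z. \<forall>i. cmod (z $ i - a $ i) < e / CARD('m)} \<subseteq> ball a e"
proof
  fix z assume z: "z \<in> {z. \<forall>i. cmod (z $ i - a $ i) < e / CARD('m)}"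
  have "norm (z - a) \<le> (\<Sum>i\<in>UNIV. norm ((z - a) $ i))"
    unfolding norm_vec_def by (rule L2_set_le_sum) simp
  also have "\<dots> < e"
    using sum_bounded_above_strict[of "UNIV :: 'm set" "\<lambda>i. norm ((z - a) $ i)" "e / CARD('m)"] z
    by simp
  finally show "z \<in> ball a e" by (simp add: dist_norm norm_minus_commute)
qed

context foliated_manifold
begin

text \<open>Charts of the restricted foliation must lie in \<open>U\<close> and still fill the unit
  polydisc. A small polydisc around the coordinates of \<open>p\<close> is therefore translated and
  dilated to unit size; this affects neither the leaf direction nor the equations of
  plaques.\<close>

lemma subpolydisc_chart:
  assumes c: "c \<in> F" and p: "p \<in> dom_of c" and U: "open U" "p \<in> U"
  obtains c' where "c' \<in> restrict_foliation A F U" "p \<in> dom_of c'" "open (dom_of c')"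
    "\<And>x y. x \<in> dom_of c' \<Longrightarrow> y \<in> dom_of c' \<Longrightarrow> y \<in> plaque c x \<Longrightarrow> y \<in> plaque c' x"
proof -
  let ?K = "coord_of c"
  define a where "a = ?K p"
  note c_top = topological[OF chart_of_in[OF c]]
  have "open (?K ` (dom_of c \<inter> U))"
    using open_chart_image[OF c_top U(1)] by simp
  moreover have "a \<in> ?K ` (dom_of c \<inter> U)" using p U by (simp add: a_def)
  ultimately obtain \<delta> where \<delta>: "\<delta> > 0" "ball a \<delta> \<subseteq> ?K ` (dom_of c \<inter> U)"
    by (rule openE)
  \<comment> \<open>The Euclidean norm is at most the sum of the \<open>CARD('m)\<close> component
    moduli, so a polydisc of this radius fits into \<open>ball a \<delta>\<close>.\<close>
  define \<epsilon> where "\<epsilon> = \<delta> / CARD('m)"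
  have \<epsilon>: "\<epsilon> > 0" using \<delta>(1) by (simp add: \<epsilon>_def)
  define e where "e = complex_of_real \<epsilon>"
  have e: "e \<noteq> 0" "cmod e = \<epsilon>" using \<epsilon> by (simp_all add: e_def)
  define P where "P = {z. \<forall>i. cmod (z $ i - a $ i) < \<epsilon>}"
  define Q where "Q = {z::complex^'m. \<forall>i. cmod (z $ i) < 1}"
  have PK: "P \<subseteq> ?K ` (dom_of c \<inter> U)"
    using polydisc_subset_ball[of a \<delta>] \<delta>(2) unfolding P_def \<epsilon>_def by (rule subset_trans)
  have oP: "open P" unfolding P_def by (rule open_polydisc)
  have oQ: "open Q" using open_polydisc[of 0 1] by (simp add: Q_def)
  define T where "T z = inverse e *s (z - a)" for z
  define T' where "T' w = a + e *s w" for w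
  have TT: "T' (T z) = z" "T (T' z) = z" for z
    using e by (simp_all add: T_def T'_def vec_eq_iff)
  have T'P: "T' w \<in> P" if "w \<in> Q" for w
    using that e \<epsilon> by (simp add: T'_def P_def Q_def norm_mult)
  have TQ: "T z \<in> Q" if "z \<in> P" for z
    using that e \<epsilon> by (simp add: T_def P_def Q_def norm_mult norm_inverse norm_divide divide_simps)
  define D where "D = dom_of c \<inter> ?K -` P"
  have oD: "open D" unfolding D_def by (rule continuous_open_preimage[OF coord_continuous[OF c] dom_open[OF c] oP])
  have KD: "?K ` D = P" using PK by (auto simp: D_def)
  have DU: "D \<subseteq> U"
  proof
    fix x assume x: "x \<in> D"
    then have "?K x \<in> ?K ` (dom_of c \<inter> U)" using PK by (auto simp: D_def)
    then obtain y where "y \<in> dom_of c \<inter> U" "?K x = ?K y" by blast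
    then show "x \<in> U" using x inj_onD[OF coord_inj[OF c]] by (auto simp: D_def)
  qed
  define N where "N x = T (?K x)" for x
  have ND: "N ` D = Q"
  proof (intro equalityI subsetI)
    fix w assume "w \<in> N ` D"
    then show "w \<in> Q" using TQ KD by (auto simp: N_def)
  next
    fix w assume "w \<in> Q"
    then have "T' w \<in> ?K ` D" using T'P KD by simp
    then obtain x where "x \<in> D" "T' w = ?K x" by blast
    then show "w \<in> N ` D" using TT(2)[of w] by (intro image_eqI[of _ _ x]) (simp_all add: N_def)
  qed
  have Ninj: "inj_on N D"
  proof (rule inj_onI)
    fix x y assume xy: "x \<in> D" "y \<in> D" "N x = N y"
    then have "?K x = ?K y" using TT(1) by (metis N_def)
    then show "x = y" using xy inj_onD[OF coord_inj[OF c]] by (auto simp: D_def)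
  qed
  have inv: "inv_into D N w = inv_into (dom_of c) ?K (T' w)" if w: "w \<in> Q" for w
  proof -
    obtain x where x: "x \<in> D" "w = N x" using w ND by blast
    have "inv_into D N w = x" using x Ninj by simp
    moreover have "inv_into (dom_of c) ?K (T' w) = x"
      using x TT(1) coord_inj[OF c] by (simp add: N_def D_def)
    ultimately show ?thesis by simp
  qed
  have top: "topological_chart (D, N)"
    unfolding topological_chart_def fst_conv snd_conv ND
  proof (intro conjI exI)
    show "open D" "open Q" by (fact oD oQ)+
    show "homeomorphism D Q N (inv_into D N)"
      unfolding homeomorphism_def
    proof (intro conjI ballI)
      show "\<And>x. x \<in> D \<Longrightarrow> inv_into D N (N x) = x" using Ninj by simp
      show "N ` D = Q" by (fact ND)
      have "continuous_on D ?K"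
        using coord_continuous[OF c] by (rule continuous_on_subset) (simp add: D_def)
      then show "continuous_on D N"
        unfolding N_def T_def by (intro scale_continuous_on continuous_intros)
      show "\<And>y. y \<in> Q \<Longrightarrow> N (inv_into D N y) = y" using ND by (metis f_inv_into_f)
      show "inv_into D N ` Q = D" using ND Ninj by (metis inj_on_imp_bij_betw bij_betw_inv_into bij_betw_imp_surj_on)
      have "continuous_on Q (\<lambda>w. inv_into (dom_of c) ?K (T' w))"
      proof (rule continuous_on_compose2[OF coord_inv_continuous[OF c]])
        show "continuous_on Q T'"
          unfolding T'_def by (intro scale_continuous_on continuous_intros)
        have "P \<subseteq> {z. \<forall>i. cmod (z $ i) < 1}" using PK polydisc[OF c] by blast
        then show "T' ` Q \<subseteq> {z. \<forall>i. cmod (z $ i) < 1}" using T'P by blast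
      qed
      then show "continuous_on Q (inv_into D N)"
        by (rule continuous_on_eq) (simp add: inv)
    qed
  qed
  have der1: "(transition (D, N) d has_derivative (\<lambda>v. e *s (M *v v))) (at (N x))"
    if x: "x \<in> D" and M: "(transition (chart_of c) d has_derivative (\<lambda>v. M *v v)) (at (?K x))" for d M x
  proof -
    have "(T' has_derivative (\<lambda>v. e *s v)) (at (N x))"
      unfolding T'_def using scale_has_derivative[OF has_derivative_ident]
      by (rule has_derivative_add[OF has_derivative_const, THEN has_derivative_eq_rhs]) simp
    moreover have "T' (N x) = ?K x" by (simp add: N_def TT)
    ultimately have "((\<lambda>w. transition (chart_of c) d (T' w)) has_derivative (\<lambda>v. M *v (e *s v))) (at (N x))"
      using has_derivative_compose[of T' "\<lambda>v. e *s v" "N x" UNIV "transition (chart_of c) d"] M by simp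
    then have "(transition (D, N) d has_derivative (\<lambda>v. M *v (e *s v))) (at (N x))"
      by (rule has_derivative_transform_within_open[OF _ oQ])
         (use x ND inv in \<open>auto simp: transition_def\<close>)
    then show ?thesis by (simp add: vector_scalar_commute)
  qed
  have der2: "(transition d (D, N) has_derivative (\<lambda>v. inverse e *s (M *v v))) (at y)"
    if M: "(transition d (chart_of c) has_derivative (\<lambda>v. M *v v)) (at y)" for d M y
  proof -
    have "((\<lambda>z. inverse e *s (transition d (chart_of c) z - a)) has_derivative (\<lambda>v. inverse e *s (M *v v))) (at y)"
      using has_derivative_diff[OF M has_derivative_const[of a]] scale_has_derivative by fastforce
    moreover have "transition d (D, N) = (\<lambda>z. inverse e *s (transition d (chart_of c) z - a))"
      by (simp add: transition_def N_def T_def)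
    ultimately show ?thesis by simp
  qed
  have DA: "(D, N) \<in> A"
  proof -
    have "holomorphic_transition (D, N) d \<and> holomorphic_transition d (D, N)" if d: "d \<in> A" for d
    proof
      show "holomorphic_transition (D, N) d"
      proof (rule holomorphic_transitionI)
        fix x assume x: "x \<in> fst (D, N)" "x \<in> fst d"
        obtain M where "(transition (chart_of c) d has_derivative (\<lambda>v. M *v v)) (at (?K x))"
          using transition_has_derivative[OF chart_of_in[OF c] d, of x] x by (auto simp: D_def)
        from der1[OF _ this] x
        show "\<exists>M. (transition (D, N) d has_derivative (\<lambda>v. e *s (M *v v))) (at (snd (D, N) x))" by auto
      qed
      show "holomorphic_transition d (D, N)"
      proof (rule holomorphic_transitionI)
        fix x assume x: "x \<in> fst d" "x \<in> fst (D, N)"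
        obtain M where "(transition d (chart_of c) has_derivative (\<lambda>v. M *v v)) (at (snd d x))"
          using transition_has_derivative[OF d chart_of_in[OF c], of x] x by (auto simp: D_def)
        from der2[OF this]
        show "\<exists>M. (transition d (D, N) has_derivative (\<lambda>v. inverse e *s (M *v v))) (at (snd d x))" by (rule exI)
      qed
    qed
    \<comment> \<open>Maximality of the atlas admits the new chart, which is why transitions in both
      directions with every chart of \<open>A\<close> were checked.\<close>
    then show ?thesis using complex_str top unfolding complex_structure_def by blast
  qed
  define c' where "c' = (D, N, leaf_coord c)"
  \<comment> \<open>The Jacobians only acquire the factor \<open>e\<close> or
    \<open>inverse e\<close>, so the entries that compatibility requires to vanish still
    vanish.\<close>
  have comp: "foliation_compatible c' d \<and> foliation_compatible d c'" if d: "d \<in> F" for d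
  proof
    have cd: "foliation_compatible c d" "foliation_compatible d c"
      using foliated c d by (simp_all add: foliated_atlas_def)
    show "foliation_compatible c' d"
      unfolding foliation_compatible_def
    proof (intro ballI allI impI)
      fix x i assume x: "x \<in> dom_of c' \<inter> dom_of d" and i: "i \<noteq> leaf_coord d"
      then have x': "x \<in> D" "x \<in> dom_of c" "x \<in> dom_of d" by (auto simp: c'_def D_def)
      obtain M where M: "(transition (chart_of c) (chart_of d) has_derivative (\<lambda>v. M *v v)) (at (?K x))"
        using transition_has_derivative[OF chart_of_in[OF c] chart_of_in[OF d], of x] x' by auto
      have "(M *v axis (leaf_coord c) 1) $ i = 0"
        using frechet_derivative_at[OF M] cd(1) x' i by (auto simp: foliation_compatible_def)
      then show "frechet_derivative (transition (chart_of c') (chart_of d)) (at (coord_of c' x))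
          (axis (leaf_coord c') 1) $ i = 0"
        using frechet_derivative_at[OF der1[OF x'(1) M], symmetric] by (simp add: c'_def)
    qed
    show "foliation_compatible d c'"
      unfolding foliation_compatible_def
    proof (intro ballI allI impI)
      fix x i assume x: "x \<in> dom_of d \<inter> dom_of c'" and i: "i \<noteq> leaf_coord c'"
      then have x': "x \<in> D" "x \<in> dom_of c" "x \<in> dom_of d" "i \<noteq> leaf_coord c" by (auto simp: c'_def D_def)
      obtain M where M: "(transition (chart_of d) (chart_of c) has_derivative (\<lambda>v. M *v v)) (at (coord_of d x))"
        using transition_has_derivative[OF chart_of_in[OF d] chart_of_in[OF c], of x] x' by auto
      have "(M *v axis (leaf_coord d) 1) $ i = 0"
        using frechet_derivative_at[OF M] cd(2) x' by (auto simp: foliation_compatible_def)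
      then show "frechet_derivative (transition (chart_of d) (chart_of c')) (at (coord_of d x))
          (axis (leaf_coord d) 1) $ i = 0"
        using frechet_derivative_at[OF der2[OF M], symmetric] by (simp add: c'_def)
    qed
  qed
  have "foliated_chart A c'"
    using DA ND by (simp add: foliated_chart_def c'_def Q_def)
  moreover have "dom_of c' \<subseteq> U \<inter> (\<Union>d\<in>F. dom_of d)"
    using DU c by (auto simp: c'_def D_def)
  ultimately have "c' \<in> restrict_foliation A F U"
    using comp by (simp add: restrict_foliation_def)
  moreover have "p \<in> dom_of c'" using p \<epsilon> by (simp add: c'_def D_def P_def a_def)
  moreover have "open (dom_of c')" using oD by (simp add: c'_def)
  moreover have "y \<in> plaque c' x" if "x \<in> dom_of c'" "y \<in> dom_of c'" "y \<in> plaque c x" for x y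
    using that by (simp add: plaque_def c'_def N_def T_def)
  ultimately show thesis by (rule that)
qed

section \<open>Limits of uniformizations avoid the singular set\<close>

text \<open>Invariance propagates along plaques of charts inside \<open>U\<close>. With such a chart
  around each \<open>f x\<close>, membership in \<open>S\<close> is locally constant along the
  connected set \<open>B\<close>.\<close>

lemma leafwise_invariant_hypersurface:
  assumes f: "holomorphic_disc A f" "leafwise F f"
    and U: "open U" and S: "invariant_hypersurface A F E U S"
    and B: "connected B" "B \<subseteq> ball 0 1" "f ` B \<subseteq> U"
    and st: "s \<in> B" "t \<in> B" "f s \<in> S"
  shows "f t \<in> S"
proof -
  have inv: "y \<in> S" if "x \<in> S" "x \<notin> E" "c \<in> restrict_foliation A F U" "x \<in> dom_of c" "y \<in> plaque c x" for x y c
  proof -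
    have "y \<in> leaf (restrict_foliation A F U) x"
      unfolding leaf_def mem_Collect_eq by (rule r_into_rtranclp) (use that in blast)
    then show ?thesis using S that(1,2) by (auto simp: invariant_hypersurface_def)
  qed
  have "(f s \<in> S) = (f t \<in> S)"
  proof (rule connected_local_const[OF B(1) st(1,2)], intro ballI)
    fix x assume x: "x \<in> B"
    then have x1: "x \<in> ball 0 1" "f x \<in> U" using B by blast+
    have xE: "f x \<notin> E" using leafwise_dom[OF f(2) x1(1)] by simp
    obtain c where c: "c \<in> F" "f x \<in> dom_of c"
      using leafwise_dom[OF f(2) x1(1)] foliated_chart_at by blast
    obtain c' where c': "c' \<in> restrict_foliation A F U" "f x \<in> dom_of c'" "open (dom_of c')"
      "\<And>x y. x \<in> dom_of c' \<Longrightarrow> y \<in> dom_of c' \<Longrightarrow> y \<in> plaque c x \<Longrightarrow> y \<in> plaque c' x"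
      using subpolydisc_chart[OF c U x1(2)] by blast
    have "\<forall>\<^sub>F y in nhds x. f y \<in> plaque c (f x)"
      using f(2) c x1(1) by (simp add: leafwise_def)
    moreover have "\<forall>\<^sub>F y in nhds x. y \<in> ball 0 1 \<and> f y \<in> dom_of c'"
      by (rule disc_eventually[OF f(1) c'(3) x1(1) c'(2)])
    ultimately have "\<forall>\<^sub>F y in nhds x. (f x \<in> S) = (f y \<in> S)"
    proof eventually_elim
      case (elim y)
      have "f y \<notin> E" using leafwise_dom[OF f(2)] elim by blast
      moreover have "f y \<in> plaque c' (f x)" using c'(4)[OF c'(2)] elim by blast
      \<comment> \<open>Lying in a common plaque is symmetric; this direction carries membership in
        \<open>S\<close> from \<open>f y\<close> back to \<open>f x\<close>, so that non-membership
        is locally constant too.\<close>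
      moreover have "f x \<in> plaque c' (f y)"
        using c'(4)[of "f y" "f x"] elim c'(2) plaque_eq[of "f y" c "f x"] plaque_self[OF c(2)] by simp
      ultimately show ?case using inv c'(1,2) elim xE by blast
    qed
    then show "\<forall>\<^sub>F y in at x within B. (f x \<in> S) = (f y \<in> S)"
      unfolding eventually_at_filter by (rule eventually_mono) simp
  qed
  then show ?thesis using st(3) by simp
qed

lemma limit_in_invariant_hypersurface:
  assumes s: "\<And>n. holomorphic_disc A (s n)" "\<And>n. leafwise F (s n)"
    and f: "holomorphic_disc A f" and conv: "converges_continuously s f (ball 0 1)"
    and U: "open U" and S: "invariant_hypersurface A F E U S"
    and B: "open B" "connected B" "B \<subseteq> ball 0 1" "\<And>n. n \<ge> N \<Longrightarrow> s n ` B \<subseteq> U" "f ` B \<subseteq> U"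
    and t: "a \<in> B" "t \<in> B" "f a \<in> S"
  shows "f t \<in> S"
proof -
  obtain h where h: "holomorphic_fun A h U" "S = {x \<in> U. h x = 0}"
    using S by (auto simp: invariant_hypersurface_def analytic_hypersurface_def)
  have hf: "(\<lambda>t. h (f t)) holomorphic_on B" by (rule holomorphic_fun_disc[OF f h(1) U B(1,3,5)])
  have hs: "(\<lambda>t. h (s n t)) holomorphic_on B" if "n \<ge> N" for n
    by (rule holomorphic_fun_disc[OF s(1) h(1) U B(1,3) B(4)[OF that]])
  have convB: "converges_continuously s f B"
    using conv B(3) by (auto simp: converges_continuously_def)
  have convh: "converges_continuously (\<lambda>n t. h (s n t)) (\<lambda>t. h (f t)) B"
    by (rule converges_continuously_image[OF convB U holomorphic_fun_continuous[OF h(1) U] B(5)])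
  have all: "h (s n x) = 0" if n: "n \<ge> N" "y \<in> B" "h (s n y) = 0" "x \<in> B" for n x y
  proof -
    have "s n y \<in> S" using h(2) B(4)[OF n(1)] n by blast
    from leafwise_invariant_hypersurface[OF s(1) s(2) U S B(2,3) B(4)[OF n(1)] n(2,4) this]
    show ?thesis using h(2) by simp
  qed
  have "h (f t) = 0"
  proof (rule ccontr)
    assume ht: "h (f t) \<noteq> 0"
    have "(\<lambda>n. h (s n t)) \<longlonglongrightarrow> h (f t)"
      by (rule converges_continuously_compose[OF convh t(2) tendsto_const])
    then have "\<forall>\<^sub>F n in sequentially. h (s n t) \<noteq> 0"
      using ht by (rule tendsto_imp_eventually_ne)
    then obtain N' where N': "\<And>n. n \<ge> N' \<Longrightarrow> h (s n t) \<noteq> 0" by (auto simp: eventually_sequentially)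
    \<comment> \<open>The shift by \<open>N\<close> keeps the maps inside \<open>U\<close> on
      \<open>B\<close>; the shift by \<open>N'\<close> makes them nonzero at \<open>t\<close>, and
      invariance spreads this to all of \<open>B\<close>, as Hurwitz requires for every
      index.\<close>
    define \<F> where "\<F> n = (\<lambda>x. h (s (n + (N + N')) x))" for n
    have "(\<lambda>x. h (f x)) a \<noteq> 0"
    proof (rule Hurwitz_no_zeros[where S=B and \<F>=\<F> and g="\<lambda>x. h (f x)"])
      show "open B" "connected B" by (fact B)+
      show "\<F> n holomorphic_on B" for n unfolding \<F>_def by (rule hs) simp
      show "(\<lambda>x. h (f x)) holomorphic_on B" by (fact hf)
      show "\<F> n z \<noteq> 0" if "z \<in> B" for n z
        using all[of "n + (N + N')" z t] N'[of "n + (N + N')"] that t(2) by (auto simp: \<F>_def)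
      show "a \<in> B" by (fact t)
      show "\<not> (\<lambda>x. h (f x)) constant_on B"
        \<comment> \<open>The limit function vanishes at \<open>a\<close>, where \<open>f\<close>
          meets \<open>S\<close>, but not at \<open>t\<close>.\<close>
        using t ht h(2) by (auto simp: constant_on_def)
      show "uniform_limit K \<F> (\<lambda>x. h (f x)) sequentially" if K: "compact K" "K \<subseteq> B" for K
      proof (rule converges_continuously_imp_uniform_limit[OF _ K(1)])
        have "converges_continuously (\<lambda>n. (\<lambda>t. h (s (n + (N + N')) t))) (\<lambda>t. h (f t)) B"
          by (rule converges_continuously_subseq[OF convh]) (simp add: strict_mono_def)
        then show "converges_continuously \<F> (\<lambda>t. h (f t)) K"
          using K(2) by (auto simp: converges_continuously_def \<F>_def)
        show "continuous_on K (\<lambda>x. h (f x))"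
          using holomorphic_on_imp_continuous_on[OF hf] K(2) by (rule continuous_on_subset)
      qed
    qed
    then show False using t(3) h(2) by simp
  qed
  then show ?thesis using t(2) B(5) h(2) by blast
qed

lemma limit_avoids_singular_set:
  assumes s: "\<And>n. holomorphic_disc A (s n)" "\<And>n. leafwise F (s n)"
    and f: "holomorphic_disc A f" "f 0 \<in> - E" and conv: "converges_continuously s f (ball 0 1)"
    and hyp: "\<And>q. q \<in> E \<Longrightarrow> \<exists>U \<Sigma>. open U \<and> q \<in> U \<and>
           (\<forall>i \<in> I. invariant_hypersurface A F E U (\<Sigma> i)) \<and>
           q \<in> (\<Inter>i \<in> I. \<Sigma> i) \<and> (\<Inter>i \<in> I. \<Sigma> i) \<subseteq> U \<inter> E"
  shows "f ` ball 0 1 \<subseteq> - E"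
proof (rule image_subsetI)
  fix t :: complex assume t: "t \<in> ball 0 1"
  have "(f 0 \<in> E) = (f t \<in> E)"
  proof (rule connected_local_const[OF connected_ball[of 0 1] _ t], simp, intro ballI)
    fix x :: complex assume x: "x \<in> ball 0 1"
    have "\<forall>\<^sub>F y in nhds x. (f x \<in> E) = (f y \<in> E)"
    proof (cases "f x \<in> E")
      case False
      have "\<forall>\<^sub>F y in nhds x. y \<in> ball 0 1 \<and> f y \<in> - E"
        by (rule disc_eventually[OF f(1) _ x]) (use singular_closed False in auto)
      then show ?thesis by (rule eventually_mono) (use False in simp)
    next
      case True
      then obtain U \<Sigma> where U: "open U" "f x \<in> U" "\<forall>i \<in> I. invariant_hypersurface A F E U (\<Sigma> i)"
          "f x \<in> (\<Inter>i \<in> I. \<Sigma> i)" "(\<Inter>i \<in> I. \<Sigma> i) \<subseteq> U \<inter> E"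
        using hyp by metis
      obtain r N where r: "r > 0" "\<And>k y. k \<ge> N \<Longrightarrow> dist y x < r \<Longrightarrow> s k y \<in> U"
        using converges_continuouslyD[OF conv x U(1,2)] by metis
      have "open {y \<in> ball 0 1. f y \<in> U}" by (rule disc_preimage_open[OF f(1) U(1)])
      then obtain r' where r': "r' > 0" "ball x r' \<subseteq> {y \<in> ball 0 1. f y \<in> U}"
        using x U(2) open_contains_ball by (metis (mono_tags, lifting) mem_Collect_eq)
      define B where "B = ball x (min r r')"
      have xB: "x \<in> B" using r(1) r'(1) by (simp add: B_def)
      have Br: "B \<subseteq> ball x r" "B \<subseteq> ball x r'" by (auto simp: B_def)
      have B1: "B \<subseteq> ball 0 1" "f ` B \<subseteq> U" using Br(2) r'(2) by blast+
      have B2: "s n ` B \<subseteq> U" if "n \<ge> N" for n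
        using r(2)[OF that] Br(1) by (auto simp: dist_commute subset_iff)
      have "f y \<in> E" if y: "y \<in> B" for y
      proof -
        have "f y \<in> \<Sigma> i" if i: "i \<in> I" for i
          by (rule limit_in_invariant_hypersurface[OF s f(1) conv U(1) _ _ _ B1(1) B2 B1(2) xB y])
             (use U i in \<open>auto simp: B_def\<close>)
        then show ?thesis using U(5) by blast
      qed
      moreover have "\<forall>\<^sub>F y in nhds x. y \<in> B"
        by (rule eventually_nhds_in_open) (use xB in \<open>auto simp: B_def\<close>)
      ultimately show ?thesis using True by (auto elim: eventually_mono)
    qed
    then show "\<forall>\<^sub>F y in at x within ball 0 1. (f x \<in> E) = (f y \<in> E)"
      unfolding eventually_at_filter by (rule eventually_mono) simp
  qed
  then show "f t \<in> - E" using f(2) by simp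
qed

end

section \<open>Convergent sequences and subsequences\<close>

lemma compact_closure_convergent_range:
  fixes z :: "nat \<Rightarrow> 'a::t2_space"
  assumes "z \<longlonglongrightarrow> l"
  shows "compact (closure (range z))"
proof -
  \<comment> \<open>A member of an open cover that contains \<open>l\<close> absorbs all but
    finitely many terms. Being compact in a Hausdorff space, the set is closed and so contains the
    closure of the range.\<close>
  have c: "compact (insert l (range z))"
  proof (rule compactI)
    fix C assume C: "\<forall>T\<in>C. open T" "insert l (range z) \<subseteq> \<Union>C"
    then obtain T where T: "T \<in> C" "l \<in> T" by blast
    then have "\<forall>\<^sub>F n in sequentially. z n \<in> T"
      using topological_tendstoD[OF assms] C(1) by blast
    then obtain N where N: "\<And>n. n \<ge> N \<Longrightarrow> z n \<in> T" by (auto simp: eventually_sequentially)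
    have "\<exists>S. S \<in> C \<and> z n \<in> S" for n using C(2) by blast
    then obtain S where S: "\<And>n. S n \<in> C" "\<And>n. z n \<in> S n" by metis
    have "z n \<in> \<Union>(insert T (S ` {..<N}))" for n
      using N[of n] S(2)[of n] by (cases "n < N") auto
    then have "insert l (range z) \<subseteq> \<Union>(insert T (S ` {..<N}))" using T by blast
    moreover have "insert T (S ` {..<N}) \<subseteq> C" using T S by blast
    ultimately show "\<exists>C'\<subseteq>C. finite C' \<and> insert l (range z) \<subseteq> \<Union>C'"
      by (intro exI[of _ "insert T (S ` {..<N})"]) simp
  qed
  then have "closure (range z) \<subseteq> insert l (range z)"
    by (intro closure_minimal compact_imp_closed) auto
  then show ?thesis
    using compact_Int_closed[OF c closed_closure[of "range z"]] by (simp add: inf.absorb2)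
qed

text \<open>Normality only yields subsequences, and different ones may have different limit maps.
  The criterion suffices because all these limits compute the same value of \<eta>.\<close>

lemma tendsto_sequentially_subseqI:
  fixes x :: "nat \<Rightarrow> 'a::topological_space"
  assumes "\<And>r. strict_mono (r :: nat \<Rightarrow> nat) \<Longrightarrow> \<exists>q. strict_mono (q :: nat \<Rightarrow> nat) \<and> (\<lambda>n. x (r (q n))) \<longlonglongrightarrow> l"
  shows "x \<longlonglongrightarrow> l"
proof (rule topological_tendstoI, rule ccontr)
  fix S assume S: "open S" "l \<in> S" and "\<not> (\<forall>\<^sub>F n in sequentially. x n \<in> S)"
  then have "\<exists>\<^sub>F n in sequentially. x n \<notin> S" by (simp add: not_eventually)
  then have "infinite {n. x n \<notin> S}"
    by (simp add: frequently_sequentially infinite_nat_iff_unbounded_le)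
  then obtain r :: "nat \<Rightarrow> nat" where r: "strict_mono r" "\<And>n. r n \<in> {n. x n \<notin> S}"
    using infinite_enumerate by blast
  obtain q where q: "(\<lambda>n. x (r (q n))) \<longlonglongrightarrow> l" using assms[OF r(1)] by blast
  have "\<forall>\<^sub>F n in sequentially. x (r (q n)) \<in> S" by (rule topological_tendstoD[OF q S])
  then obtain n where "x (r (q n)) \<in> S" by (auto simp: eventually_sequentially)
  then show False using r(2) by blast
qed

theorem corollary1p13:
  fixes A :: "('a::{t2_space, second_countable_topology}, 'm::finite) chart set"
    and F :: "('a, 'm) fchart set"
    and E :: "'a set"
    and g :: "('a, 'm) chart \<Rightarrow> 'a \<Rightarrow> complex^'m^'m"
    and k :: nat
  assumes "complex_structure A"
    and "shfc A F E"
    and "has_analytic_dim A E k"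
    and "hyperbolic_foliation A F E"
    and "hermitian_metric A g"
    and "NCP A (uniformizations A F E)"
    and "\<And>q. q \<in> E \<Longrightarrow> \<exists>U \<Sigma>. open U \<and> q \<in> U \<and>
           (\<forall>i \<in> {1..CARD('m) - k}. invariant_hypersurface A F E U (\<Sigma> i)) \<and>
           q \<in> (\<Inter>i \<in> {1..CARD('m) - k}. \<Sigma> i) \<and>
           (\<Inter>i \<in> {1..CARD('m) - k}. \<Sigma> i) \<subseteq> U \<inter> E"
  shows "continuous_on (- E) (modulus_of_uniformization A F E g)"
proof -
  interpret foliated_manifold A F E
    by unfold_locales (use assms(1,2) in \<open>auto simp: shfc_def\<close>)
  let ?\<eta> = "modulus_of_uniformization A F E g"
  show ?thesis
  \<comment> \<open>Sequences detect continuity here because a second countable space is first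
    countable.\<close>
  proof (rule continuous_on_sequentiallyI)
    fix u a assume u: "\<forall>n. u n \<in> - E" and a: "a \<in> - E" and lim: "u \<longlonglongrightarrow> a"
    have "\<exists>\<alpha>. uniformization A F \<alpha> (leaf F (u n)) \<and> \<alpha> 0 = u n" for n
      using uniformization_at[OF assms(4)] u by blast
    then obtain \<alpha> where \<alpha>: "\<And>n. uniformization A F (\<alpha> n) (leaf F (u n))" "\<And>n. \<alpha> n 0 = u n"
      by metis
    have uE: "u n \<in> - E" for n using u by blast
    have hol: "holomorphic_disc A (\<alpha> n)" for n using \<alpha>(1) by (simp add: uniformization_def)
    have lw: "leafwise F (\<alpha> n)" for n by (rule uniformization_leafwise[OF \<alpha>(1) uE])
    have sec: "has_plaque_sections F (\<alpha> n)" for n by (rule uniformization_has_plaque_sections[OF \<alpha>(1) uE])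
    have unif: "range \<alpha> \<subseteq> uniformizations A F E"
    proof (rule image_subsetI)
      fix n
      have "\<alpha> n \<in> leaf_discs A F E"
        using hol uE[of n] uniformization_image[OF \<alpha>(1) uE, of n] unfolding leaf_discs_def by blast
      then show "\<alpha> n \<in> uniformizations A F E" using \<alpha>(1) uE unfolding uniformizations_def by blast
    qed
    \<comment> \<open>Since the uniformizations are centred, their base points are the convergent
      sequence \<open>u\<close> itself, which meets the compactness condition in NCP.\<close>
    have "(\<lambda>\<beta>. \<beta> 0) ` range \<alpha> = range u" using \<alpha>(2) by (simp add: image_image)
    then have "compact (closure ((\<lambda>\<beta>. \<beta> 0) ` range \<alpha>))"
      using compact_closure_convergent_range[OF lim] by simp
    then have normal: "normal_family A (range \<alpha>)"
      using assms(6) unif by (simp add: NCP_def)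
    show "(\<lambda>n. ?\<eta> (u n)) \<longlonglongrightarrow> ?\<eta> a"
    proof (rule tendsto_sequentially_subseqI)
      fix r :: "nat \<Rightarrow> nat" assume r: "strict_mono r"
      have "range (\<alpha> \<circ> r) \<subseteq> range \<alpha>" by auto
      then obtain q f where q: "strict_mono (q :: nat \<Rightarrow> nat)" and f: "holomorphic_disc A f"
          and "converges_locally_uniformly (\<alpha> \<circ> r \<circ> q) f"
        using normal unfolding normal_family_def by blast
      then have conv: "converges_continuously (\<alpha> \<circ> r \<circ> q) f (ball 0 1)"
        by (intro converges_locally_uniformly_imp_continuously) (simp_all add: holomorphic_disc_def)
      define s where "s n = \<alpha> (r (q n))" for n
      have conv: "converges_continuously s f (ball 0 1)" using conv by (simp add: s_def[abs_def] o_def)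
      have s: "\<And>n. holomorphic_disc A (s n)" "\<And>n. leafwise F (s n)" "\<And>n. has_plaque_sections F (s n)"
        by (simp_all add: s_def hol lw sec)
      have "(\<lambda>n. s n 0) \<longlonglongrightarrow> f 0" by (rule converges_continuously_compose[OF conv]) auto
      moreover have "(\<lambda>n. s n 0) \<longlonglongrightarrow> a"
        using LIMSEQ_subseq_LIMSEQ[OF lim strict_mono_o[OF r q]] by (simp add: s_def \<alpha>(2) o_def)
      ultimately have f0: "f 0 = a" by (rule LIMSEQ_unique)
      \<comment> \<open>Regularity of \<open>f 0 = a\<close> fixes which alternative of the clopen
        argument holds.\<close>
      have "f ` ball 0 1 \<subseteq> - E"
        by (rule limit_avoids_singular_set[OF s(1,2) f _ conv assms(7)]) (simp add: f0 a[simplified])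
      then have fl: "leafwise F f" by (rule leafwise_limit[OF s(2) f _ conv])
      have fs: "has_plaque_sections F f" by (rule has_plaque_sections_limit[OF s(3) conv])
      have "(\<lambda>n. ereal (initial_speed A g (s n))) \<longlonglongrightarrow> ereal (initial_speed A g f)"
        using initial_speed_tendsto[OF s(1) f assms(5) conv] by simp
      moreover have "?\<eta> (u (r (q n))) = ereal (initial_speed A g (s n))" for n
        using modulus_of_uniformization_eq[OF assms(4,5) s(1-3), of n] by (simp add: s_def \<alpha>(2))
      moreover have "?\<eta> a = ereal (initial_speed A g f)"
        using modulus_of_uniformization_eq[OF assms(4,5) f fl fs] by (simp add: f0)
      ultimately show "\<exists>q. strict_mono (q :: nat \<Rightarrow> nat) \<and> (\<lambda>n. ?\<eta> (u (r (q n)))) \<longlonglongrightarrow> ?\<eta> a"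
        using q by auto
    qed
  qed
qed

end
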